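(* For each $n$, let $\mathbf{W}_n=n^{-1/2}\mathbf{X}_n$ be a normalized real Wigner matrix with uniformly controlled moments (as defined in the context), let $\mathbf{D}_n$ be the diagonal matrix of row sums of $\mathbf{W}_n$, $\mathbf{D}_n(j,j)=\sum_{k=1}^n\mathbf{W}_n(j,k)$, and for $p,q\in\mathbb{R}$ let $\mathbf{M}_{n,p,q}=p\mathbf{W}_n+q\mathbf{D}_n$. Then for all $p,q\in\mathbb{R}$ the empirical spectral distributions $\mu(\mathbf{M}_{n,p,q})$ converge weakly in expectation, as $n\to\infty$, to the free convolution $\mathcal{SC}(0,p^2)\boxplus\mathcal{N}(0,q^2)$.
   Context: Real Wigner matrices: $\mathbf{X}_n$ is a random real symmetric $n\times n$ matrix with independent entries $(\mathbf{X}_n(j,k):1\le j\le k\le n)$; for $j<k$, $\mathbb{E}\mathbf{X}_n(j,k)=0$ and $\mathbb{E}\mathbf{X}_n(j,k)^2=1$; and $\sup_n\sup_{1\le j\le k\le n}\mathbb{E}|\mathbf{X}_n(j,k)|^\ell<\infty$ for every $\ell\in\mathbb{N}$. The empirical spectral distribution of a Hermitian $\mathbf{A}_n$ with eigenvalues $\lambda_1,\dots,\lambda_n$ is $\mu(\mathbf{A}_n)=\frac1n\sum_k\delta_{\lambda_k}$; weak convergence in expectation means that the averaged probability measures $\mathbb{E}\mu(\mathbf{M}_{n,p,q})$ converge weakly. $\mathcal{SC}(0,\sigma^2)$ is the semicircle distribution $\frac{1}{2\pi\sigma^2}(4\sigma^2-x^2)_+^{1/2}dx$, $\mathcal{N}(0,\sigma^2)$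 the normal distribution (both $\delta_0$ if $\sigma=0$), and $\boxplus$ is free additive convolution. *)

theory Defs
  imports "HOL-Probability.Probability" "Jordan_Normal_Form.Char_Poly"
begin

section \<open>Wigner matrices and their row sums\<close>

text \<open>
  The space \<open>\<Omega> n\<close> may vary with \<open>n\<close>: no joint law of matrices of different sizes is needed.
  Matrix indices start at 0. The moments are taken in \<^typ>\<open>ennreal\<close>, so their finiteness includes the
  integrability of all powers of the entries.
\<close>

definition real_wigner :: "(nat \<Rightarrow> 'a measure) \<Rightarrow> (nat \<Rightarrow> 'a \<Rightarrow> real mat) \<Rightarrow> bool" where
  "real_wigner \<Omega> X \<longleftrightarrow>
    (\<forall>n. prob_space (\<Omega> n)) \<and>
    (\<forall>n. \<forall>\<omega>\<in>space (\<Omega> n). X n \<omega> \<in> carrier_mat n n \<and> transpose_mat (X n \<omega>) = X n \<omega>) \<and>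
    (\<forall>n. prob_space.indep_vars (\<Omega> n) (\<lambda>_. borel) (\<lambda>(j, k) \<omega>. X n \<omega> $$ (j, k))
           {(j, k). j \<le> k \<and> k < n}) \<and>
    (\<forall>n j k. j < k \<and> k < n \<longrightarrow>
       (\<integral>\<omega>. X n \<omega> $$ (j, k) \<partial>\<Omega> n) = 0 \<and> (\<integral>\<omega>. (X n \<omega> $$ (j, k))\<^sup>2 \<partial>\<Omega> n) = 1) \<and>
    (\<forall>l::nat. (\<Squnion>n. \<Squnion>(j, k)\<in>{(j, k). j \<le> k \<and> k < n}.
       \<integral>\<^sup>+\<omega>. ennreal (\<bar>X n \<omega> $$ (j, k)\<bar> ^ l) \<partial>\<Omega> n) < \<infinity>)"

definition row_sum_mat :: "real mat \<Rightarrow> real mat" where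
  "row_sum_mat A = mat_diag (dim_row A) (\<lambda>j. \<Sum>k<dim_col A. A $$ (j, k))"

section \<open>Empirical spectral distribution\<close>

text \<open>
  For a symmetric \<open>n \<times> n\<close> matrix with \<open>n \<ge> 1\<close>, \<^const>\<open>proots\<close> of the characteristic polynomial is the
  multiset of all \<open>n\<close> eigenvalues, and \<^const>\<open>pmf_of_multiset\<close> gives each of them the mass \<open>1 / n\<close>.
  The \<^const>\<open>distr\<close> only replaces the discrete \<open>\<sigma>\<close>-algebra by the Borel one.
\<close>

definition esd :: "real mat \<Rightarrow> real measure" where
  "esd A = distr (measure_pmf (pmf_of_multiset (proots (char_poly A)))) borel (\<lambda>x. x)"

text \<open>
  The averaged measure sends a Borel set \<open>B\<close> to the expectation of \<open>esd (A \<omega>) B\<close>, i.e. it is the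
  monadic bind of the random measure.
\<close>

definition expected_esd :: "'a measure \<Rightarrow> ('a \<Rightarrow> real mat) \<Rightarrow> real measure" where
  "expected_esd \<Omega> A = bind \<Omega> (\<lambda>\<omega>. esd (A \<omega>))"

section \<open>Semicircle and normal distributions\<close>

text \<open>The second parameter is the variance.\<close>

definition semicircle :: "real \<Rightarrow> real \<Rightarrow> real measure" where
  "semicircle m v =
    (if v = 0 then return borel m
     else density lborel (\<lambda>x. ennreal (sqrt (max 0 (4 * v - (x - m)\<^sup>2)) / (2 * pi * v))))"

definition normal_distr :: "real \<Rightarrow> real \<Rightarrow> real measure" where
  "normal_distr m v =
    (if v = 0 then return borel m
     else density lborel (\<lambda>x. ennreal (normal_density m (sqrt v) x)))"

section \<open>Free additive convolution\<close>

text \<open>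
  Since the normal distribution has unbounded support, we use the definition of Bercovici and
  Voiculescu (Free convolution of measures with unbounded support, 1993) for arbitrary probability
  measures on the real line: \<open>\<mu> \<boxplus> \<nu>\<close> is the probability measure whose Voiculescu transform is the sum
  of those of \<open>\<mu>\<close> and \<open>\<nu>\<close> on a common truncated cone.
\<close>

definition cauchy_transform :: "real measure \<Rightarrow> complex \<Rightarrow> complex" where
  "cauchy_transform \<mu> z = (\<integral>t. 1 / (z - complex_of_real t) \<partial>\<mu>)"

definition recip_cauchy :: "real measure \<Rightarrow> complex \<Rightarrow> complex" where
  "recip_cauchy \<mu> z = 1 / cauchy_transform \<mu> z"

definition trunc_cone :: "real \<Rightarrow> real \<Rightarrow> complex set" where
  "trunc_cone \<alpha> \<beta> = {z. Im z > \<beta> \<and> \<bar>Re z\<bar> < \<alpha> * Im z}"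

text \<open>
  With \<open>F\<close> the reciprocal Cauchy transform, \<open>\<phi> z = F\<^sup>-\<^sup>1 z - z\<close> on the cone with parameters \<open>\<alpha>\<close>, \<open>\<beta>\<close>;
  the inverse is that of the restriction of \<open>F\<close> to some truncated cone on which it is univalent.
  The values of \<open>\<phi>\<close> do not depend on the latter cone: as \<open>F w / w\<close> tends to 1 when \<open>w\<close> tends to
  infinity inside a truncated cone, two such inverses agree far out in a narrower cone, hence
  everywhere on the cone with parameters \<open>\<alpha>\<close>, \<open>\<beta>\<close> by analyticity.
\<close>

definition has_voiculescu_transform ::
    "real measure \<Rightarrow> (complex \<Rightarrow> complex) \<Rightarrow> real \<Rightarrow> real \<Rightarrow> bool" where
  "has_voiculescu_transform \<mu> \<phi> \<alpha> \<beta> \<longleftrightarrow>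
    (\<exists>\<alpha>'>0. \<exists>\<beta>'>0. inj_on (recip_cauchy \<mu>) (trunc_cone \<alpha>' \<beta>') \<and>
       trunc_cone \<alpha> \<beta> \<subseteq> recip_cauchy \<mu> ` trunc_cone \<alpha>' \<beta>' \<and>
       (\<forall>z\<in>trunc_cone \<alpha> \<beta>. \<phi> z = the_inv_into (trunc_cone \<alpha>' \<beta>') (recip_cauchy \<mu>) z - z))"

definition free_conv :: "real measure \<Rightarrow> real measure \<Rightarrow> real measure" (infixl "\<boxplus>" 65) where
  "\<mu> \<boxplus> \<nu> = (THE \<rho>. real_distribution \<rho> \<and>
     (\<exists>\<alpha>>0. \<exists>\<beta>>0. \<exists>\<phi> \<psi>. has_voiculescu_transform \<mu> \<phi> \<alpha> \<beta> \<and> has_voiculescu_transform \<nu> \<psi> \<alpha> \<beta> \<and>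
        has_voiculescu_transform \<rho> (\<lambda>z. \<phi> z + \<psi> z) \<alpha> \<beta>))"

end

(*
  With N = N(0, q^2), the averaged Cauchy transform G of M satisfies G(z) = G_N(z - p^2 G(z)) up to an
  error tending to 0, for Im z >= 1. Indeed, let R' be the resolvent of the model without the entries of
  the j-th row and column, w the j-th row of W and d its sum. Expanding along the j-th row, the j-th
  diagonal entry of the resolvent is close to 1 / (z - p^2 <w, R' w> - q d). The quadratic form is close to
  G: given R' it concentrates at the normalised trace, whose variance is small by the Efron-Stein
  inequality. Finally d is asymptotically normal, and since 1 / (zeta - q d) is a superposition of the
  characters of d, closeness of the characteristic functions is all that is needed.

  In the limit the equation says that the Voiculescu transform is p^2 / z + phi_N(z), where p^2 / z is that
  of the semicircle law. Existence of the free convolution need not be known in advance: the approximate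
  equation gives tightness, and any subsequential limit is a free convolution, which is unique by
  Stieltjes inversion.
*)

theory Submission
  imports Defs "HOL-Complex_Analysis.Complex_Analysis" "HOL-Real_Asymp.Real_Asymp"
begin

section \<open>Cauchy transforms\<close>

text \<open>The row sums are the obstacle. Removing the j-th row also changes every other diagonal
  entry of D, by the entry of w at that place, so the minor that is independent of the row differs
  from the full model by more than a row and a column. The expansion along the row therefore leaves
  a term p q <w, R' (w R e_j)>, \<open>cross\<close>, with the entrywise product of w and the j-th
  column of the full resolvent R. As R depends on w, conditioning does not help; the term is bounded
  pointwise by sums of squares and of fourth powers of the row, which leads to the rate n^(-1/4).

  Everything takes place at Im z \<ge> 1. There resolvents are contractions, and Cauchy transforms
  and traces have imaginary part \<le> 0, so that z - p^2 G stays in the same half plane and no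
  bound depends on z. Nothing is lost, because Cauchy transforms that agree on a set with an
  accumulation point agree on the upper half plane.\<close>

lemma norm_diff_of_real_ge: "\<bar>Im z\<bar> \<le> cmod (z - complex_of_real t)"
  using abs_Im_le_cmod[of "z - complex_of_real t"] by simp

lemma diff_of_real_nonzero: "Im z \<noteq> 0 \<Longrightarrow> z - complex_of_real t \<noteq> 0"
  by (metis Im_complex_of_real cancel_comm_monoid_add_class.diff_cancel eq_iff_diff_eq_0 right_minus_eq)

lemma norm_inverse_diff_le:
  assumes "0 < c" "c \<le> Im z"
  shows "cmod (1 / (z - complex_of_real t)) \<le> 1 / c"
  using norm_diff_of_real_ge[of z t] assms by (simp add: norm_divide frac_le)

context real_distribution
begin

lemma integrable_bounded:
  fixes f :: "real \<Rightarrow> 'b::{banach, second_countable_topology}"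
  assumes "f \<in> borel_measurable borel" "\<And>t. norm (f t) \<le> B"
  shows "integrable M f"
  using assms by (intro integrable_const_bound[where B = B]) auto

lemma norm_integral_le_const:
  fixes f :: "real \<Rightarrow> 'b::{banach, second_countable_topology}"
  assumes "f \<in> borel_measurable borel" "\<And>t. norm (f t) \<le> B"
  shows "norm (\<integral>t. f t \<partial>M) \<le> B"
proof -
  have "norm (\<integral>t. f t \<partial>M) \<le> (\<integral>t. norm (f t) \<partial>M)" by simp
  also have "\<dots> \<le> (\<integral>t. B \<partial>M)"
    using assms integrable_bounded[OF assms] by (intro integral_mono) auto
  finally show ?thesis using prob_space by simp
qed

lemma integrable_cauchy_kernel: "0 < Im z \<Longrightarrow> integrable M (\<lambda>t. 1 / (z - complex_of_real t))"
  using norm_inverse_diff_le[of "Im z" z] by (intro integrable_bounded[where B = "1 / Im z"]) auto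

lemma norm_cauchy_transform_le: "0 < c \<Longrightarrow> c \<le> Im z \<Longrightarrow> cmod (cauchy_transform M z) \<le> 1 / c"
  unfolding cauchy_transform_def by (rule norm_integral_le_const) (auto simp: norm_inverse_diff_le)

text \<open>Up to the factor \<open>pi\<close> this is the Poisson kernel of the upper half plane.
  Its positivity gives the sign of the transform, and its \<open>arctan\<close> primitive gives the
  inversion formula.\<close>

lemma neg_Im_cauchy_kernel:
  "- Im (1 / (z - complex_of_real t)) = Im z / ((Re z - t)\<^sup>2 + (Im z)\<^sup>2)"
  by (simp add: Im_divide power2_eq_square)

lemma Im_cauchy_transform:
  assumes "0 < Im z"
  shows "- Im (cauchy_transform M z) = (\<integral>t. Im z / ((Re z - t)\<^sup>2 + (Im z)\<^sup>2) \<partial>M)"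
proof -
  have "- Im (cauchy_transform M z) = (\<integral>t. - Im (1 / (z - complex_of_real t)) \<partial>M)"
    unfolding cauchy_transform_def integral_minus[symmetric]
    using integrable_cauchy_kernel[OF assms] by (simp add: integral_Im)
  then show ?thesis by (simp only: neg_Im_cauchy_kernel)
qed

text \<open>The strict sign keeps the transform away from 0, so that \<open>recip_cauchy\<close> is
  an honest quotient on the upper half plane. A vanishing integral of a positive function would make
  \<open>False\<close> hold almost everywhere in a probability space.\<close>

lemma Im_cauchy_transform_neg:
  assumes "0 < Im z"
  shows "Im (cauchy_transform M z) < 0"
proof -
  let ?f = "\<lambda>t. Im z / ((Re z - t)\<^sup>2 + (Im z)\<^sup>2)"
  have pos: "?f t > 0" for t
    using assms by (intro divide_pos_pos add_nonneg_pos) auto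
  have int: "integrable M ?f"
    using integrable_cauchy_kernel[OF assms]
    by (subst neg_Im_cauchy_kernel[symmetric]) (intro integrable_minus integrable_Im)
  have "(\<integral>t. ?f t \<partial>M) \<noteq> 0"
  proof
    assume "(\<integral>t. ?f t \<partial>M) = 0"
    then have "AE t in M. ?f t = 0"
      using integral_nonneg_eq_0_iff_AE[OF int] pos by (auto intro: less_imp_le)
    then have "AE t in M. False"
      by eventually_elim (use pos in \<open>auto simp: less_le\<close>)
    then show False by simp
  qed
  moreover have "(\<integral>t. ?f t \<partial>M) \<ge> 0"
    using pos by (intro Bochner_Integration.integral_nonneg) (auto intro: less_imp_le)
  ultimately show ?thesis using Im_cauchy_transform[OF assms] by linarith
qed

lemma cauchy_transform_nonzero: "0 < Im z \<Longrightarrow> cauchy_transform M z \<noteq> 0"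
  using Im_cauchy_transform_neg[of z] by auto

text \<open>The integrated resolvent identity. It yields the Lipschitz bound directly and turns the
  difference quotient into an integral to which dominated convergence applies.\<close>

lemma cauchy_transform_diff:
  assumes "0 < Im z" "0 < Im w"
  shows "cauchy_transform M w - cauchy_transform M z =
    - (w - z) * (\<integral>t. 1 / ((w - complex_of_real t) * (z - complex_of_real t)) \<partial>M)"
proof -
  have "1 / (w - complex_of_real t) - 1 / (z - complex_of_real t) =
      - (w - z) * (1 / ((w - complex_of_real t) * (z - complex_of_real t)))" for t
    using diff_of_real_nonzero[of w t] diff_of_real_nonzero[of z t] assms by (simp add: field_simps)
  then show ?thesis
    unfolding cauchy_transform_def
    using integrable_cauchy_kernel[OF assms(1)] integrable_cauchy_kernel[OF assms(2)]
    by (simp flip: Bochner_Integration.integral_diff integral_mult_right_zero)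
qed

lemma norm_cauchy_kernel2_le:
  assumes "0 < c" "c \<le> Im z" "c \<le> Im w"
  shows "cmod (1 / ((w - complex_of_real t) * (z - complex_of_real t))) \<le> 1 / c\<^sup>2"
proof -
  have "cmod (1 / (w - complex_of_real t)) * cmod (1 / (z - complex_of_real t)) \<le> (1 / c) * (1 / c)"
    using assms by (intro mult_mono norm_inverse_diff_le) auto
  then show ?thesis by (simp add: norm_mult norm_divide power2_eq_square)
qed

lemma cauchy_transform_lipschitz:
  assumes "0 < c" "c \<le> Im z" "c \<le> Im w"
  shows "cmod (cauchy_transform M w - cauchy_transform M z) \<le> cmod (w - z) / c\<^sup>2"
proof -
  have "cmod (\<integral>t. 1 / ((w - complex_of_real t) * (z - complex_of_real t)) \<partial>M) \<le> 1 / c\<^sup>2"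
    by (rule norm_integral_le_const) (auto intro: norm_cauchy_kernel2_le[OF assms])
  then have "cmod (w - z) * cmod (\<integral>t. 1 / ((w - complex_of_real t) * (z - complex_of_real t)) \<partial>M) \<le>
      cmod (w - z) * (1 / c\<^sup>2)"
    by (rule mult_left_mono) simp
  then show ?thesis
    using cauchy_transform_diff[of z w] assms by (simp add: norm_mult norm_minus_commute)
qed

lemma cauchy_transform_has_field_derivative:
  assumes "0 < Im z"
  shows "(cauchy_transform M has_field_derivative - (\<integral>t. 1 / (z - complex_of_real t)\<^sup>2 \<partial>M)) (at z)"
proof -
  \<comment> \<open>Half the height leaves room for the neighbours of \<open>z\<close> and bounds
    all kernels involved by one constant.\<close>
  define c where "c = Im z / 2"
  have c: "0 < c" "c \<le> Im z" using assms by (auto simp: c_def)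
  let ?g = "\<lambda>w. \<integral>t. 1 / ((w - complex_of_real t) * (z - complex_of_real t)) \<partial>M"
  have ev: "eventually (\<lambda>w. w \<in> {w. c < Im w}) (at z)"
    by (rule eventually_at_in_open'[OF open_halfspace_Im_gt]) (use assms in \<open>simp add: c_def\<close>)
  have "((\<lambda>w. - ?g w) \<longlongrightarrow> - ?g z) (at z)"
  proof (rule tendsto_minus, unfold tendsto_at_iff_sequentially, intro allI impI)
    fix X :: "nat \<Rightarrow> complex"
    assume X: "\<forall>i. X i \<in> UNIV - {z}" "X \<longlonglongrightarrow> z"
    have evX: "eventually (\<lambda>i. c < Im (X i)) sequentially"
      using X(2) assms by (intro order_tendstoD(1)[OF tendsto_Im]) (auto simp: c_def)
    \<comment> \<open>Dominated convergence wants the bound for every index, so the finitely many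
      terms below height \<open>c\<close> are cut off by a shift.\<close>
    then obtain N where N: "\<And>i. i \<ge> N \<Longrightarrow> c < Im (X i)" unfolding eventually_sequentially by auto
    have "(\<lambda>i. ?g (X (i + N))) \<longlonglongrightarrow> ?g z"
    proof (rule integral_dominated_convergence[where w = "\<lambda>_. 1 / c\<^sup>2"])
      show "AE t in M. (\<lambda>i. 1 / ((X (i + N) - complex_of_real t) * (z - complex_of_real t)))
          \<longlonglongrightarrow> 1 / ((z - complex_of_real t) * (z - complex_of_real t))"
        using X(2)[THEN LIMSEQ_ignore_initial_segment, of N] diff_of_real_nonzero[of z] assms
        by (auto intro!: tendsto_intros)
      show "AE t in M. cmod (1 / ((X (i + N) - complex_of_real t) * (z - complex_of_real t))) \<le> 1 / c\<^sup>2" for i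
        using N[of "i + N"] c by (intro AE_I2 norm_cauchy_kernel2_le) auto
    qed auto
    then show "((\<lambda>w. ?g w) \<circ> X) \<longlonglongrightarrow> ?g z"
      unfolding o_def by (rule LIMSEQ_offset)
  qed
  moreover have "eventually (\<lambda>w. (cauchy_transform M w - cauchy_transform M z) / (w - z) = - ?g w) (at z)"
    using ev eventually_neq_at_within[of z]
    by eventually_elim (use c assms in \<open>simp add: cauchy_transform_diff field_simps\<close>)
  ultimately have "((\<lambda>w. (cauchy_transform M w - cauchy_transform M z) / (w - z)) \<longlongrightarrow> - ?g z) (at z)"
    using tendsto_cong by force
  then show ?thesis by (simp add: has_field_derivative_iff power2_eq_square)
qed

lemma holomorphic_cauchy_transform: "cauchy_transform M holomorphic_on {z. 0 < Im z}"
  using cauchy_transform_has_field_derivative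
  by (auto simp: holomorphic_on_def field_differentiable_def intro: has_field_derivative_at_within)

lemma holomorphic_recip_cauchy: "recip_cauchy M holomorphic_on {z. 0 < Im z}"
  unfolding recip_cauchy_def[abs_def]
  using cauchy_transform_nonzero by (auto intro!: holomorphic_intros holomorphic_cauchy_transform)

section \<open>Stieltjes inversion and uniqueness of Cauchy transforms\<close>

text \<open>Fubini moves the integral in \<open>x\<close> inside, where the Poisson kernel has the
  primitive \<open>arctan ((x - t) / y)\<close>. On a compact range of \<open>x\<close> the product
  measure is finite, and the bound \<open>1 / y\<close> on the kernel suffices for
  integrability.\<close>

lemma poisson_integral_eq:
  assumes "0 < y" "a \<le> c"
  shows "(\<integral>x. indicator {a..c} x *\<^sub>R (- Im (cauchy_transform M (Complex x y))) \<partial>lborel) =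
    (\<integral>t. arctan ((c - t) / y) - arctan ((a - t) / y) \<partial>M)"
proof -
  let ?L = "restrict_space lborel {a..c}"
  let ?f = "\<lambda>x t. y / ((x - t)\<^sup>2 + y\<^sup>2)"
  interpret L: finite_measure ?L
    by (rule finite_measureI) (simp add: emeasure_restrict_space emeasure_lborel_Icc_eq)
  interpret P: pair_sigma_finite ?L M
    by (intro pair_sigma_finite.intro L.sigma_finite_measure_axioms sigma_finite_measure_axioms)
  have bnd: "\<bar>?f x t\<bar> \<le> 1 / y" for x t
  proof -
    have "y\<^sup>2 \<le> (x - t)\<^sup>2 + y\<^sup>2" by simp
    moreover have "0 < (x - t)\<^sup>2 + y\<^sup>2" using assms by (intro add_nonneg_pos) auto
    ultimately show ?thesis using assms by (simp add: field_simps power2_eq_square)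
  qed
  have fin: "finite_measure (?L \<Otimes>\<^sub>M M)"
    by (rule finite_measure_pair_measure) unfold_locales
  have "(\<lambda>x. x) \<in> borel_measurable ?L" by (rule measurable_restrict_space1) simp
  from measurable_compose[OF measurable_fst[of ?L M] this]
  have [measurable]: "fst \<in> borel_measurable (?L \<Otimes>\<^sub>M M)" by (simp add: o_def)
  have meas [measurable]: "(\<lambda>(x, t). ?f x t) \<in> borel_measurable (?L \<Otimes>\<^sub>M M)"
    unfolding split_beta by measurable
  have int: "integrable (?L \<Otimes>\<^sub>M M) (\<lambda>(x, t). ?f x t)"
    by (rule finite_measure.integrable_const_bound[OF fin, where B = "1 / y"]) (use bnd in auto)
  have "(\<integral>x. indicator {a..c} x *\<^sub>R (- Im (cauchy_transform M (Complex x y))) \<partial>lborel) =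
     (\<integral>x. - Im (cauchy_transform M (Complex x y)) \<partial>?L)"
    by (subst integral_restrict_space) auto
  also have "\<dots> = (\<integral>x. (\<integral>t. ?f x t \<partial>M) \<partial>?L)"
    using Im_cauchy_transform[of "Complex _ y"] assms by simp
  also have "\<dots> = (\<integral>t. (\<integral>x. ?f x t \<partial>?L) \<partial>M)"
    by (rule P.Fubini_integral[OF int, symmetric])
  also have "\<dots> = (\<integral>t. arctan ((c - t) / y) - arctan ((a - t) / y) \<partial>M)"
  proof (rule Bochner_Integration.integral_cong[OF refl])
    fix t
    have "(\<integral>x. ?f x t \<partial>?L) = (\<integral>x. ?f x t * indicator {a..c} x \<partial>lborel)"
      by (subst integral_restrict_space) (auto simp: mult.commute)
    also have "\<dots> = arctan ((c - t) / y) - arctan ((a - t) / y)"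
    proof (rule integral_FTC_Icc_real[OF assms(2)])
      fix x
      have p: "0 < (x - t)\<^sup>2 + y\<^sup>2" using assms by (intro add_nonneg_pos) auto
      show "((\<lambda>x. arctan ((x - t) / y)) has_real_derivative ?f x t) (at x)"
        using assms p
        by (auto intro!: derivative_eq_intros simp: field_simps power2_eq_square)
      show "isCont (\<lambda>x. ?f x t) x" using p by (auto intro!: continuous_intros)
    qed
    finally show "(\<integral>x. ?f x t \<partial>?L) = arctan ((c - t) / y) - arctan ((a - t) / y)" .
  qed
  finally show ?thesis .
qed

end

text \<open>Takes a function and not a measure: the same expression is applied to
  \<open>norm_trace\<close>, where it exhibits the distribution function of a random spectral
  distribution as a pointwise limit of measurable functions.\<close>

definition stieltjes_approx :: "(complex \<Rightarrow> complex) \<Rightarrow> real \<Rightarrow> nat \<Rightarrow> real" where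
  "stieltjes_approx G b m =
    (\<integral>x. indicator {- real (Suc m)..b + 1 / real (Suc m)} x *\<^sub>R
      (- Im (G (Complex x (1 / (real (Suc m))\<^sup>2)))) \<partial>lborel) / pi"

lemma abs_arctan_diff_le: "\<bar>arctan u - arctan v\<bar> \<le> pi"
  using arctan_bounded[of u] arctan_bounded[of v] by linarith

text \<open>The right end point \<open>b + 1 / m\<close> approaches \<open>b\<close> more slowly than the height \<open>1 / m\<^sup>2\<close> approaches 0,
  so that an atom at \<open>b\<close> is counted in full.\<close>

lemma (in real_distribution) stieltjes_inversion:
  "stieltjes_approx (cauchy_transform M) b \<longlonglongrightarrow> cdf M b"
proof -
  let ?n = "\<lambda>m. real (Suc m)"
  let ?k = "\<lambda>m t. arctan ((b + 1 / ?n m - t) / (1 / (?n m)\<^sup>2)) - arctan ((- ?n m - t) / (1 / (?n m)\<^sup>2))"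
  have "(\<lambda>m. \<integral>t. ?k m t \<partial>M) \<longlonglongrightarrow> (\<integral>t. pi * indicator {..b} t \<partial>M)"
  proof (rule integral_dominated_convergence[where w = "\<lambda>_. pi"])
    show "AE t in M. norm (?k m t) \<le> pi" for m
      using abs_arctan_diff_le by simp
    have n: "filterlim ?n at_top sequentially"
      by (intro filterlim_compose[OF filterlim_real_sequentially] filterlim_Suc)
    show "AE t in M. (\<lambda>m. ?k m t) \<longlonglongrightarrow> pi * indicator {..b} t"
    proof (rule AE_I2)
      fix t
      have l2: "(\<lambda>m. arctan ((- ?n m - t) / (1 / (?n m)\<^sup>2))) \<longlonglongrightarrow> - (pi / 2)"
      proof (rule filterlim_compose[OF tendsto_arctan_at_bot])
        have "filterlim (\<lambda>x::real. (- x - t) / (1 / x\<^sup>2)) at_bot at_top" by real_asymp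
        from filterlim_compose[OF this n]
        show "filterlim (\<lambda>m. (- ?n m - t) / (1 / (?n m)\<^sup>2)) at_bot sequentially" .
      qed
      show "(\<lambda>m. ?k m t) \<longlonglongrightarrow> pi * indicator {..b} t"
      proof (cases "t \<le> b")
        case True
        have "(\<lambda>m. arctan ((b + 1 / ?n m - t) / (1 / (?n m)\<^sup>2))) \<longlonglongrightarrow> pi / 2"
        proof (rule filterlim_compose[OF tendsto_arctan_at_top])
          show "filterlim (\<lambda>m. (b + 1 / ?n m - t) / (1 / (?n m)\<^sup>2)) at_top sequentially"
          proof (rule filterlim_at_top_mono[OF n], intro always_eventually allI)
            fix m
            have "?n m \<le> (b - t) * (?n m)\<^sup>2 + ?n m" using True by simp
            also have "\<dots> = (b + 1 / ?n m - t) / (1 / (?n m)\<^sup>2)"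
              by (simp add: field_simps power2_eq_square del: of_nat_Suc)
            finally show "?n m \<le> (b + 1 / ?n m - t) / (1 / (?n m)\<^sup>2)" .
          qed
        qed
        from tendsto_diff[OF this l2] True show ?thesis by simp
      next
        case False
        have "(\<lambda>m. arctan ((b + 1 / ?n m - t) / (1 / (?n m)\<^sup>2))) \<longlonglongrightarrow> - (pi / 2)"
        proof (rule filterlim_compose[OF tendsto_arctan_at_bot])
          have "t - b > 0" using False by simp
          then have "filterlim (\<lambda>x::real. (1 / x - (t - b)) / (1 / x\<^sup>2)) at_bot at_top" by real_asymp
          from filterlim_compose[OF this n]
          show "filterlim (\<lambda>m. (b + 1 / ?n m - t) / (1 / (?n m)\<^sup>2)) at_bot sequentially"
            by (simp add: algebra_simps)
        qed
        from tendsto_diff[OF this l2] False show ?thesis by simp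
      qed
    qed
  qed auto
  moreover have "(\<integral>t. pi * indicator {..b} t \<partial>M) = pi * cdf M b"
    by (simp add: cdf_def)
  ultimately have lim: "(\<lambda>m. (\<integral>t. ?k m t \<partial>M) / pi) \<longlonglongrightarrow> pi * cdf M b / pi"
    by (intro tendsto_divide) auto
  have "eventually (\<lambda>m. stieltjes_approx (cauchy_transform M) b m = (\<integral>t. ?k m t \<partial>M) / pi) sequentially"
  proof -
    \<comment> \<open>From this index on the left end point lies below the right one, as the arctan
      formula demands.\<close>
    have "eventually (\<lambda>m. m \<ge> nat \<lceil>- b\<rceil>) sequentially" by (rule eventually_ge_at_top)
    then show ?thesis
    proof eventually_elim
      case (elim m)
      then have "- ?n m \<le> b + 1 / ?n m"
        by (smt (verit) divide_nonneg_nonneg of_nat_0_le_iff of_nat_Suc real_nat_ceiling_ge of_nat_mono)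
      then show ?case
        unfolding stieltjes_approx_def by (subst poisson_integral_eq) auto
    qed
  qed
  from tendsto_cong[OF this] lim show ?thesis by simp
qed

text \<open>The approximants see a measure only through its transform in the open upper half plane,
  so equal transforms force equal distribution functions.\<close>

lemma cauchy_transform_unique:
  assumes "real_distribution M" "real_distribution N"
    and "\<And>z. 0 < Im z \<Longrightarrow> cauchy_transform M z = cauchy_transform N z"
  shows "M = N"
proof (rule cdf_unique[OF assms(1,2)], rule ext)
  fix b
  have "stieltjes_approx (cauchy_transform M) b = stieltjes_approx (cauchy_transform N) b"
    unfolding stieltjes_approx_def using assms(3) by (intro ext) (simp del: of_nat_Suc)
  then show "cdf M b = cdf N b"
    using real_distribution.stieltjes_inversion[OF assms(1), of b]
      real_distribution.stieltjes_inversion[OF assms(2), of b] LIMSEQ_unique by metis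
qed

section \<open>Inverting the reciprocal Cauchy transform\<close>

text \<open>A uniform bound on a whole half plane, stronger than F z / z -> 1 inside cones (F is the
  reciprocal Cauchy transform). It holds for laws with a finite second moment, passes to
  subordinated laws, and makes the inversion of F a perturbation of the identity.\<close>

definition near_identity :: "real measure \<Rightarrow> real \<Rightarrow> real \<Rightarrow> bool" where
  "near_identity M C Y \<longleftrightarrow> 0 \<le> C \<and> 0 < Y \<and> (\<forall>z. Y \<le> Im z \<longrightarrow> cmod (recip_cauchy M z - z) \<le> C)"

text \<open>With e = z G(z) - 1 one has F(z) - z = - e z / (1 + e), so it is enough that e z is
  bounded and e is small. One step of the geometric expansion writes e as the integral of (t + t^2 /
  (z - t)) / z, whence |e z| is at most \<open>C\<close>, the sum of the first absolute and the
  second moment. The height \<open>2 * C + 1\<close> ensures |e| \<le> 1 / 2.\<close>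

lemma (in real_distribution) near_identity_second_moment:
  assumes "integrable M (\<lambda>t. t\<^sup>2)"
  shows "\<exists>C Y. near_identity M C Y"
proof -
  let ?m = "\<integral>t. \<bar>t\<bar> \<partial>M" and ?v = "\<integral>t. t\<^sup>2 \<partial>M"
  define C where "C = ?m + ?v"
  have i1: "integrable M (\<lambda>t. \<bar>t\<bar>)"
  proof (rule Bochner_Integration.integrable_bound)
    show "integrable M (\<lambda>t. 1 + t\<^sup>2)" using assms by simp
    have "\<bar>t\<bar> \<le> 1 + t\<^sup>2" for t :: real
      using zero_le_power2[of "\<bar>t\<bar> - 1 / 2"] by (simp add: power2_diff power_divide)
    then show "AE t in M. norm \<bar>t\<bar> \<le> norm (1 + t\<^sup>2)" by simp
  qed simp
  have C0: "0 \<le> C" unfolding C_def by simp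
  have "cmod (recip_cauchy M z - z) \<le> 2 * C" if z: "2 * C + 1 \<le> Im z" for z
  proof -
    let ?G = "cauchy_transform M z"
    have Imz: "1 \<le> Im z" and Imz0: "0 < Im z" using z C0 by auto
    have zn: "z \<noteq> 0" using Imz0 by auto
    have abs: "2 * C + 1 \<le> cmod z" using z abs_Im_le_cmod[of z] by linarith
    define e where "e = z * ?G - 1"
    have iG: "integrable M (\<lambda>t. 1 / (z - complex_of_real t))" by (rule integrable_cauchy_kernel[OF Imz0])
    have eq: "z * (1 / (z - complex_of_real t)) - 1 = (complex_of_real t + (complex_of_real t)\<^sup>2 * (1 / (z - complex_of_real t))) / z" for t
      using diff_of_real_nonzero[of z t] zn Imz0 by (simp add: field_simps power2_eq_square)
    have "e = (\<integral>t. z * (1 / (z - complex_of_real t)) - 1 \<partial>M)"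
      unfolding e_def cauchy_transform_def using iG prob_space
      by (simp del: times_divide_eq_right mult_1_right)
    also have "cmod \<dots> \<le> (\<integral>t. cmod (z * (1 / (z - complex_of_real t)) - 1) \<partial>M)" by simp
    also have "\<dots> \<le> (\<integral>t. (\<bar>t\<bar> + t\<^sup>2) / cmod z \<partial>M)"
    proof (rule integral_mono)
      show "integrable M (\<lambda>t. cmod (z * (1 / (z - complex_of_real t)) - 1))"
        using iG by (intro integrable_norm Bochner_Integration.integrable_diff integrable_mult_right) auto
      show "integrable M (\<lambda>t. (\<bar>t\<bar> + t\<^sup>2) / cmod z)" using i1 assms by simp
      fix t
      have "cmod (complex_of_real t + (complex_of_real t)\<^sup>2 * (1 / (z - complex_of_real t)))
          \<le> \<bar>t\<bar> + t\<^sup>2 * cmod (1 / (z - complex_of_real t))"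
        by (rule norm_triangle_le) (simp add: norm_mult norm_power norm_divide)
      also have "\<dots> \<le> \<bar>t\<bar> + t\<^sup>2 * 1"
        using norm_inverse_diff_le[of 1 z t] Imz by (intro add_left_mono mult_left_mono) auto
      finally show "cmod (z * (1 / (z - complex_of_real t)) - 1) \<le> (\<bar>t\<bar> + t\<^sup>2) / cmod z"
        unfolding eq norm_divide by (simp add: divide_right_mono)
    qed
    also have "\<dots> = C / cmod z" unfolding C_def using i1 assms by simp
    finally have e: "cmod e \<le> C / cmod z" .
    then have e': "cmod e * cmod z \<le> C" using zn by (simp add: field_simps)
    have "cmod e \<le> 1 / 2"
    proof -
      have "C / cmod z \<le> 1 / 2" using abs C0 zn by (simp add: field_simps)
      then show ?thesis using e by linarith
    qed
    then have l: "1 / 2 \<le> cmod (1 + e)"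
      using norm_triangle_ineq4[of "1 + e" e] by simp
    then have ne: "1 + e \<noteq> 0" by auto
    have G: "?G = (1 + e) / z" unfolding e_def using zn by simp
    have "recip_cauchy M z - z = - (e * z) / (1 + e)"
      unfolding recip_cauchy_def G using ne zn by (simp add: field_simps)
    then have "cmod (recip_cauchy M z - z) = cmod e * cmod z / cmod (1 + e)"
      by (simp add: norm_divide norm_mult)
    also have "\<dots> \<le> C / (1 / 2)" using e' l C0 by (intro frac_le) auto
    finally show ?thesis by simp
  qed
  then have "near_identity M (2 * C) (2 * C + 1)" unfolding near_identity_def using C0 by auto
  then show ?thesis by blast
qed

text \<open>Cauchy's estimate on a disc of radius \<open>2 * C + 1\<close>, which stays above height
  \<open>Y\<close>, bounds the derivative of F - id by C / (2 C + 1) \<le> 1 / 2. A perturbation of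
  the identity by a map with Lipschitz constant 1 / 2 is injective.\<close>

lemma near_identity_inj_on:
  assumes "real_distribution M" and ni: "near_identity M C Y"
  shows "inj_on (recip_cauchy M) {z. Y + 2 * C + 1 \<le> Im z}"
proof -
  interpret real_distribution M by fact
  let ?S = "{z. Y + 2 * C + 1 \<le> Im z}"
  let ?g = "\<lambda>z. recip_cauchy M z - z"
  have C: "0 \<le> C" "0 < Y" and b: "\<And>z. Y \<le> Im z \<Longrightarrow> cmod (?g z) \<le> C"
    using ni by (auto simp: near_identity_def)
  have hol: "?g holomorphic_on {z. 0 < Im z}"
    by (intro holomorphic_intros holomorphic_recip_cauchy)
  have d: "cmod (deriv ?g z) \<le> 1 / 2" if z: "z \<in> ?S" for z
  proof -
    have sub: "Y \<le> Im u" if "u \<in> cball z (2 * C + 1)" for u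
    proof -
      have "\<bar>Im (z - u)\<bar> \<le> 2 * C + 1"
        using that abs_Im_le_cmod[of "z - u"] by (simp add: dist_norm)
      then show ?thesis using z by simp
    qed
    then have hol': "?g holomorphic_on cball z (2 * C + 1)"
      by (intro holomorphic_on_subset[OF hol]) (use C in force)
    have "cmod ((deriv ^^ 1) ?g z) \<le> fact 1 * C / (2 * C + 1) ^ 1"
    proof (rule Cauchy_inequality)
      show "?g holomorphic_on ball z (2 * C + 1)" using hol' holomorphic_on_subset ball_subset_cball by blast
      show "continuous_on (cball z (2 * C + 1)) ?g" using hol' by (rule holomorphic_on_imp_continuous_on)
      show "0 < 2 * C + 1" using C by simp
      show "cmod (?g x) \<le> C" if "cmod (z - x) = 2 * C + 1" for x
        using that by (intro b sub) (auto simp: dist_norm)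
    qed
    also have "\<dots> \<le> 1 / 2" using C by (simp add: field_simps)
    finally show ?thesis by simp
  qed
  have lip: "cmod (?g z - ?g w) \<le> 1 / 2 * cmod (z - w)" if "z \<in> ?S" "w \<in> ?S" for z w
  proof (rule field_differentiable_bound[of ?S ?g "deriv ?g"])
    show "convex ?S" by (rule convex_halfspace_Im_ge)
    fix u assume u: "u \<in> ?S"
    then have "u \<in> {z. 0 < Im z}" using C by auto
    from holomorphic_derivI[OF hol open_halfspace_Im_gt this]
    show "(?g has_field_derivative deriv ?g u) (at u within ?S)"
      by (rule has_field_derivative_at_within)
    show "cmod (deriv ?g u) \<le> 1 / 2" using d u by blast
  qed fact+
  show ?thesis
  proof (rule inj_onI)
    fix z w assume z: "z \<in> ?S" and w: "w \<in> ?S" and e: "recip_cauchy M z = recip_cauchy M w"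
    have "?g z - ?g w = - (z - w)" using e by simp
    then have "cmod (z - w) = cmod (?g z - ?g w)" by (simp only: norm_minus_cancel)
    also have "\<dots> \<le> 1 / 2 * cmod (z - w)" by (rule lip[OF z w])
    finally show "z = w" by simp
  qed
qed

text \<open>A preimage of \<open>z\<close> is a fixed point of w -> z - (F w - w). This map sends
  the closed disc of radius \<open>C\<close> about \<open>z\<close> into itself, so Brouwer's
  theorem supplies the point. The second conclusion records the height of the preimage, at which F
  is known to be injective.\<close>

lemma near_identity_has_voiculescu_transform:
  assumes "real_distribution M" and ni: "near_identity M C Y"
    and \<beta>: "Y + 4 * C + 2 \<le> \<beta>"
  obtains \<phi> where "has_voiculescu_transform M \<phi> 1 \<beta>"
    "\<And>z. z \<in> trunc_cone 1 \<beta> \<Longrightarrow> Y + 2 * C + 1 < Im (z + \<phi> z) \<and> recip_cauchy M (z + \<phi> z) = z"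
proof -
  interpret real_distribution M by fact
  define T where "T = trunc_cone 3 (Y + 2 * C + 1)"
  have C: "0 \<le> C" "0 < Y" and b: "\<And>z. Y \<le> Im z \<Longrightarrow> cmod (recip_cauchy M z - z) \<le> C"
    using ni by (auto simp: near_identity_def)
  have inj: "inj_on (recip_cauchy M) T"
    by (rule inj_on_subset[OF near_identity_inj_on[OF assms(1,2)]]) (auto simp: T_def trunc_cone_def)
  have "\<exists>w\<in>T. recip_cauchy M w = z" if z: "z \<in> trunc_cone 1 \<beta>" for z
  proof -
    \<comment> \<open>Moving by \<open>C\<close> costs at most \<open>C\<close> in height, and |Re
      u| < Im u + 2 C < 3 Im u: hence the aperture 3 of \<open>T\<close> and the slack in the bound
      on \<open>\<beta>\<close>.\<close>
    have sub: "Y + 2 * C + 1 < Im u" "\<bar>Re u\<bar> < 3 * Im u" if "u \<in> cball z C" for u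
    proof -
      have "\<bar>Im (z - u)\<bar> \<le> C" "\<bar>Re (z - u)\<bar> \<le> C"
        using that abs_Im_le_cmod[of "z - u"] abs_Re_le_cmod[of "z - u"] by (auto simp: dist_norm)
      then show "Y + 2 * C + 1 < Im u" "\<bar>Re u\<bar> < 3 * Im u"
        using z \<beta> C by (auto simp: trunc_cone_def)
    qed
    have "\<exists>w\<in>cball z C. z - (recip_cauchy M w - w) = w"
    proof (rule brouwer[of "cball z C"])
      have "cball z C \<subseteq> {z. 0 < Im z}" using sub C by fastforce
      then have "recip_cauchy M holomorphic_on cball z C"
        using holomorphic_recip_cauchy holomorphic_on_subset by blast
      then show "continuous_on (cball z C) (\<lambda>w. z - (recip_cauchy M w - w))"
        by (intro continuous_intros holomorphic_on_imp_continuous_on)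
      show "(\<lambda>w. z - (recip_cauchy M w - w)) \<in> cball z C \<rightarrow> cball z C"
      proof (rule funcsetI)
        fix w assume "w \<in> cball z C"
        then have "cmod (recip_cauchy M w - w) \<le> C" using sub C by (intro b) fastforce
        then show "z - (recip_cauchy M w - w) \<in> cball z C" by (simp add: dist_norm)
      qed
    qed (use C in auto)
    then obtain w where w: "w \<in> cball z C" "z - (recip_cauchy M w - w) = w" by blast
    then have "recip_cauchy M w = z" by (simp add: algebra_simps)
    with sub[OF w(1)] show ?thesis by (auto simp: T_def trunc_cone_def)
  qed
  then have sub: "trunc_cone 1 \<beta> \<subseteq> recip_cauchy M ` T" by blast
  let ?\<phi> = "\<lambda>z. the_inv_into T (recip_cauchy M) z - z"
  show thesis
  proof (rule that[of ?\<phi>])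
    show "has_voiculescu_transform M ?\<phi> 1 \<beta>"
      using inj C sub unfolding has_voiculescu_transform_def T_def
      by (intro exI[of _ 3] conjI exI[of _ "Y + 2 * C + 1"]) auto
    fix z assume "z \<in> trunc_cone 1 \<beta>"
    then have "z \<in> recip_cauchy M ` T" using sub by blast
    then show "Y + 2 * C + 1 < Im (z + ?\<phi> z) \<and> recip_cauchy M (z + ?\<phi> z) = z"
      using the_inv_into_into[OF inj _ subset_refl] f_the_inv_into_f[OF inj]
      by (auto simp: T_def trunc_cone_def)
  qed
qed

lemma has_voiculescu_transform_inverse:
  assumes "has_voiculescu_transform M \<phi> \<alpha> \<beta>"
  obtains \<alpha>' \<beta>' where "0 < \<alpha>'" "0 < \<beta>'"
    "\<And>z. z \<in> trunc_cone \<alpha> \<beta> \<Longrightarrow> z + \<phi> z \<in> trunc_cone \<alpha>' \<beta>'"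
    "\<And>z. z \<in> trunc_cone \<alpha> \<beta> \<Longrightarrow> recip_cauchy M (z + \<phi> z) = z"
proof -
  obtain \<alpha>' \<beta>' where *: "\<alpha>' > 0" "\<beta>' > 0" "inj_on (recip_cauchy M) (trunc_cone \<alpha>' \<beta>')"
      "trunc_cone \<alpha> \<beta> \<subseteq> recip_cauchy M ` trunc_cone \<alpha>' \<beta>'"
      "\<And>z. z \<in> trunc_cone \<alpha> \<beta> \<Longrightarrow> \<phi> z = the_inv_into (trunc_cone \<alpha>' \<beta>') (recip_cauchy M) z - z"
    using assms unfolding has_voiculescu_transform_def by blast
  show thesis
  proof (rule that[OF *(1,2)])
    fix z assume z: "z \<in> trunc_cone \<alpha> \<beta>"
    then have e: "z + \<phi> z = the_inv_into (trunc_cone \<alpha>' \<beta>') (recip_cauchy M) z" using *(5) by simp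
    show "z + \<phi> z \<in> trunc_cone \<alpha>' \<beta>'"
      unfolding e using *(4) z by (intro the_inv_into_into[OF *(3)]) auto
    show "recip_cauchy M (z + \<phi> z) = z"
      unfolding e using *(4) z by (intro f_the_inv_into_f[OF *(3)]) auto
  qed
qed

text \<open>Below the height \<open>Y\<close> the cone is bounded and \<^const>\<open>recip_cauchy\<close> is bounded on it, so
  that far out points of the imaginary axis are only attained above \<open>Y\<close>.\<close>

lemma (in real_distribution) has_voiculescu_transform_far_out:
  assumes "has_voiculescu_transform M \<phi> \<alpha> \<beta>" "0 < \<alpha>" "0 < Y"
  obtains B where "\<beta> < B"
    "\<And>y. B < y \<Longrightarrow> Y \<le> Im (Complex 0 y + \<phi> (Complex 0 y)) \<and>
       recip_cauchy M (Complex 0 y + \<phi> (Complex 0 y)) = Complex 0 y"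
proof -
  obtain \<alpha>' \<beta>' where *: "0 < \<alpha>'" "0 < \<beta>'"
    "\<And>z. z \<in> trunc_cone \<alpha> \<beta> \<Longrightarrow> z + \<phi> z \<in> trunc_cone \<alpha>' \<beta>'"
    "\<And>z. z \<in> trunc_cone \<alpha> \<beta> \<Longrightarrow> recip_cauchy M (z + \<phi> z) = z"
    by (rule has_voiculescu_transform_inverse[OF assms(1)]) blast
  let ?K = "cbox (Complex (- (\<alpha>' * Y)) \<beta>') (Complex (\<alpha>' * Y) Y)"
  have "?K \<subseteq> {z. 0 < Im z}" using *(2) by (auto simp: in_cbox_complex_iff)
  then have "continuous_on ?K (recip_cauchy M)"
    using holomorphic_on_imp_continuous_on[OF holomorphic_recip_cauchy] continuous_on_subset by blast
  then have "bounded (recip_cauchy M ` ?K)"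
    by (intro compact_imp_bounded compact_continuous_image) auto
  then obtain b where b: "\<And>u. u \<in> ?K \<Longrightarrow> cmod (recip_cauchy M u) \<le> b"
    unfolding bounded_iff by auto
  show thesis
  proof (rule that[of "max b (max 0 \<beta> + 1)"])
    show "\<beta> < max b (max 0 \<beta> + 1)" by simp
    fix y assume y: "max b (max 0 \<beta> + 1) < y"
    let ?z = "Complex 0 y"
    have z: "?z \<in> trunc_cone \<alpha> \<beta>" using y assms(2) by (auto simp: trunc_cone_def)
    note w = *(3)[OF z] *(4)[OF z]
    have "Y \<le> Im (?z + \<phi> ?z)"
    proof (rule ccontr)
      assume n: "\<not> Y \<le> Im (?z + \<phi> ?z)"
      have "\<alpha>' * Im (?z + \<phi> ?z) \<le> \<alpha>' * Y" using n *(1) by (intro mult_left_mono) auto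
      then have "?z + \<phi> ?z \<in> ?K"
        using w(1) n by (auto simp: trunc_cone_def in_cbox_complex_iff)
      from b[OF this] w(2) have "cmod ?z \<le> b" by simp
      then show False using y by (simp add: cmod_def)
    qed
    then show "Y \<le> Im (?z + \<phi> ?z) \<and> recip_cauchy M (?z + \<phi> ?z) = ?z" using w by simp
  qed
qed

section \<open>Free convolution by subordination\<close>

text \<open>Subordination gives F_R(z) = F_N(z - v G(z)). The argument lies at least as high as
  \<open>z\<close> since Im G \<le> 0, and differs from \<open>z\<close> by at most \<open>v\<close>
  since |G| \<le> 1, so the bound for \<open>N\<close> is inherited.\<close>

lemma subordination_near_identity:
  assumes "real_distribution N" "real_distribution R"
    and ni: "near_identity N C Y" and "0 \<le> v"
    and sub: "\<And>z. 1 \<le> Im z \<Longrightarrow> cauchy_transform R z = cauchy_transform N (z - of_real v * cauchy_transform R z)"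
  shows "near_identity R (C + v) (1 + Y)"
proof -
  interpret R: real_distribution R by fact
  have C: "0 \<le> C" "0 < Y" and b: "\<And>z. Y \<le> Im z \<Longrightarrow> cmod (recip_cauchy N z - z) \<le> C"
    using ni by (auto simp: near_identity_def)
  have "cmod (recip_cauchy R z - z) \<le> C + v" if z: "1 + Y \<le> Im z" for z
  proof -
    have z1: "1 \<le> Im z" "Y \<le> Im z" "0 < Im z" using z C by auto
    let ?G = "cauchy_transform R z"
    have "Im ?G \<le> 0" using R.Im_cauchy_transform_neg[of z] z1 by auto
    then have "v * Im ?G \<le> 0" using assms(4) by (rule mult_nonneg_nonpos[rotated])
    then have i: "Y \<le> Im (z - of_real v * ?G)" using z1 by simp
    have e: "recip_cauchy R z = recip_cauchy N (z - of_real v * ?G)"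
      unfolding recip_cauchy_def using sub[OF z1(1)] by simp
    have "recip_cauchy R z - z = (recip_cauchy N (z - of_real v * ?G) - (z - of_real v * ?G)) - of_real v * ?G"
      unfolding e by simp
    also have "cmod \<dots> \<le> C + v * 1"
    proof (rule order.trans[OF norm_triangle_ineq4], rule add_mono[OF b[OF i]])
      show "cmod (of_real v * ?G) \<le> v * 1"
        unfolding norm_mult using R.norm_cauchy_transform_le[of 1 z] z1 assms(4)
        by (intro mult_mono) auto
    qed
    finally show ?thesis by simp
  qed
  then show ?thesis unfolding near_identity_def using C assms(4) by auto
qed

text \<open>\<open>quad\<close> says that the inverse of F_M at z is z + v / z, and by
  \<open>sub\<close> a preimage u of z under F_R yields the preimage u - v / z under F_N; hence the
  transforms add up. For uniqueness, a competitor comes with its own cones and inverses, but far out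
  on the imaginary axis these are the same inverses. Its Cauchy transform then agrees with that of
  \<open>R\<close> on a set with an accumulation point, hence on the upper half plane.\<close>

lemma free_conv_eqI:
  assumes rM: "real_distribution M" and rN: "real_distribution N" and rR: "real_distribution R"
    and ni: "near_identity N C Y" and v: "0 \<le> v"
    and quad: "\<And>z. 1 \<le> Im z \<Longrightarrow> recip_cauchy M z = z - of_real v * cauchy_transform M z"
    and sub: "\<And>z. 1 \<le> Im z \<Longrightarrow> cauchy_transform R z = cauchy_transform N (z - of_real v * cauchy_transform R z)"
  shows "M \<boxplus> N = R"
proof -
  interpret M: real_distribution M by fact
  interpret N: real_distribution N by fact
  interpret R: real_distribution R by fact
  have niR: "near_identity R (C + v) (1 + Y)"
    by (rule subordination_near_identity[OF rN rR ni v sub])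
  have C: "0 \<le> C" "0 < Y" using ni by (auto simp: near_identity_def)
  have niM: "near_identity M v (1)"
    unfolding near_identity_def
  proof (intro conjI allI impI v)
    fix z assume z: "1 \<le> Im z"
    have "cmod (recip_cauchy M z - z) = v * cmod (cauchy_transform M z)"
      using quad[of z] z v by (simp add: norm_mult)
    also have "\<dots> \<le> v * 1"
      using M.norm_cauchy_transform_le[of 1 z] z v by (intro mult_left_mono) auto
    finally show "cmod (recip_cauchy M z - z) \<le> v" by simp
  qed simp
  define YN where "YN = Y + 2 * C + 1"
  have injN: "inj_on (recip_cauchy N) {z. YN \<le> Im z}"
    unfolding YN_def by (rule near_identity_inj_on[OF rN ni])
  have G_recip: "cauchy_transform L u = 1 / z" if "recip_cauchy L u = z" for L u z
    using that by (auto simp: recip_cauchy_def)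
  have M_inv: "w = z + of_real v / z" if "recip_cauchy M w = z" "1 \<le> Im w" for w z
    using quad[OF that(2)] that(1) G_recip[OF that(1)] by (simp add: algebra_simps)
  have R_inv: "recip_cauchy N (u - of_real v / z) = z \<and> Im u \<le> Im (u - of_real v / z)"
    if "recip_cauchy R u = z" "1 \<le> Im u" for u z
  proof -
    have G: "cauchy_transform R u = 1 / z" by (rule G_recip) fact
    have "Im (1 / z) \<le> 0" using R.Im_cauchy_transform_neg[of u] that(2) unfolding G by simp
    then have "v * Im (1 / z) \<le> 0" using v by (rule mult_nonneg_nonpos[rotated])
    moreover have "Im (of_real v / z) = v * Im (1 / z)"
    proof -
      have "of_real v / z = v *\<^sub>R (1 / z)" by (simp add: scaleR_conv_of_real)
      then show ?thesis by simp
    qed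
    moreover have "recip_cauchy N (u - of_real v / z) = z"
      using sub[OF that(2)] that(1) unfolding recip_cauchy_def G by simp
    ultimately show ?thesis by simp
  qed

  \<comment> \<open>A height above which all three measures can be inverted, each with its own pair
    of constants.\<close>
  define b where "b = Max {1 + 4 * v + 2, Y + 4 * C + 2, 1 + Y + 4 * (C + v) + 2}"
  have b: "1 + 4 * v + 2 \<le> b" "Y + 4 * C + 2 \<le> b" "1 + Y + 4 * (C + v) + 2 \<le> b"
    unfolding b_def by auto
  have "0 < b" using b(2) C by linarith
  obtain \<phi> where \<phi>: "has_voiculescu_transform M \<phi> 1 b"
    and \<phi>': "\<And>z. z \<in> trunc_cone 1 b \<Longrightarrow> 1 + 2 * v + 1 < Im (z + \<phi> z) \<and> recip_cauchy M (z + \<phi> z) = z"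
    by (rule near_identity_has_voiculescu_transform[OF rM niM b(1)]) blast
  obtain \<psi> where \<psi>: "has_voiculescu_transform N \<psi> 1 b"
    and \<psi>': "\<And>z. z \<in> trunc_cone 1 b \<Longrightarrow> Y + 2 * C + 1 < Im (z + \<psi> z) \<and> recip_cauchy N (z + \<psi> z) = z"
    by (rule near_identity_has_voiculescu_transform[OF rN ni b(2)]) blast
  obtain \<theta> where \<theta>: "has_voiculescu_transform R \<theta> 1 b"
    and \<theta>': "\<And>z. z \<in> trunc_cone 1 b \<Longrightarrow> 1 + Y + 2 * (C + v) + 1 < Im (z + \<theta> z) \<and> recip_cauchy R (z + \<theta> z) = z"
    by (rule near_identity_has_voiculescu_transform[OF rR niR b(3)]) blast
  \<comment> \<open>Stated for an arbitrary high preimage \<open>w\<close>, so that it applies both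
    to the inverse constructed here and to that of a competing triple.\<close>
  have \<theta>_eq: "z + \<theta> z - of_real v / z = w"
    if z: "z \<in> trunc_cone 1 b" and w: "recip_cauchy N w = z" "YN \<le> Im w" for z w
  proof -
    define u where "u = z + \<theta> z"
    have t: "recip_cauchy R u = z" "1 + Y + 2 * C + 2 * v + 1 < Im u"
      using \<theta>'[OF z] unfolding u_def by (auto simp: distrib_left)
    have u1: "1 \<le> Im u" using t(2) v C by linarith
    have u2: "YN \<le> Im u" using t(2) v C unfolding YN_def by linarith
    note * = R_inv[OF t(1) u1]
    have "u - of_real v / z = w"
    proof (rule inj_onD[OF injN])
      show "recip_cauchy N (u - of_real v / z) = recip_cauchy N w" unfolding w(1) using * by blast
      show "u - of_real v / z \<in> {z. YN \<le> Im z}" using order.trans[OF u2 conjunct2[OF *]] by blast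
      show "w \<in> {z. YN \<le> Im z}" using w(2) by blast
    qed
    then show ?thesis unfolding u_def .
  qed
  have sum: "\<theta> z = \<phi> z + \<psi> z" if z: "z \<in> trunc_cone 1 b" for z
  proof -
    have "1 \<le> Im (z + \<phi> z)" using conjunct1[OF \<phi>'[OF z]] v by linarith
    from M_inv[OF conjunct2[OF \<phi>'[OF z]] this] have 1: "z + \<phi> z = z + of_real v / z" .
    have "YN \<le> Im (z + \<psi> z)" using conjunct1[OF \<psi>'[OF z]] unfolding YN_def by (rule less_imp_le)
    from \<theta>_eq[OF z conjunct2[OF \<psi>'[OF z]] this]
    have 2: "z + \<theta> z - of_real v / z = z + \<psi> z" .
    have "\<phi> z = of_real v / z" using 1 by (rule add_left_imp_eq)
    with 2 show ?thesis by (simp add: algebra_simps)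
  qed
  show ?thesis
    unfolding free_conv_def
  proof (rule the_equality)
    have "has_voiculescu_transform R (\<lambda>z. \<phi> z + \<psi> z) 1 b"
      using \<theta> sum unfolding has_voiculescu_transform_def by simp
    with \<phi> \<psi> \<open>0 < b\<close> rR show "real_distribution R \<and> (\<exists>\<alpha>>0. \<exists>\<beta>>0. \<exists>\<phi> \<psi>. has_voiculescu_transform M \<phi> \<alpha> \<beta> \<and>
        has_voiculescu_transform N \<psi> \<alpha> \<beta> \<and> has_voiculescu_transform R (\<lambda>z. \<phi> z + \<psi> z) \<alpha> \<beta>)"
      by (intro conjI exI[of _ 1] exI[of _ b] exI[of _ \<phi>] exI[of _ \<psi>]) auto
    fix R' assume "real_distribution R' \<and> (\<exists>\<alpha>>0. \<exists>\<beta>>0. \<exists>\<phi> \<psi>. has_voiculescu_transform M \<phi> \<alpha> \<beta> \<and>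
        has_voiculescu_transform N \<psi> \<alpha> \<beta> \<and> has_voiculescu_transform R' (\<lambda>z. \<phi> z + \<psi> z) \<alpha> \<beta>)"
    then obtain \<alpha> \<beta> \<phi>\<^sub>2 \<psi>\<^sub>2 where rR': "real_distribution R'" and \<alpha>: "0 < \<alpha>" "0 < \<beta>"
      and \<phi>\<^sub>2: "has_voiculescu_transform M \<phi>\<^sub>2 \<alpha> \<beta>" and \<psi>\<^sub>2: "has_voiculescu_transform N \<psi>\<^sub>2 \<alpha> \<beta>"
      and s\<^sub>2: "has_voiculescu_transform R' (\<lambda>z. \<phi>\<^sub>2 z + \<psi>\<^sub>2 z) \<alpha> \<beta>" by blast
    interpret R': real_distribution R' by fact
    obtain B1 where B1: "\<beta> < B1" "\<And>y. B1 < y \<Longrightarrow> 1 \<le> Im (Complex 0 y + \<phi>\<^sub>2 (Complex 0 y)) \<and>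
       recip_cauchy M (Complex 0 y + \<phi>\<^sub>2 (Complex 0 y)) = Complex 0 y"
      using M.has_voiculescu_transform_far_out[OF \<phi>\<^sub>2 \<alpha>(1), of "1"] by auto
    obtain B2 where B2: "\<beta> < B2" "\<And>y. B2 < y \<Longrightarrow> YN \<le> Im (Complex 0 y + \<psi>\<^sub>2 (Complex 0 y)) \<and>
       recip_cauchy N (Complex 0 y + \<psi>\<^sub>2 (Complex 0 y)) = Complex 0 y"
      using N.has_voiculescu_transform_far_out[OF \<psi>\<^sub>2 \<alpha>(1), of YN] C by (auto simp: YN_def)
    define y\<^sub>0 where "y\<^sub>0 = max b (max B1 B2)"
    define u where "u = (\<lambda>y. Complex 0 y + \<theta> (Complex 0 y))"
    have cone: "Complex 0 y \<in> trunc_cone 1 b" "Complex 0 y \<in> trunc_cone \<alpha> \<beta>" if "y\<^sub>0 < y" for y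
      using that \<open>0 < b\<close> \<alpha> B1 by (auto simp: trunc_cone_def y\<^sub>0_def)
    have uR: "recip_cauchy R (u y) = Complex 0 y" "1 \<le> Im (u y)" "cmod (u y) \<le> y + C + v" if y: "y\<^sub>0 < y" for y
    proof -
      show 1: "recip_cauchy R (u y) = Complex 0 y"
        unfolding u_def using \<theta>'[OF cone(1)[OF y]] by simp
      have "1 + Y + 2 * C + 2 * v + 1 < Im (u y)" unfolding u_def using \<theta>'[OF cone(1)[OF y]] by (auto simp: distrib_left)
      then have "1 + Y \<le> Im (u y)" "1 \<le> Im (u y)" using C v by auto
      then show "1 \<le> Im (u y)" by blast
      from \<open>1 + Y \<le> Im (u y)\<close> have "cmod (Complex 0 y - u y) \<le> C + v"
        using niR unfolding near_identity_def 1[symmetric] by blast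
      then have "cmod (u y) \<le> cmod (Complex 0 y) + (C + v)"
        using norm_triangle_ineq2[of "u y" "Complex 0 y"] by (simp add: norm_minus_commute)
      moreover have "cmod (Complex 0 y) = y" using y \<open>0 < b\<close> by (simp add: cmod_def y\<^sub>0_def)
      ultimately show "cmod (u y) \<le> y + C + v" by simp
    qed
    have uR': "recip_cauchy R' (u y) = Complex 0 y" if y: "y\<^sub>0 < y" for y
    proof -
      let ?z = "Complex 0 y"
      have "B1 < y" "B2 < y" using y unfolding y\<^sub>0_def by auto
      note 1 = B1(2)[OF this(1)] and 2 = B2(2)[OF this(2)]
      have "1 \<le> Im (?z + \<phi>\<^sub>2 ?z)" using conjunct1[OF 1] .
      from M_inv[OF conjunct2[OF 1] this] have "\<phi>\<^sub>2 ?z = of_real v / ?z" by (rule add_left_imp_eq)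
      moreover have "?z + \<theta> ?z - of_real v / ?z = ?z + \<psi>\<^sub>2 ?z"
        by (rule \<theta>_eq[OF cone(1)[OF y] conjunct2[OF 2] conjunct1[OF 2]])
      ultimately have "u y = ?z + (\<phi>\<^sub>2 ?z + \<psi>\<^sub>2 ?z)" unfolding u_def by (simp add: algebra_simps)
      moreover have "recip_cauchy R' (?z + (\<phi>\<^sub>2 ?z + \<psi>\<^sub>2 ?z)) = ?z"
        by (rule has_voiculescu_transform_inverse[OF s\<^sub>2]) (use cone(2)[OF y] in blast)
      ultimately show ?thesis by simp
    qed
    \<comment> \<open>A bounded range of heights keeps the points \<open>u y\<close> in a compact
      part of the half plane, and \<open>u\<close> is injective because F_R inverts it. So there is
      an accumulation point for the identity theorem.\<close>
    let ?U = "u ` {y\<^sub>0<..<y\<^sub>0 + 1}"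
    let ?K = "{z. 1 \<le> Im z} \<inter> cball 0 (y\<^sub>0 + 1 + C + v)"
    have "inj_on u {y\<^sub>0<..<y\<^sub>0 + 1}"
    proof (rule inj_onI)
      fix x y assume "x \<in> {y\<^sub>0<..<y\<^sub>0 + 1}" "y \<in> {y\<^sub>0<..<y\<^sub>0 + 1}" and e: "u x = u y"
      then have xy: "y\<^sub>0 < x" "y\<^sub>0 < y" by auto
      have "Complex 0 x = Complex 0 y" using uR(1)[OF xy(1)] unfolding e uR(1)[OF xy(2)] by (rule sym)
      then show "x = y" by simp
    qed
    from finite_image_iff[OF this] have "infinite ?U" using infinite_Ioo[of y\<^sub>0 "y\<^sub>0 + 1"] by simp
    moreover have "?U \<subseteq> ?K"
    proof (rule image_subsetI)
      fix y assume "y \<in> {y\<^sub>0<..<y\<^sub>0 + 1}"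
      then have y: "y\<^sub>0 < y" "y < y\<^sub>0 + 1" by auto
      then show "u y \<in> ?K" using uR(2)[OF y(1)] order.trans[OF uR(3)[OF y(1)], of "y\<^sub>0 + 1 + C + v"] by simp
    qed
    moreover have "compact ?K"
      by (intro closed_Int_compact closed_halfspace_Im_ge compact_cball)
    ultimately obtain \<xi> where \<xi>: "\<xi> \<in> ?K" "\<xi> islimpt ?U"
      using Heine_Borel_imp_Bolzano_Weierstrass by blast
    show "R' = R"
    proof (rule cauchy_transform_unique[OF rR' rR])
      fix z assume z: "0 < Im z"
      have "cauchy_transform R' z - cauchy_transform R z = 0"
      proof (rule analytic_continuation[of "\<lambda>z. cauchy_transform R' z - cauchy_transform R z" "{z. 0 < Im z}" ?U \<xi>])
        show "(\<lambda>z. cauchy_transform R' z - cauchy_transform R z) holomorphic_on {z. 0 < Im z}"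
          by (intro holomorphic_intros R.holomorphic_cauchy_transform R'.holomorphic_cauchy_transform)
        show "connected {z. 0 < Im z}" by (intro convex_connected convex_halfspace_Im_gt)
        show "?U \<subseteq> {z. 0 < Im z}" using \<open>?U \<subseteq> ?K\<close> by auto
        show "\<xi> \<in> {z. 0 < Im z}" using \<xi> by auto
        fix w assume "w \<in> ?U"
        then obtain y where y: "y\<^sub>0 < y" "w = u y" by auto
        show "cauchy_transform R' w - cauchy_transform R w = 0"
          unfolding y(2) G_recip[OF uR(1)[OF y(1)]] G_recip[OF uR'[OF y(1)]] by simp
      qed (use \<xi> z in \<open>auto simp: open_halfspace_Im_gt\<close>)
      then show "cauchy_transform R' z = cauchy_transform R z" by simp
    qed
  qed
qed

section \<open>Resolvents of symmetric matrices\<close>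

definition shifted_mat :: "nat \<Rightarrow> (nat \<Rightarrow> nat \<Rightarrow> real) \<Rightarrow> complex \<Rightarrow> complex mat" where
  "shifted_mat n a z = mat n n (\<lambda>(i, j). (if i = j then z else 0) - complex_of_real (a i j))"

text \<open>Cramer's rule instead of an abstract inverse: the entries are quotients of polynomials
  in the matrix entries, hence measurable, and the diagonal of the adjugate consists of the
  principal minors whose sum is the derivative of the characteristic polynomial.\<close>

definition resolvent :: "nat \<Rightarrow> (nat \<Rightarrow> nat \<Rightarrow> real) \<Rightarrow> complex \<Rightarrow> nat \<Rightarrow> nat \<Rightarrow> complex" where
  "resolvent n a z k l = adj_mat (shifted_mat n a z) $$ (k, l) / Determinant.det (shifted_mat n a z)"

definition sym_array :: "nat \<Rightarrow> (nat \<Rightarrow> nat \<Rightarrow> real) \<Rightarrow> bool" where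
  "sym_array n a \<longleftrightarrow> (\<forall>i<n. \<forall>j<n. a i j = a j i)"

definition norm_trace :: "nat \<Rightarrow> (nat \<Rightarrow> nat \<Rightarrow> real) \<Rightarrow> complex \<Rightarrow> complex" where
  "norm_trace n a z = (\<Sum>j<n. resolvent n a z j j) / of_nat n"

text \<open>The quadratic form of a real symmetric array is real at every complex vector, so only
  \<open>z\<close> contributes to the imaginary part.\<close>

lemma Im_sum_cnj_mult_shifted:
  assumes "sym_array n a" and u: "\<And>i. i < n \<Longrightarrow> u i = z * w i - (\<Sum>j<n. complex_of_real (a i j) * w j)"
  shows "Im (\<Sum>i<n. cnj (w i) * u i) = Im z * (\<Sum>i<n. (cmod (w i))\<^sup>2)"
proof -
  let ?Q = "\<Sum>i<n. \<Sum>j<n. complex_of_real (a i j) * (cnj (w i) * w j)"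
  have "cnj ?Q = (\<Sum>i<n. \<Sum>j<n. complex_of_real (a i j) * (w i * cnj (w j)))" by simp
  also have "\<dots> = (\<Sum>j<n. \<Sum>i<n. complex_of_real (a i j) * (w i * cnj (w j)))" by (rule sum.swap)
  also have "\<dots> = ?Q"
    using assms(1) by (intro sum.cong refl) (auto simp: sym_array_def)
  finally have Q: "Im ?Q = 0" using Reals_cnj_iff complex_is_Real_iff by blast
  have "(\<Sum>i<n. cnj (w i) * u i) = (\<Sum>i<n. z * (w i * cnj (w i)) - (\<Sum>j<n. complex_of_real (a i j) * (cnj (w i) * w j)))"
    by (rule sum.cong) (auto simp: u algebra_simps sum_distrib_left)
  also have "\<dots> = z * (\<Sum>i<n. w i * cnj (w i)) - ?Q" by (simp add: sum_subtractf sum_distrib_left)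
  also have "(\<Sum>i<n. w i * cnj (w i)) = complex_of_real (\<Sum>i<n. (cmod (w i))\<^sup>2)"
    by (simp only: of_real_sum complex_norm_square)
  finally show ?thesis using Q by simp
qed

lemma norm_sum_mult_le:
  fixes f g :: "nat \<Rightarrow> complex"
  shows "(cmod (\<Sum>i<n. f i * g i))\<^sup>2 \<le> (\<Sum>i<n. (cmod (f i))\<^sup>2) * (\<Sum>i<n. (cmod (g i))\<^sup>2)"
proof -
  have "cmod (\<Sum>i<n. f i * g i) \<le> (\<Sum>i<n. cmod (f i) * cmod (g i))"
    by (rule order.trans[OF norm_sum]) (simp add: norm_mult)
  then have "(cmod (\<Sum>i<n. f i * g i))\<^sup>2 \<le> (\<Sum>i<n. cmod (f i) * cmod (g i))\<^sup>2"
    by (rule power_mono) simp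
  also have "\<dots> \<le> (\<Sum>i<n. (cmod (f i))\<^sup>2) * (\<Sum>i<n. (cmod (g i))\<^sup>2)"
    by (rule Cauchy_Schwarz_ineq_sum)
  finally show ?thesis .
qed

text \<open>Cauchy-Schwarz applied to the previous identity: |Im z| |w|^2 \<le> |w| |u|. This lower
  bound does the work of the spectral theorem, as both the invertibility of the shifted matrix and
  the contraction property of the resolvent follow from it.\<close>

lemma shifted_bounded_below:
  assumes "sym_array n a" and u: "\<And>i. i < n \<Longrightarrow> u i = z * w i - (\<Sum>j<n. complex_of_real (a i j) * w j)"
  shows "(Im z)\<^sup>2 * (\<Sum>i<n. (cmod (w i))\<^sup>2) \<le> (\<Sum>i<n. (cmod (u i))\<^sup>2)"
proof -
  let ?W = "\<Sum>i<n. (cmod (w i))\<^sup>2" and ?U = "\<Sum>i<n. (cmod (u i))\<^sup>2"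
  have W0: "0 \<le> ?W" by (intro sum_nonneg) auto
  have U0: "0 \<le> ?U" by (intro sum_nonneg) auto
  have "(Im z * ?W)\<^sup>2 = (Im (\<Sum>i<n. cnj (w i) * u i))\<^sup>2"
    by (subst Im_sum_cnj_mult_shifted[OF assms]) auto
  also have "\<dots> \<le> (cmod (\<Sum>i<n. cnj (w i) * u i))\<^sup>2"
    using abs_Im_le_cmod by (metis abs_ge_zero power2_abs power_mono)
  also have "\<dots> \<le> (\<Sum>i<n. (cmod (cnj (w i)))\<^sup>2) * ?U" by (rule norm_sum_mult_le)
  finally have "((Im z)\<^sup>2 * ?W) * ?W \<le> ?U * ?W" by (simp add: power2_eq_square algebra_simps)
  then show ?thesis using W0 U0 by (cases "?W = 0") (auto simp: mult_le_cancel_right)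
qed

lemma shifted_mat_carrier [simp]: "shifted_mat n a z \<in> carrier_mat n n"
  by (simp add: shifted_mat_def)

lemma det_shifted_mat_nonzero:
  assumes "sym_array n a" "Im z \<noteq> 0"
  shows "Determinant.det (shifted_mat n a z) \<noteq> 0"
proof
  assume "Determinant.det (shifted_mat n a z) = 0"
  then obtain v where v: "v \<in> carrier_vec n" "v \<noteq> 0\<^sub>v n" "shifted_mat n a z *\<^sub>v v = 0\<^sub>v n"
    using det_0_iff_vec_prod_zero[OF shifted_mat_carrier] by blast
  have "0 = z * v $ i - (\<Sum>j<n. complex_of_real (a i j) * v $ j)" if "i < n" for i
  proof -
    have "0 = (shifted_mat n a z *\<^sub>v v) $ i" using v(3) that by simp
    also have "\<dots> = (\<Sum>j<n. ((if i = j then z else 0) - complex_of_real (a i j)) * v $ j)"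
      using that v(1) by (simp add: shifted_mat_def scalar_prod_def lessThan_atLeast0)
    also have "\<dots> = (\<Sum>j<n. (if i = j then z * v $ j else 0)) - (\<Sum>j<n. complex_of_real (a i j) * v $ j)"
      unfolding sum_subtractf[symmetric] by (intro sum.cong) (auto simp: algebra_simps)
    finally show ?thesis using that by simp
  qed
  from shifted_bounded_below[where u = "\<lambda>_. 0" and w = "\<lambda>i. v $ i", OF assms(1) this]
  have "(Im z)\<^sup>2 * (\<Sum>i<n. (cmod (v $ i))\<^sup>2) \<le> 0" by simp
  then have "(\<Sum>i<n. (cmod (v $ i))\<^sup>2) \<le> 0" using assms(2) by (simp add: mult_le_0_iff)
  then have "(\<Sum>i<n. (cmod (v $ i))\<^sup>2) = 0" by (intro antisym sum_nonneg) auto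
  then have "v = 0\<^sub>v n" using v(1) by (intro eq_vecI) (auto simp: sum_nonneg_eq_0_iff)
  with v(2) show False by simp
qed

lemma resolvent_inverse:
  assumes "sym_array n a" "Im z \<noteq> 0" "i < n" "j < n"
  shows "z * resolvent n a z i j - (\<Sum>k<n. complex_of_real (a i k) * resolvent n a z k j) = (if i = j then 1 else 0)"
    and "z * resolvent n a z i j - (\<Sum>k<n. resolvent n a z i k * complex_of_real (a k j)) = (if i = j then 1 else 0)"
proof -
  let ?A = "shifted_mat n a z"
  let ?d = "Determinant.det ?A"
  have d: "?d \<noteq> 0" using assms by (intro det_shifted_mat_nonzero)
  note adj = adj_mat[OF shifted_mat_carrier, of n a z]
  have R: "adj_mat ?A $$ (k, l) = ?d * resolvent n a z k l" for k l
    using d by (simp add: resolvent_def)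
  have "(?A * adj_mat ?A) $$ (i, j) = (\<Sum>k<n. ((if i = k then z else 0) - complex_of_real (a i k)) * (?d * resolvent n a z k j))"
    using adj(1) assms unfolding R[symmetric] by (simp add: shifted_mat_def scalar_prod_def lessThan_atLeast0)
  also have "\<dots> = (\<Sum>k<n. (if i = k then ?d * (z * resolvent n a z k j) else 0)) - ?d * (\<Sum>k<n. complex_of_real (a i k) * resolvent n a z k j)"
    unfolding sum_subtractf[symmetric] sum_distrib_left by (intro sum.cong) (auto simp: algebra_simps)
  finally have "?d * (z * resolvent n a z i j - (\<Sum>k<n. complex_of_real (a i k) * resolvent n a z k j)) = ?d * (if i = j then 1 else 0)"
    using assms adj(2) by (simp add: algebra_simps)
  then show "z * resolvent n a z i j - (\<Sum>k<n. complex_of_real (a i k) * resolvent n a z k j) = (if i = j then 1 else 0)"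
    using d by (subst (asm) mult_left_cancel)
  have "(adj_mat ?A * ?A) $$ (i, j) = (\<Sum>k<n. (?d * resolvent n a z i k) * ((if k = j then z else 0) - complex_of_real (a k j)))"
    using adj(1) assms unfolding R[symmetric] by (simp add: shifted_mat_def scalar_prod_def lessThan_atLeast0)
  also have "\<dots> = (\<Sum>k<n. (if k = j then ?d * (z * resolvent n a z i k) else 0)) - ?d * (\<Sum>k<n. resolvent n a z i k * complex_of_real (a k j))"
    unfolding sum_subtractf[symmetric] sum_distrib_left by (intro sum.cong) (auto simp: algebra_simps)
  finally have "?d * (z * resolvent n a z i j - (\<Sum>k<n. resolvent n a z i k * complex_of_real (a k j))) = ?d * (if i = j then 1 else 0)"
    using assms adj(3) by (simp add: algebra_simps)
  then show "z * resolvent n a z i j - (\<Sum>k<n. resolvent n a z i k * complex_of_real (a k j)) = (if i = j then 1 else 0)"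
    using d by (subst (asm) mult_left_cancel)
qed

lemma resolvent_apply:
  fixes u :: "nat \<Rightarrow> complex"
  assumes "sym_array n a" "Im z \<noteq> 0" "i < n"
  defines "w \<equiv> \<lambda>i. \<Sum>j<n. resolvent n a z i j * u j"
  shows "u i = z * w i - (\<Sum>j<n. complex_of_real (a i j) * w j)"
proof -
  have "z * w i - (\<Sum>j<n. complex_of_real (a i j) * w j) =
      (\<Sum>l<n. z * resolvent n a z i l * u l) - (\<Sum>l<n. \<Sum>j<n. complex_of_real (a i j) * resolvent n a z j l * u l)"
    unfolding w_def by (subst sum.swap) (simp add: sum_distrib_left mult.assoc)
  also have "\<dots> = (\<Sum>l<n. (z * resolvent n a z i l - (\<Sum>j<n. complex_of_real (a i j) * resolvent n a z j l)) * u l)"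
    by (simp add: sum_subtractf left_diff_distrib sum_distrib_right)
  also have "\<dots> = (\<Sum>l<n. (if i = l then u l else 0))"
    using assms by (intro sum.cong refl) (simp add: resolvent_inverse)
  finally show ?thesis using assms by simp
qed

lemma resolvent_solve:
  assumes "sym_array n a" "Im z \<noteq> 0" "i < n"
    and u: "\<And>i. i < n \<Longrightarrow> u i = z * w i - (\<Sum>j<n. complex_of_real (a i j) * w j)"
  shows "w i = (\<Sum>j<n. resolvent n a z i j * u j)"
proof -
  have "(\<Sum>j<n. resolvent n a z i j * u j) =
      (\<Sum>j<n. z * resolvent n a z i j * w j) - (\<Sum>j<n. \<Sum>l<n. resolvent n a z i j * complex_of_real (a j l) * w l)"
    unfolding sum_subtractf[symmetric] by (intro sum.cong refl) (simp add: u right_diff_distrib sum_distrib_left algebra_simps)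
  also have "\<dots> = (\<Sum>l<n. z * resolvent n a z i l * w l) - (\<Sum>l<n. \<Sum>j<n. resolvent n a z i j * complex_of_real (a j l) * w l)"
    by (subst sum.swap) simp
  also have "\<dots> = (\<Sum>l<n. (z * resolvent n a z i l - (\<Sum>j<n. resolvent n a z i j * complex_of_real (a j l))) * w l)"
    by (simp add: sum_subtractf left_diff_distrib sum_distrib_right)
  also have "\<dots> = (\<Sum>l<n. (if i = l then w l else 0))"
    using assms by (intro sum.cong refl) (simp add: resolvent_inverse)
  finally show ?thesis using assms by simp
qed

lemma resolvent_contraction:
  assumes "sym_array n a" "1 \<le> Im z"
  shows "(\<Sum>i<n. (cmod (\<Sum>j<n. resolvent n a z i j * u j))\<^sup>2) \<le> (\<Sum>j<n. (cmod (u j))\<^sup>2)"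
proof -
  let ?W = "\<Sum>i<n. (cmod (\<Sum>j<n. resolvent n a z i j * u j))\<^sup>2"
  have "(Im z)\<^sup>2 * ?W \<le> (\<Sum>j<n. (cmod (u j))\<^sup>2)"
    using assms by (intro shifted_bounded_below[OF assms(1)] resolvent_apply) auto
  moreover have "1 * ?W \<le> (Im z)\<^sup>2 * ?W"
    using assms(2) by (intro mult_right_mono sum_nonneg) (auto simp: one_le_power)
  ultimately show ?thesis by simp
qed

lemma sum_indicator_mult: "j < (n::nat) \<Longrightarrow> (\<Sum>k<n. f k * (if k = j then 1 else 0)) = (f j :: 'a::comm_semiring_1)"
  by (subst sum.cong[OF refl, of _ _ "\<lambda>k. if k = j then f k else 0"]) auto

lemma resolvent_column_le:
  assumes "sym_array n a" "1 \<le> Im z" "j < n"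
  shows "(\<Sum>i<n. (cmod (resolvent n a z i j))\<^sup>2) \<le> 1"
proof -
  have "(\<Sum>i<n. (cmod (\<Sum>k<n. resolvent n a z i k * (if k = j then 1 else 0)))\<^sup>2)
      \<le> (\<Sum>k<n. (cmod (if k = j then 1 else 0))\<^sup>2)"
    by (rule resolvent_contraction[OF assms(1,2)])
  also have "(\<Sum>k<n. (cmod (if k = j then 1 else 0))\<^sup>2) = (\<Sum>k<n. if k = j then 1 else 0)"
    by (intro sum.cong) auto
  finally show ?thesis using assms(3) by (simp add: sum_indicator_mult)
qed

lemma sq_le_sum_sq:
  fixes f :: "nat \<Rightarrow> real"
  assumes "i < n" "(\<Sum>i<n. (f i)\<^sup>2) \<le> 1"
  shows "\<bar>f i\<bar> \<le> 1"
proof -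
  have "(f i)\<^sup>2 \<le> (\<Sum>i<n. (f i)\<^sup>2)" using assms(1) by (intro member_le_sum) auto
  then have "(f i)\<^sup>2 \<le> 1" using assms(2) by linarith
  then show ?thesis by (simp add: abs_square_le_1)
qed

lemma norm_resolvent_le_1:
  assumes "sym_array n a" "1 \<le> Im z" "i < n" "j < n"
  shows "cmod (resolvent n a z i j) \<le> 1"
  using sq_le_sum_sq[OF assms(3) resolvent_column_le[OF assms(1,2,4)]] by simp

text \<open>Every column has norm at most 1. The Hilbert-Schmidt norm is the one in which
  \<open>quadratic_form_variance\<close> measures the coefficients.\<close>

lemma sum_resolvent_sq_le:
  assumes "sym_array n a" "1 \<le> Im z"
  shows "(\<Sum>i<n. \<Sum>j<n. (cmod (resolvent n a z i j))\<^sup>2) \<le> real n"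
proof -
  have "(\<Sum>j<n. \<Sum>i<n. (cmod (resolvent n a z i j))\<^sup>2) \<le> (\<Sum>j<n. 1)"
    using assms by (intro sum_mono resolvent_column_le) auto
  then show ?thesis by (subst sum.swap) simp
qed

lemma norm_norm_trace_le_1:
  assumes "sym_array n a" "1 \<le> Im z"
  shows "cmod (norm_trace n a z) \<le> 1"
proof -
  have "cmod (\<Sum>j<n. resolvent n a z j j) \<le> (\<Sum>j<n. 1)"
    using assms by (intro order.trans[OF norm_sum] sum_mono norm_resolvent_le_1) auto
  then show ?thesis unfolding norm_trace_def by (cases "n = 0") (auto simp: norm_divide)
qed

text \<open>With w = R v the form is the conjugate of <w, (z - A) w>, whose imaginary part is Im z
  |w|^2. Basis vectors give the diagonal of the resolvent, hence the sign for traces, and this sign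
  keeps z - p^2 g as high as z when g is a normalised trace.\<close>

lemma Im_resolvent_quadratic_le_0:
  assumes "sym_array n a" "0 < Im z"
  shows "Im (\<Sum>i<n. \<Sum>j<n. complex_of_real (v i) * resolvent n a z i j * complex_of_real (v j)) \<le> 0"
proof -
  let ?w = "\<lambda>i. \<Sum>j<n. resolvent n a z i j * complex_of_real (v j)"
  have z: "Im z \<noteq> 0" using assms(2) by simp
  have "Im (\<Sum>i<n. cnj (?w i) * complex_of_real (v i)) = Im z * (\<Sum>i<n. (cmod (?w i))\<^sup>2)"
    by (rule Im_sum_cnj_mult_shifted[OF assms(1)], rule resolvent_apply[OF assms(1) z])
  moreover have "0 \<le> Im z * (\<Sum>i<n. (cmod (?w i))\<^sup>2)"
    using assms(2) by (intro mult_nonneg_nonneg sum_nonneg) auto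
  moreover have "(\<Sum>i<n. \<Sum>j<n. complex_of_real (v i) * resolvent n a z i j * complex_of_real (v j)) =
      cnj (\<Sum>i<n. cnj (?w i) * complex_of_real (v i))"
    by (simp add: sum_distrib_left sum_distrib_right mult_ac)
  ultimately show ?thesis by (simp only: cnj.sel)
qed

lemma Im_resolvent_diag_le_0:
  assumes "sym_array n a" "0 < Im z" "k < n"
  shows "Im (resolvent n a z k k) \<le> 0"
proof -
  have e: "complex_of_real (if i = k then 1 else 0) = (if i = k then 1 else 0)" for i :: nat by simp
  have "(\<Sum>i<n. \<Sum>j<n. complex_of_real (if i = k then 1 else 0) * resolvent n a z i j * complex_of_real (if j = k then 1 else 0))
     = (\<Sum>i<n. (if i = k then 1 else 0) * resolvent n a z i k)"
    unfolding e by (intro sum.cong refl sum_indicator_mult[OF assms(3)])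
  also have "\<dots> = resolvent n a z k k"
    using sum_indicator_mult[OF assms(3), of "\<lambda>i. resolvent n a z i k"] by (simp only: mult.commute)
  finally show ?thesis
    using Im_resolvent_quadratic_le_0[OF assms(1,2), of "\<lambda>i. if i = k then 1 else 0"] by simp
qed

lemma Im_norm_trace_le_0:
  assumes "sym_array n a" "0 < Im z"
  shows "Im (norm_trace n a z) \<le> 0"
proof -
  have "Im (norm_trace n a z) = (\<Sum>j<n. Im (resolvent n a z j j)) / real n"
    unfolding norm_trace_def by (simp add: Im_divide_of_nat)
  also have "\<dots> \<le> 0"
    using assms by (intro divide_nonpos_nonneg sum_nonpos Im_resolvent_diag_le_0) auto
  finally show ?thesis .
qed

section \<open>Perturbation and measurability of resolvents\<close>

lemma resolvent_diff:
  assumes "sym_array n a" "sym_array n b" "Im z \<noteq> 0" "i < n" "j < n"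
  shows "resolvent n a z i j - resolvent n b z i j =
    (\<Sum>k<n. \<Sum>l<n. resolvent n a z i k * complex_of_real (a k l - b k l) * resolvent n b z l j)"
proof -
  have "resolvent n b z i j = (\<Sum>k<n. resolvent n a z i k * ((if k = j then 1 else 0)
      - (\<Sum>l<n. complex_of_real (a k l - b k l) * resolvent n b z l j)))"
  proof (rule resolvent_solve[OF assms(1,3,4)])
    fix k assume k: "k < n"
    show "(if k = j then 1 else 0) - (\<Sum>l<n. complex_of_real (a k l - b k l) * resolvent n b z l j) =
        z * resolvent n b z k j - (\<Sum>l<n. complex_of_real (a k l) * resolvent n b z l j)"
      unfolding resolvent_inverse(1)[OF assms(2,3) k assms(5), symmetric]
      by (simp add: left_diff_distrib sum_subtractf)
  qed
  also have "\<dots> = (\<Sum>k<n. resolvent n a z i k * (if k = j then 1 else 0))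
      - (\<Sum>k<n. \<Sum>l<n. resolvent n a z i k * complex_of_real (a k l - b k l) * resolvent n b z l j)"
    by (simp only: right_diff_distrib sum_subtractf sum_distrib_left mult.assoc)
  also have "(\<Sum>k<n. resolvent n a z i k * (if k = j then 1 else 0)) = resolvent n a z i j"
    by (rule sum_indicator_mult[OF assms(5)])
  finally show ?thesis by simp
qed

text \<open>By the resolvent identity the difference of the traces is the trace of R_a (a - b) R_b,
  that is, the sum of (a - b)(k, l) times the entry (l, k) of R_b R_a. A product of two contractions
  has entries of modulus at most 1.\<close>

lemma norm_trace_diff_le:
  assumes "sym_array n a" "sym_array n b" "1 \<le> Im z"
  shows "cmod (norm_trace n a z - norm_trace n b z) \<le> (\<Sum>k<n. \<Sum>l<n. \<bar>a k l - b k l\<bar>) / real n"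
proof -
  have z: "Im z \<noteq> 0" using assms(3) by simp
  let ?S = "\<lambda>l k. \<Sum>i<n. resolvent n b z l i * resolvent n a z i k"
  have S: "cmod (?S l k) \<le> 1" if "l < n" "k < n" for l k
  proof -
    have "(\<Sum>l<n. (cmod (?S l k))\<^sup>2) \<le> (\<Sum>i<n. (cmod (resolvent n a z i k))\<^sup>2)"
      by (rule resolvent_contraction[OF assms(2,3)])
    also have "\<dots> \<le> 1" by (rule resolvent_column_le[OF assms(1,3) that(2)])
    finally show ?thesis using sq_le_sum_sq[OF that(1), of "\<lambda>l. cmod (?S l k)"] by simp
  qed
  have "(\<Sum>j<n. resolvent n a z j j) - (\<Sum>j<n. resolvent n b z j j) =
      (\<Sum>j<n. \<Sum>k<n. \<Sum>l<n. resolvent n a z j k * complex_of_real (a k l - b k l) * resolvent n b z l j)"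
    unfolding sum_subtractf[symmetric] by (intro sum.cong refl resolvent_diff[OF assms(1,2) z]) auto
  also have "\<dots> = (\<Sum>k<n. \<Sum>l<n. \<Sum>j<n. resolvent n a z j k * complex_of_real (a k l - b k l) * resolvent n b z l j)"
    by (subst sum.swap, rule sum.cong[OF refl], rule sum.swap)
  also have "\<dots> = (\<Sum>k<n. \<Sum>l<n. complex_of_real (a k l - b k l) * ?S l k)"
    by (simp add: sum_distrib_left mult_ac)
  also have "cmod \<dots> \<le> (\<Sum>k<n. \<Sum>l<n. \<bar>a k l - b k l\<bar>)"
  proof (intro order.trans[OF norm_sum] sum_mono)
    fix k l assume "k \<in> {..<n}" "l \<in> {..<n}"
    then have "\<bar>a k l - b k l\<bar> * cmod (?S l k) \<le> \<bar>a k l - b k l\<bar> * 1" by (intro mult_left_mono S) auto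
    then show "cmod (complex_of_real (a k l - b k l) * ?S l k) \<le> \<bar>a k l - b k l\<bar>"
      unfolding norm_mult norm_of_real by simp
  qed
  finally have "cmod ((\<Sum>j<n. resolvent n a z j j) - (\<Sum>j<n. resolvent n b z j j)) \<le> (\<Sum>k<n. \<Sum>l<n. \<bar>a k l - b k l\<bar>)" .
  then have "cmod (((\<Sum>j<n. resolvent n a z j j) - (\<Sum>j<n. resolvent n b z j j)) / of_nat n) \<le> (\<Sum>k<n. \<Sum>l<n. \<bar>a k l - b k l\<bar>) / real n"
    unfolding norm_divide norm_of_nat by (rule divide_right_mono) simp
  then show ?thesis unfolding norm_trace_def diff_divide_distrib .
qed

lemma resolvent_cong:
  assumes "\<And>i j. i < n \<Longrightarrow> j < n \<Longrightarrow> a i j = b i j"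
  shows "resolvent n a z = resolvent n b z"
proof -
  have "shifted_mat n a z = shifted_mat n b z"
    unfolding shifted_mat_def using assms by (intro cong_mat) auto
  then show ?thesis by (intro ext) (simp add: resolvent_def)
qed

text \<open>By the Leibniz formula determinants are polynomials in the entries. The spectral
  parameter may depend on the sample point too, which gives joint measurability in the matrix and
  the real part of \<open>z\<close>.\<close>

lemma borel_measurable_resolvent:
  assumes a: "\<And>i j. i < n \<Longrightarrow> j < n \<Longrightarrow> (\<lambda>x. a x i j) \<in> borel_measurable M"
    and z [measurable]: "z \<in> borel_measurable M" and kl: "k < n" "l < n"
  shows "(\<lambda>x. resolvent n (a x) (z x) k l) \<in> borel_measurable M"
proof -
  have det: "(\<lambda>x. Determinant.det (mat m m (\<lambda>(i, j). b x i j))) \<in> borel_measurable M"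
    if "\<And>i j. i < m \<Longrightarrow> j < m \<Longrightarrow> (\<lambda>x. b x i j) \<in> borel_measurable M" for m and b :: "_ \<Rightarrow> nat \<Rightarrow> nat \<Rightarrow> complex"
  proof -
    have "(\<lambda>x. Determinant.det (mat m m (\<lambda>(i, j). b x i j))) =
        (\<lambda>x. \<Sum>p | p permutes {0..<m}. of_int (sign p) * (\<Prod>i = 0..<m. b x i (p i)))"
    proof (rule ext)
      fix x
      have "mat m m (\<lambda>(i, j). b x i j) \<in> carrier_mat m m" by simp
      from det_def'[OF this]
      show "Determinant.det (mat m m (\<lambda>(i, j). b x i j)) =
          (\<Sum>p | p permutes {0..<m}. of_int (sign p) * (\<Prod>i = 0..<m. b x i (p i)))"
      proof (rule trans, intro sum.cong refl arg_cong2[of _ _ _ _ "(*)"] prod.cong)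
        fix p i assume "p \<in> {p. p permutes {0..<m}}" "i \<in> {0..<m}"
        then have "p i < m" "i < m" using permutes_in_image[of p "{0..<m}" i] by auto
        then show "mat m m (\<lambda>(i, j). b x i j) $$ (i, p i) = b x i (p i)" by simp
      qed
    qed
    also have "\<dots> \<in> borel_measurable M"
      using that by (intro borel_measurable_sum borel_measurable_times borel_measurable_const borel_measurable_prod)
        (auto simp: permutes_in_image)
    finally show ?thesis .
  qed
  let ?s = "\<lambda>x i j. (if i = j then z x else 0) - complex_of_real (a x i j)"
  have s: "(\<lambda>x. ?s x i j) \<in> borel_measurable M" if "i < n" "j < n" for i j
    using a[OF that] by (cases "i = j") auto
  have 1: "(\<lambda>x. Determinant.det (shifted_mat n (a x) (z x))) \<in> borel_measurable M"
    unfolding shifted_mat_def by (rule det) (rule s)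
  have "(\<lambda>x. adj_mat (shifted_mat n (a x) (z x)) $$ (k, l)) = (\<lambda>x. (- 1) ^ (l + k) *
      Determinant.det (mat (n - 1) (n - 1) (\<lambda>(i, j). ?s x (if i < l then i else Suc i) (if j < k then j else Suc j))))"
    using kl unfolding adj_mat_def cofactor_def mat_delete_def shifted_mat_def
    by (intro ext) (simp, intro arg_cong[of _ _ Determinant.det] cong_mat, auto)
  also have "\<dots> \<in> borel_measurable M"
    using kl by (intro borel_measurable_times borel_measurable_const det s) auto
  finally show ?thesis unfolding resolvent_def using 1 by (intro borel_measurable_divide)
qed

lemma borel_measurable_norm_trace:
  assumes "\<And>i j. i < n \<Longrightarrow> j < n \<Longrightarrow> (\<lambda>x. a x i j) \<in> borel_measurable M"
    and "z \<in> borel_measurable M"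
  shows "(\<lambda>x. norm_trace n (a x) (z x)) \<in> borel_measurable M"
  unfolding norm_trace_def using assms
  by (intro borel_measurable_divide borel_measurable_sum borel_measurable_resolvent) auto

section \<open>The semicircle and normal distributions\<close>

context
  fixes s :: real
  assumes s: "0 < s"
begin

text \<open>This is \<open>pi\<close> times the Cauchy transform of the arcsine law on [-2 s, 2 s],
  hence pi / sqrt (z^2 - 4 s^2). The integral singles out the right branch of the root without
  naming it.\<close>

definition arcsine_kernel :: "complex \<Rightarrow> complex" where
  "arcsine_kernel z = integral {- (pi / 2)..pi / 2} (\<lambda>\<theta>. 1 / (z - complex_of_real (2 * s * sin \<theta>)))"

lemma continuous_on_arcsine_integrand:
  "0 < Im z \<Longrightarrow> continuous_on S (\<lambda>\<theta>. 1 / (z - complex_of_real (2 * s * sin \<theta>)))"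
  using diff_of_real_nonzero[of z] by (intro continuous_intros) auto

lemma arcsine_kernel_has_derivative:
  assumes "0 < Im z"
  shows "(arcsine_kernel has_field_derivative
    integral {- (pi / 2)..pi / 2} (\<lambda>\<theta>. - (1 / (z - complex_of_real (2 * s * sin \<theta>))\<^sup>2))) (at z)"
proof -
  let ?U = "{z. 0 < Im z}"
  have "((\<lambda>z. integral (cbox (- (pi / 2)) (pi / 2)) (\<lambda>\<theta>. 1 / (z - complex_of_real (2 * s * sin \<theta>))))
      has_field_derivative integral (cbox (- (pi / 2)) (pi / 2)) (\<lambda>\<theta>. - (1 / (z - complex_of_real (2 * s * sin \<theta>))\<^sup>2))) (at z within ?U)"
  proof (rule leibniz_rule_field_derivative)
    fix w :: complex and \<theta> :: real assume "w \<in> ?U"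
    then have "w - complex_of_real (2 * s * sin \<theta>) \<noteq> 0" using diff_of_real_nonzero[of w] by auto
    then show "((\<lambda>w. 1 / (w - complex_of_real (2 * s * sin \<theta>))) has_field_derivative
        - (1 / (w - complex_of_real (2 * s * sin \<theta>))\<^sup>2)) (at w within ?U)"
      by (auto intro!: derivative_eq_intros simp: power2_eq_square)
  next
    fix w assume "w \<in> ?U"
    then show "(\<lambda>\<theta>. 1 / (w - complex_of_real (2 * s * sin \<theta>))) integrable_on cbox (- (pi / 2)) (pi / 2)"
      by (intro integrable_continuous continuous_on_arcsine_integrand) auto
  next
    show "continuous_on (?U \<times> cbox (- (pi / 2)) (pi / 2)) (\<lambda>(z, \<theta>). - (1 / (z - complex_of_real (2 * s * sin \<theta>))\<^sup>2))"
      unfolding split_beta using diff_of_real_nonzero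
      by (intro continuous_intros) auto
  qed (use assms convex_halfspace_Im_gt in auto)
  then show ?thesis
    unfolding arcsine_kernel_def[abs_def] using assms
    by (simp add: at_within_open[OF _ open_halfspace_Im_gt])
qed

text \<open>The integrand of the left-hand side is \<open>2 s\<close> times the \<open>\<theta>\<close>-derivative of
  \<open>cos \<theta> / (z - 2 s sin \<theta>)\<close>, which vanishes at both end points.\<close>

lemma arcsine_kernel_ode:
  assumes z: "0 < Im z"
  shows "(z\<^sup>2 - 4 * (complex_of_real s)\<^sup>2) * integral {- (pi / 2)..pi / 2} (\<lambda>\<theta>. - (1 / (z - complex_of_real (2 * s * sin \<theta>))\<^sup>2))
    + z * arcsine_kernel z = 0"
proof -
  let ?I = "{- (pi / 2)..pi / 2}"
  let ?d = "\<lambda>\<theta>. z - complex_of_real (2 * s * sin \<theta>)"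
  let ?s = "complex_of_real s"
  have d: "?d \<theta> \<noteq> 0" for \<theta> using diff_of_real_nonzero[of z] z by auto
  have int1: "(\<lambda>\<theta>. - (1 / (?d \<theta>)\<^sup>2)) integrable_on ?I"
    using d by (intro integrable_continuous_real continuous_intros) auto
  have int2: "(\<lambda>\<theta>. 1 / ?d \<theta>) integrable_on ?I"
    using continuous_on_arcsine_integrand[OF z] by (intro integrable_continuous_real)
  have "((\<lambda>\<theta>. 2 * ?s * ((2 * ?s - z * complex_of_real (sin \<theta>)) / (?d \<theta>)\<^sup>2)) has_integral
      (\<lambda>w. 2 * ?s * (cos w / (z - 2 * ?s * sin w))) (complex_of_real (pi / 2)) -
      (\<lambda>w. 2 * ?s * (cos w / (z - 2 * ?s * sin w))) (complex_of_real (- (pi / 2)))) ?I"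
  proof (rule fundamental_theorem_of_calculus)
    fix \<theta> :: real
    have ne: "z - 2 * ?s * sin (complex_of_real \<theta>) \<noteq> 0" using d[of \<theta>] by (simp add: sin_of_real)
    have "- S * (z - 2 * ?s * S) - C * (- (2 * ?s * C)) = 2 * ?s * (S * S + C * C) - z * S" for S C :: complex
      by (simp add: algebra_simps)
    from this[of "sin (complex_of_real \<theta>)" "cos (complex_of_real \<theta>)"] have eq: "- sin (complex_of_real \<theta>) * (z - 2 * ?s * sin (complex_of_real \<theta>)) - cos (complex_of_real \<theta>) * (- (2 * ?s * cos (complex_of_real \<theta>)))
        = 2 * ?s - z * sin (complex_of_real \<theta>)"
      by (simp only: sin_cos_squared_add3 sin_cos_squared_add[unfolded power2_eq_square] mult_1_right)
    have "((\<lambda>w. 2 * ?s * (cos w / (z - 2 * ?s * sin w))) has_field_derivative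
      2 * ?s * ((- sin (complex_of_real \<theta>) * (z - 2 * ?s * sin (complex_of_real \<theta>)) - cos (complex_of_real \<theta>) * (- (2 * ?s * cos (complex_of_real \<theta>))))
        / ((z - 2 * ?s * sin (complex_of_real \<theta>)) * (z - 2 * ?s * sin (complex_of_real \<theta>))))) (at (complex_of_real \<theta>))"
      using ne by (intro DERIV_cmult DERIV_divide) (auto intro!: derivative_eq_intros)
    from has_vector_derivative_real_field[OF this[unfolded eq]]
    show "((\<lambda>\<theta>. 2 * ?s * (cos (complex_of_real \<theta>) / (z - 2 * ?s * sin (complex_of_real \<theta>)))) has_vector_derivative
      2 * ?s * ((2 * ?s - z * complex_of_real (sin \<theta>)) / (?d \<theta>)\<^sup>2)) (at \<theta> within ?I)"
      by (simp add: sin_of_real power2_eq_square)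
  qed simp
  moreover have "cos (complex_of_real (pi / 2)) = 0" "cos (complex_of_real (- (pi / 2))) = 0"
    by (simp_all only: cos_of_real cos_minus cos_pi_half of_real_0)
  ultimately have "((\<lambda>\<theta>. 2 * ?s * ((2 * ?s - z * complex_of_real (sin \<theta>)) / (?d \<theta>)\<^sup>2)) has_integral 0) ?I"
    by simp
  moreover have "2 * ?s * ((2 * ?s - z * complex_of_real (sin \<theta>)) / (?d \<theta>)\<^sup>2) =
      (z\<^sup>2 - 4 * ?s\<^sup>2) * (- (1 / (?d \<theta>)\<^sup>2)) + z * (1 / ?d \<theta>)" for \<theta>
  proof -
    have e: "2 * a * ((2 * a - z * S) / D\<^sup>2) = (z\<^sup>2 - 4 * a\<^sup>2) * (- (1 / D\<^sup>2)) + z * (1 / D)"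
      if D: "D \<noteq> 0" "D = z - 2 * a * S" for a S D
    proof -
      have "z * (1 / D) = z * D * (1 / D\<^sup>2)" using D(1) by (simp add: power2_eq_square)
      then have "(z\<^sup>2 - 4 * a\<^sup>2) * (- (1 / D\<^sup>2)) + z * (1 / D) = (z * D - (z\<^sup>2 - 4 * a\<^sup>2)) * (1 / D\<^sup>2)"
        by (simp add: diff_divide_distrib)
      also have "z * D - (z\<^sup>2 - 4 * a\<^sup>2) = 2 * a * (2 * a - z * S)"
        by (subst D(2)) (simp add: power2_eq_square algebra_simps)
      finally show ?thesis by simp
    qed
    show ?thesis by (rule e[OF d]) simp
  qed
  ultimately have "((\<lambda>\<theta>. (z\<^sup>2 - 4 * ?s\<^sup>2) * (- (1 / (?d \<theta>)\<^sup>2)) + z * (1 / ?d \<theta>)) has_integral 0) ?I"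
    by simp
  moreover have "((\<lambda>\<theta>. (z\<^sup>2 - 4 * ?s\<^sup>2) * (- (1 / (?d \<theta>)\<^sup>2)) + z * (1 / ?d \<theta>)) has_integral
      (z\<^sup>2 - 4 * ?s\<^sup>2) * integral ?I (\<lambda>\<theta>. - (1 / (?d \<theta>)\<^sup>2)) + z * integral ?I (\<lambda>\<theta>. 1 / ?d \<theta>)) ?I"
    by (intro has_integral_add has_integral_mult_right integrable_integral int1 int2)
  ultimately show ?thesis unfolding arcsine_kernel_def by (rule has_integral_unique[symmetric])
qed

text \<open>By \<open>arcsine_kernel_ode\<close> the derivative of the left-hand side vanishes, so
  it is constant on the half plane. The constant is read off at infinity along the imaginary axis,
  where the kernel tends to 0 and z times the kernel to \<open>pi\<close>.\<close>

lemma arcsine_kernel_square: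
  assumes z: "0 < Im z"
  shows "(arcsine_kernel z)\<^sup>2 * (z\<^sup>2 - 4 * (complex_of_real s)\<^sup>2) = (complex_of_real pi)\<^sup>2"
proof -
  let ?U = "{z. 0 < Im z}" and ?I = "{- (pi / 2)..pi / 2}"
  let ?f = "\<lambda>z. (arcsine_kernel z)\<^sup>2 * (z\<^sup>2 - 4 * (complex_of_real s)\<^sup>2)"
  have "(?f has_field_derivative 0) (at w within ?U)" if w: "w \<in> ?U" for w
  proof (rule has_field_derivative_at_within)
    have w': "0 < Im w" using w by simp
    let ?K' = "integral ?I (\<lambda>\<theta>. - (1 / (w - complex_of_real (2 * s * sin \<theta>))\<^sup>2))"
    have "(?f has_field_derivative 2 * arcsine_kernel w * ?K' * (w\<^sup>2 - 4 * (complex_of_real s)\<^sup>2) + (arcsine_kernel w)\<^sup>2 * (2 * w)) (at w)"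
      by (rule derivative_eq_intros arcsine_kernel_has_derivative[OF w'] refl)+ (simp add: algebra_simps)
    also have "2 * arcsine_kernel w * ?K' * (w\<^sup>2 - 4 * (complex_of_real s)\<^sup>2) + (arcsine_kernel w)\<^sup>2 * (2 * w)
        = 2 * arcsine_kernel w * ((w\<^sup>2 - 4 * (complex_of_real s)\<^sup>2) * ?K' + w * arcsine_kernel w)"
      by (simp only: power2_eq_square) (simp only: algebra_simps)
    also have "\<dots> = 0" unfolding arcsine_kernel_ode[OF w'] by simp
    finally show "(?f has_field_derivative 0) (at w)" .
  qed
  from has_field_derivative_zero_constant[OF convex_halfspace_Im_gt this]
  obtain c where c: "\<And>w. w \<in> ?U \<Longrightarrow> ?f w = c" by blast
  have bK: "cmod (arcsine_kernel (Complex 0 y)) \<le> pi / y" and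
    bzK: "cmod (Complex 0 y * arcsine_kernel (Complex 0 y) - complex_of_real pi) \<le> 2 * s * pi / y" if y: "0 < y" for y
  proof -
    let ?z = "Complex 0 y"
    have z: "0 < Im ?z" using y by simp
    have d: "?z - complex_of_real (2 * s * sin \<theta>) \<noteq> 0" for \<theta>
      by (rule diff_of_real_nonzero) (use z in simp)
    have b: "cmod (1 / (?z - complex_of_real t)) \<le> 1 / y" for t using norm_inverse_diff_le[of y ?z t] y by simp
    have int: "(\<lambda>\<theta>. 1 / (?z - complex_of_real (2 * s * sin \<theta>))) integrable_on ?I"
      using continuous_on_arcsine_integrand[OF z] by (intro integrable_continuous_real)
    have "cmod (arcsine_kernel ?z) \<le> integral ?I (\<lambda>_. 1 / y)"
      unfolding arcsine_kernel_def using b by (intro integral_norm_bound_integral int) (auto simp del: of_real_mult)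
    then show "cmod (arcsine_kernel ?z) \<le> pi / y" by (simp add: field_simps)
    have "?z * arcsine_kernel ?z - complex_of_real pi = integral ?I (\<lambda>\<theta>. ?z * (1 / (?z - complex_of_real (2 * s * sin \<theta>)))) - integral ?I (\<lambda>\<theta>. 1)"
      unfolding arcsine_kernel_def by (subst integral_mult_right) (auto simp: scaleR_conv_of_real)
    also have "\<dots> = integral ?I (\<lambda>\<theta>. ?z * (1 / (?z - complex_of_real (2 * s * sin \<theta>))) - 1)"
      by (intro Henstock_Kurzweil_Integration.integral_diff[symmetric] integrable_on_mult_right int) auto
    also have "\<dots> = integral ?I (\<lambda>\<theta>. complex_of_real (2 * s * sin \<theta>) * (1 / (?z - complex_of_real (2 * s * sin \<theta>))))"
    proof (rule Henstock_Kurzweil_Integration.integral_cong)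
      have e: "u * (1 / (u - t)) - 1 = t * (1 / (u - t))" if "u - t \<noteq> 0" for u t :: complex
        using that by (simp add: field_simps)
      show "?z * (1 / (?z - complex_of_real (2 * s * sin \<theta>))) - 1 =
          complex_of_real (2 * s * sin \<theta>) * (1 / (?z - complex_of_real (2 * s * sin \<theta>)))" for \<theta>
        by (rule e[OF d])
    qed
    also have "cmod \<dots> \<le> integral ?I (\<lambda>_. 2 * s * (1 / y))"
    proof (rule integral_norm_bound_integral)
      show "(\<lambda>\<theta>. complex_of_real (2 * s * sin \<theta>) * (1 / (?z - complex_of_real (2 * s * sin \<theta>)))) integrable_on ?I"
        using d by (intro integrable_continuous_real continuous_intros) auto
      fix \<theta>
      have "\<bar>2 * s * sin \<theta>\<bar> \<le> 2 * s" using s by (simp add: abs_mult)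
      then have "\<bar>2 * s * sin \<theta>\<bar> * cmod (1 / (?z - complex_of_real (2 * s * sin \<theta>))) \<le> 2 * s * (1 / y)"
        using s y by (intro mult_mono b) auto
      then show "cmod (complex_of_real (2 * s * sin \<theta>) * (1 / (?z - complex_of_real (2 * s * sin \<theta>)))) \<le> 2 * s * (1 / y)"
        unfolding norm_mult norm_of_real .
    qed auto
    finally show "cmod (?z * arcsine_kernel ?z - complex_of_real pi) \<le> 2 * s * pi / y" by (simp add: field_simps)
  qed
  let ?y = "\<lambda>n::nat. real (Suc n)"
  let ?z = "\<lambda>n. Complex 0 (?y n)"
  have l1: "(\<lambda>n. arcsine_kernel (?z n)) \<longlonglongrightarrow> 0"
  proof (rule Lim_null_comparison)
    show "\<forall>\<^sub>F n in sequentially. cmod (arcsine_kernel (?z n)) \<le> pi / ?y n"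
      using bK by (intro always_eventually allI) simp
    show "(\<lambda>n. pi / ?y n) \<longlonglongrightarrow> 0" by real_asymp
  qed
  have "(\<lambda>n. ?z n * arcsine_kernel (?z n) - complex_of_real pi) \<longlonglongrightarrow> 0"
  proof (rule Lim_null_comparison)
    show "\<forall>\<^sub>F n in sequentially. cmod (?z n * arcsine_kernel (?z n) - complex_of_real pi) \<le> 2 * s * pi / ?y n"
      using bzK by (intro always_eventually allI) simp
    show "(\<lambda>n. 2 * s * pi / ?y n) \<longlonglongrightarrow> 0" by real_asymp
  qed
  then have l2: "(\<lambda>n. ?z n * arcsine_kernel (?z n)) \<longlonglongrightarrow> complex_of_real pi" by (rule Lim_null[THEN iffD2])
  have "(\<lambda>n. (?z n * arcsine_kernel (?z n))\<^sup>2 - 4 * (complex_of_real s)\<^sup>2 * (arcsine_kernel (?z n))\<^sup>2)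
      \<longlonglongrightarrow> (complex_of_real pi)\<^sup>2 - 4 * (complex_of_real s)\<^sup>2 * 0\<^sup>2"
    by (intro tendsto_intros l1 l2)
  moreover have "(?z n * arcsine_kernel (?z n))\<^sup>2 - 4 * (complex_of_real s)\<^sup>2 * (arcsine_kernel (?z n))\<^sup>2 = c" for n
    using c[of "?z n"] by (simp add: power_mult_distrib algebra_simps)
  ultimately have "(complex_of_real pi)\<^sup>2 = c" by (simp add: LIMSEQ_const_iff)
  then show ?thesis using c[of z] z by simp
qed

text \<open>The substitution x = 2 s sin \<theta> removes the square root and leaves the weight 2 /
  pi cos^2 \<theta>. A general \<open>h\<close> covers both the total mass and the Cauchy
  kernel.\<close>

lemma semicircle_density_integral:
  fixes h :: "real \<Rightarrow> 'b::{euclidean_space, second_countable_topology}"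
  assumes h: "continuous_on UNIV h"
  defines "f \<equiv> \<lambda>x. sqrt (max 0 (4 * s\<^sup>2 - x\<^sup>2)) / (2 * pi * s\<^sup>2)"
  shows "integrable lborel (\<lambda>x. f x *\<^sub>R h x)"
    and "((\<lambda>\<theta>. (2 / pi * (cos \<theta>)\<^sup>2) *\<^sub>R h (2 * s * sin \<theta>)) has_integral (\<integral>x. f x *\<^sub>R h x \<partial>lborel)) {- (pi / 2)..pi / 2}"
proof -
  let ?S = "{- (2 * s)..2 * s}" and ?I = "{- (pi / 2)..pi / 2}"
  have cont: "continuous_on ?S (\<lambda>x. f x *\<^sub>R h x)"
    unfolding f_def using s continuous_on_subset[OF h]
    by (intro continuous_intros) auto
  have eq: "(\<lambda>x. f x *\<^sub>R h x) = (\<lambda>x. indicator ?S x *\<^sub>R (f x *\<^sub>R h x))"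
  proof
    fix x :: real
    have "f x = 0" if "x \<notin> ?S"
    proof -
      have "(2 * s)\<^sup>2 \<le> \<bar>x\<bar>\<^sup>2" using that s by (intro power_mono) auto
      then show ?thesis unfolding f_def by (simp add: power_mult_distrib)
    qed
    then show "f x *\<^sub>R h x = indicator ?S x *\<^sub>R (f x *\<^sub>R h x)" by (auto simp: indicator_def)
  qed
  have si: "set_integrable lborel ?S (\<lambda>x. f x *\<^sub>R h x)"
    by (rule borel_integrable_atLeastAtMost'[OF cont])
  then show "integrable lborel (\<lambda>x. f x *\<^sub>R h x)"
    unfolding set_integrable_def using eq by simp
  have "(\<integral>x. f x *\<^sub>R h x \<partial>lborel) = set_lebesgue_integral lborel ?S (\<lambda>x. f x *\<^sub>R h x)"
    unfolding set_lebesgue_integral_def using eq by simp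
  also have "\<dots> = integral ?S (\<lambda>x. f x *\<^sub>R h x)" by (rule set_borel_integral_eq_integral[OF si])
  finally have 1: "(\<integral>x. f x *\<^sub>R h x \<partial>lborel) = integral ?S (\<lambda>x. f x *\<^sub>R h x)" .
  have "((\<lambda>\<theta>. (2 * s * cos \<theta>) *\<^sub>R (f (2 * s * sin \<theta>) *\<^sub>R h (2 * s * sin \<theta>))) has_integral
      integral {2 * s * sin (- (pi / 2))..2 * s * sin (pi / 2)} (\<lambda>x. f x *\<^sub>R h x)) ?I"
  proof (rule has_integral_substitution)
    show "(\<lambda>\<theta>. 2 * s * sin \<theta>) ` ?I \<subseteq> ?S"
    proof (rule image_subsetI)
      fix \<theta>
      have "2 * s * (- 1) \<le> 2 * s * sin \<theta>" "2 * s * sin \<theta> \<le> 2 * s * 1"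
        using s by (intro mult_left_mono; simp)+
      then show "2 * s * sin \<theta> \<in> ?S" by simp
    qed
    show "((\<lambda>\<theta>. 2 * s * sin \<theta>) has_real_derivative 2 * s * cos \<theta>) (at \<theta> within ?I)" for \<theta>
      by (auto intro!: derivative_eq_intros)
  qed (use cont s in auto)
  also have "{2 * s * sin (- (pi / 2))..2 * s * sin (pi / 2)} = ?S" by simp
  finally have 2: "((\<lambda>\<theta>. (2 * s * cos \<theta>) *\<^sub>R (f (2 * s * sin \<theta>) *\<^sub>R h (2 * s * sin \<theta>))) has_integral (\<integral>x. f x *\<^sub>R h x \<partial>lborel)) ?I"
    unfolding 1 .
  show "((\<lambda>\<theta>. (2 / pi * (cos \<theta>)\<^sup>2) *\<^sub>R h (2 * s * sin \<theta>)) has_integral (\<integral>x. f x *\<^sub>R h x \<partial>lborel)) ?I"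
  proof (rule has_integral_eq[OF _ 2])
    fix \<theta> :: real assume "\<theta> \<in> ?I"
    then have c: "0 \<le> cos \<theta>" by (intro cos_ge_zero) auto
    have "4 * s\<^sup>2 - (2 * s * sin \<theta>)\<^sup>2 = (2 * s * cos \<theta>)\<^sup>2"
      unfolding power_mult_distrib cos_squared_eq by (simp add: algebra_simps)
    then have "f (2 * s * sin \<theta>) = 2 * s * cos \<theta> / (2 * pi * s\<^sup>2)"
      unfolding f_def using c s by simp
    then have "2 * s * cos \<theta> * f (2 * s * sin \<theta>) = 2 / pi * (cos \<theta>)\<^sup>2"
      using s by (simp add: field_simps power2_eq_square)
    then show "(2 * s * cos \<theta>) *\<^sub>R (f (2 * s * sin \<theta>) *\<^sub>R h (2 * s * sin \<theta>)) = (2 / pi * (cos \<theta>)\<^sup>2) *\<^sub>R h (2 * s * sin \<theta>)"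
      by simp
  qed
qed

lemma semicircle_eq_density:
  "semicircle 0 (s\<^sup>2) = density lborel (\<lambda>x. ennreal (sqrt (max 0 (4 * s\<^sup>2 - x\<^sup>2)) / (2 * pi * s\<^sup>2)))"
  using s by (simp add: semicircle_def)

lemma real_distribution_semicircle_pos: "real_distribution (semicircle 0 (s\<^sup>2))"
proof -
  let ?f = "\<lambda>x. sqrt (max 0 (4 * s\<^sup>2 - x\<^sup>2)) / (2 * pi * s\<^sup>2)"
  note * = semicircle_density_integral[of "\<lambda>_. 1::real", OF continuous_on_const]
  have "((\<lambda>\<theta>. 2 / pi * (cos \<theta>)\<^sup>2) has_integral (pi / 2 + sin (pi / 2) * cos (pi / 2)) / pi - (- (pi / 2) + sin (- (pi / 2)) * cos (- (pi / 2))) / pi) {- (pi / 2)..pi / 2}"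
  proof (rule fundamental_theorem_of_calculus)
    fix \<theta> :: real
    have "1 + (cos \<theta> * cos \<theta> + sin \<theta> * - sin \<theta>) = 2 * (cos \<theta>)\<^sup>2"
      using sin_cos_squared_add[of \<theta>] by (simp add: power2_eq_square)
    then have e: "(1 + (cos \<theta> * cos \<theta> + sin \<theta> * - sin \<theta>)) / pi = 2 / pi * (cos \<theta>)\<^sup>2" by simp
    have "((\<lambda>\<theta>. (\<theta> + sin \<theta> * cos \<theta>) / pi) has_real_derivative
        (1 + (cos \<theta> * cos \<theta> + sin \<theta> * - sin \<theta>)) / pi) (at \<theta> within {- (pi / 2)..pi / 2})"
      by (auto intro!: derivative_eq_intros)
    note this[unfolded e]
    then show "((\<lambda>\<theta>. (\<theta> + sin \<theta> * cos \<theta>) / pi) has_vector_derivative 2 / pi * (cos \<theta>)\<^sup>2) (at \<theta> within {- (pi / 2)..pi / 2})"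
      by (simp add: has_real_derivative_iff_has_vector_derivative)
  qed simp
  then have "((\<lambda>\<theta>. (2 / pi * (cos \<theta>)\<^sup>2) *\<^sub>R (1::real)) has_integral 1) {- (pi / 2)..pi / 2}" by simp
  from has_integral_unique[OF *(2) this] have 1: "(\<integral>x. ?f x \<partial>lborel) = 1"
    by (simp only: real_scaleR_def mult_1_right)
  have "integrable lborel ?f" using *(1) by (simp only: real_scaleR_def mult_1_right)
  then have "(\<integral>\<^sup>+x. ennreal (?f x) \<partial>lborel) = ennreal (\<integral>x. ?f x \<partial>lborel)"
    by (rule nn_integral_eq_integral) simp
  then have "(\<integral>\<^sup>+x. ennreal (?f x) \<partial>lborel) = 1" unfolding 1 by simp
  then have "prob_space (semicircle 0 (s\<^sup>2))"
    unfolding semicircle_eq_density by (intro prob_spaceI) (simp add: emeasure_density)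
  then show ?thesis
    by (intro real_distribution.intro real_distribution_axioms.intro) (simp_all add: semicircle_eq_density)
qed

text \<open>Division with remainder: 4 s^2 cos^2 \<theta> = (4 s^2 - z^2) + (z + 2 s sin \<theta>)
  (z - 2 s sin \<theta>). Over z - 2 s sin \<theta>, the first summand gives the arcsine kernel and
  the second one z + 2 s sin \<theta>, with integral pi z.\<close>

lemma cauchy_transform_semicircle_pos:
  assumes z: "0 < Im z"
  shows "2 * complex_of_real pi * (complex_of_real s)\<^sup>2 * cauchy_transform (semicircle 0 (s\<^sup>2)) z =
    (4 * (complex_of_real s)\<^sup>2 - z\<^sup>2) * arcsine_kernel z + complex_of_real pi * z"
proof -
  let ?f = "\<lambda>x. sqrt (max 0 (4 * s\<^sup>2 - x\<^sup>2)) / (2 * pi * s\<^sup>2)"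
  let ?I = "{- (pi / 2)..pi / 2}"
  let ?d = "\<lambda>\<theta>. z - complex_of_real (2 * s * sin \<theta>)"
  have d: "?d \<theta> \<noteq> 0" for \<theta> using diff_of_real_nonzero[of z] z by auto
  have cont: "continuous_on UNIV (\<lambda>x. 1 / (z - complex_of_real x))"
    using diff_of_real_nonzero[of z] z by (intro continuous_intros) auto
  have "cauchy_transform (semicircle 0 (s\<^sup>2)) z = (\<integral>x. ?f x *\<^sub>R (1 / (z - complex_of_real x)) \<partial>lborel)"
    unfolding cauchy_transform_def semicircle_eq_density by (subst integral_density) auto
  with semicircle_density_integral(2)[OF cont]
  have "((\<lambda>\<theta>. (2 / pi * (cos \<theta>)\<^sup>2) *\<^sub>R (1 / ?d \<theta>)) has_integral cauchy_transform (semicircle 0 (s\<^sup>2)) z) ?I" by simp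
  then have "((\<lambda>\<theta>. 2 * complex_of_real pi * (complex_of_real s)\<^sup>2 * ((2 / pi * (cos \<theta>)\<^sup>2) *\<^sub>R (1 / ?d \<theta>))) has_integral
      2 * complex_of_real pi * (complex_of_real s)\<^sup>2 * cauchy_transform (semicircle 0 (s\<^sup>2)) z) ?I"
    by (rule has_integral_mult_right)
  moreover have "2 * complex_of_real pi * (complex_of_real s)\<^sup>2 * ((2 / pi * (cos \<theta>)\<^sup>2) *\<^sub>R (1 / ?d \<theta>)) =
      (4 * (complex_of_real s)\<^sup>2 - z\<^sup>2) * (1 / ?d \<theta>) + (z + complex_of_real (2 * s * sin \<theta>))" for \<theta>
  proof -
    let ?C = "complex_of_real (cos \<theta>)" and ?S = "complex_of_real (sin \<theta>)" and ?s = "complex_of_real s"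
    have "(cos \<theta>)\<^sup>2 = 1 - (sin \<theta>)\<^sup>2" using sin_cos_squared_add[of \<theta>] by linarith
    then have sc: "?C\<^sup>2 = 1 - ?S\<^sup>2" by (metis of_real_1 of_real_diff of_real_power)
    have "2 * complex_of_real pi * ?s\<^sup>2 * ((2 / pi * (cos \<theta>)\<^sup>2) *\<^sub>R (1 / ?d \<theta>)) = 4 * ?s\<^sup>2 * ?C\<^sup>2 * (1 / ?d \<theta>)"
      by (simp add: scaleR_conv_of_real)
    also have "4 * ?s\<^sup>2 * ?C\<^sup>2 = (4 * ?s\<^sup>2 - z\<^sup>2) + (z + complex_of_real (2 * s * sin \<theta>)) * ?d \<theta>"
      unfolding sc by (simp add: power2_eq_square algebra_simps)
    also have "\<dots> * (1 / ?d \<theta>) = (4 * ?s\<^sup>2 - z\<^sup>2) * (1 / ?d \<theta>) + (z + complex_of_real (2 * s * sin \<theta>))"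
    proof -
      have "(A + B * c) * (1 / c) = A * (1 / c) + B" if "c \<noteq> 0" for A B c :: complex
        using that by (simp add: field_simps)
      from this[OF d] show ?thesis .
    qed
    finally show ?thesis .
  qed
  ultimately have 1: "((\<lambda>\<theta>. (4 * (complex_of_real s)\<^sup>2 - z\<^sup>2) * (1 / ?d \<theta>) + (z + complex_of_real (2 * s * sin \<theta>))) has_integral
      2 * complex_of_real pi * (complex_of_real s)\<^sup>2 * cauchy_transform (semicircle 0 (s\<^sup>2)) z) ?I" by simp
  have "((\<lambda>\<theta>. complex_of_real (2 * s * sin \<theta>)) has_integral
      complex_of_real (- (2 * s * cos (pi / 2))) - complex_of_real (- (2 * s * cos (- (pi / 2))))) ?I"
    by (rule fundamental_theorem_of_calculus)
      (auto intro!: has_vector_derivative_of_real derivative_eq_intros simp flip: has_real_derivative_iff_has_vector_derivative)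
  then have 2: "((\<lambda>\<theta>. complex_of_real (2 * s * sin \<theta>)) has_integral 0) ?I" by simp
  have 3: "((\<lambda>\<theta>. z) has_integral complex_of_real pi * z) ?I"
    using has_integral_const_real[of z "- (pi / 2)" "pi / 2"] by (simp add: scaleR_conv_of_real)
  have "((\<lambda>\<theta>. 1 / ?d \<theta>) has_integral arcsine_kernel z) ?I"
    unfolding arcsine_kernel_def
    using continuous_on_arcsine_integrand[OF z] by (intro integrable_integral integrable_continuous_real)
  then have "((\<lambda>\<theta>. (4 * (complex_of_real s)\<^sup>2 - z\<^sup>2) * (1 / ?d \<theta>) + (z + complex_of_real (2 * s * sin \<theta>))) has_integral
      (4 * (complex_of_real s)\<^sup>2 - z\<^sup>2) * arcsine_kernel z + (complex_of_real pi * z + 0)) ?I"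
    by (intro has_integral_add has_integral_mult_right 2 3)
  from has_integral_unique[OF 1 this] show ?thesis by simp
qed

text \<open>The square of the arcsine kernel is known exactly, so completing the square shows s^2
  G^2 - z G + 1 = 0 with no decision on a branch. The claim is this equation divided by G.\<close>

lemma recip_cauchy_semicircle_pos:
  assumes z: "0 < Im z"
  shows "recip_cauchy (semicircle 0 (s\<^sup>2)) z = z - of_real (s\<^sup>2) * cauchy_transform (semicircle 0 (s\<^sup>2)) z"
proof -
  let ?G = "cauchy_transform (semicircle 0 (s\<^sup>2)) z"
  let ?s = "complex_of_real s" and ?p = "complex_of_real pi"
  let ?K = "arcsine_kernel z"
  interpret real_distribution "semicircle 0 (s\<^sup>2)" by (rule real_distribution_semicircle_pos)
  have ne: "?G \<noteq> 0" by (rule cauchy_transform_nonzero[OF z])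
  have G: "2 * ?p * ?s\<^sup>2 * ?G = (4 * ?s\<^sup>2 - z\<^sup>2) * ?K + ?p * z" by (rule cauchy_transform_semicircle_pos[OF z])
  have K: "?K\<^sup>2 * (z\<^sup>2 - 4 * ?s\<^sup>2) = ?p\<^sup>2" by (rule arcsine_kernel_square[OF z])
  have "(2 * ?p * ?s\<^sup>2 * ?G - ?p * z)\<^sup>2 = (4 * ?s\<^sup>2 - z\<^sup>2)\<^sup>2 * ?K\<^sup>2" unfolding G by (simp add: power_mult_distrib)
  also have "\<dots> = (z\<^sup>2 - 4 * ?s\<^sup>2) * (?K\<^sup>2 * (z\<^sup>2 - 4 * ?s\<^sup>2))"
    by (simp add: power2_eq_square algebra_simps)
  also have "\<dots> = (z\<^sup>2 - 4 * ?s\<^sup>2) * ?p\<^sup>2" unfolding K ..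
  finally have 1: "(2 * ?p * ?s\<^sup>2 * ?G - ?p * z)\<^sup>2 - (z\<^sup>2 - 4 * ?s\<^sup>2) * ?p\<^sup>2 = 0" by simp
  have "4 * ?p\<^sup>2 * ?s\<^sup>2 * (?s\<^sup>2 * ?G\<^sup>2 - z * ?G + 1) = (2 * ?p * ?s\<^sup>2 * ?G - ?p * z)\<^sup>2 - (z\<^sup>2 - 4 * ?s\<^sup>2) * ?p\<^sup>2"
    by (simp add: power2_eq_square algebra_simps)
  also note 1
  finally have "?s\<^sup>2 * ?G\<^sup>2 - z * ?G + 1 = 0" using s by simp
  then show ?thesis unfolding recip_cauchy_def using ne by (simp add: field_simps power2_eq_square)
qed

end

lemma semicircle_properties:
  shows "real_distribution (semicircle 0 (p\<^sup>2))"
    and "1 \<le> Im z \<Longrightarrow> recip_cauchy (semicircle 0 (p\<^sup>2)) z = z - of_real (p\<^sup>2) * cauchy_transform (semicircle 0 (p\<^sup>2)) z"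
proof -
  have *: "real_distribution (semicircle 0 (p\<^sup>2)) \<and>
    (1 \<le> Im z \<longrightarrow> recip_cauchy (semicircle 0 (p\<^sup>2)) z = z - of_real (p\<^sup>2) * cauchy_transform (semicircle 0 (p\<^sup>2)) z)"
  proof (cases "p = 0")
    case True
    then have e: "semicircle 0 (p\<^sup>2) = return borel 0" by (simp add: semicircle_def)
    have "real_distribution (return borel (0::real))"
      by (intro real_distribution.intro real_distribution_axioms.intro prob_space_return) auto
    moreover have "cauchy_transform (return borel 0) z = 1 / z"
      unfolding cauchy_transform_def by (subst integral_return) auto
    ultimately show ?thesis unfolding e recip_cauchy_def using True by simp
  next
    case False
    then show ?thesis
      using real_distribution_semicircle_pos[of "\<bar>p\<bar>"] recip_cauchy_semicircle_pos[of "\<bar>p\<bar>" z] by simp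
  qed
  then show "real_distribution (semicircle 0 (p\<^sup>2))"
    and "1 \<le> Im z \<Longrightarrow> recip_cauchy (semicircle 0 (p\<^sup>2)) z = z - of_real (p\<^sup>2) * cauchy_transform (semicircle 0 (p\<^sup>2)) z"
    by blast+
qed

section \<open>Centred normal laws as images of the standard one\<close>

text \<open>One formula for all \<open>q\<close>, negative ones included; for \<open>q = 0\<close>
  it is the image under the constant map 0. Everything later is computed with the standard normal
  law.\<close>

lemma normal_distr_eq_distr: "normal_distr 0 (q\<^sup>2) = distr std_normal_distribution borel (\<lambda>x. q * x)"
proof (cases "q = 0")
  case True
  interpret prob_space std_normal_distribution by (rule prob_space_normal_density) simp
  show ?thesis using True by (simp add: normal_distr_def distr_const)
next
  case False
  interpret prob_space std_normal_distribution by (rule prob_space_normal_density) simp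
  have "distributed std_normal_distribution lborel (\<lambda>x. x) (normal_density 0 1)"
    unfolding distributed_def by (auto simp: distr_id2)
  from normal_density_affine[OF this, of q 0] False
  have "distributed std_normal_distribution lborel (\<lambda>x. q * x) (normal_density 0 \<bar>q\<bar>)" by simp
  from distributed_distr_eq_density[OF this]
  have "distr std_normal_distribution lborel (\<lambda>x. q * x) = density lborel (\<lambda>x. ennreal (normal_density 0 \<bar>q\<bar> x))" .
  moreover have "distr std_normal_distribution lborel (\<lambda>x. q * x) = distr std_normal_distribution borel (\<lambda>x. q * x)"
    by (rule distr_cong) auto
  ultimately show ?thesis using False by (simp add: normal_distr_def)
qed

lemma real_distribution_normal_distr: "real_distribution (normal_distr 0 (q\<^sup>2))"
proof -
  interpret prob_space std_normal_distribution by (rule prob_space_normal_density) simp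
  show ?thesis unfolding normal_distr_eq_distr by (intro real_distribution_distr) auto
qed

lemma cauchy_transform_normal_distr:
  "cauchy_transform (normal_distr 0 (q\<^sup>2)) z = (\<integral>x. 1 / (z - complex_of_real (q * x)) \<partial>std_normal_distribution)"
  unfolding cauchy_transform_def normal_distr_eq_distr by (subst integral_distr) auto

lemma normal_distr_near_identity: "\<exists>C Y. near_identity (normal_distr 0 (q\<^sup>2)) C Y"
proof -
  have "integrable (normal_distr 0 (q\<^sup>2)) (\<lambda>t. t\<^sup>2)"
    unfolding normal_distr_eq_distr
    using integrable_std_normal_distribution_moment[of 2]
    by (subst integrable_distr_eq) (auto simp: power_mult_distrib)
  then show ?thesis
    by (rule real_distribution.near_identity_second_moment[OF real_distribution_normal_distr])
qed

lemma semicircle_normal_free_conv_eqI: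
  assumes "real_distribution R"
    and "\<And>z. 1 \<le> Im z \<Longrightarrow> cauchy_transform R z =
      cauchy_transform (normal_distr 0 (q\<^sup>2)) (z - of_real (p\<^sup>2) * cauchy_transform R z)"
  shows "semicircle 0 (p\<^sup>2) \<boxplus> normal_distr 0 (q\<^sup>2) = R"
proof -
  obtain C Y where "near_identity (normal_distr 0 (q\<^sup>2)) C Y" using normal_distr_near_identity by blast
  then show ?thesis
    by (intro free_conv_eqI[where v = "p\<^sup>2"] semicircle_properties real_distribution_normal_distr assms) auto
qed

section \<open>Cauchy transform of the empirical spectral distribution\<close>

lemma poly_char_poly:
  fixes A :: "'a :: field mat"
  assumes "A \<in> carrier_mat m m"
  shows "poly (char_poly A) z = Determinant.det (mat m m (\<lambda>(i, j). (if i = j then z else 0) - A $$ (i, j)))"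
proof -
  have "- (char_matrix A z) = mat m m (\<lambda>(i, j). (if i = j then z else 0) - A $$ (i, j))"
    using assms by (intro eq_matI) (auto simp: char_matrix_def)
  then show ?thesis by (simp add: char_poly_matrix[OF assms])
qed

text \<open>The logarithmic derivative. A list of roots, and not a set, keeps the
  multiplicities.\<close>

lemma poly_pderiv_div_prod_linear:
  fixes es :: "complex list"
  assumes "poly (\<Prod>e\<leftarrow>es. [:- e, 1:]) z \<noteq> 0"
  shows "poly (pderiv (\<Prod>e\<leftarrow>es. [:- e, 1:])) z / poly (\<Prod>e\<leftarrow>es. [:- e, 1:]) z = (\<Sum>e\<leftarrow>es. 1 / (z - e))"
  using assms
proof (induction es)
  case (Cons e es)
  let ?P = "\<Prod>e\<leftarrow>es. [:- e, 1:]"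
  have ne: "z - e \<noteq> 0" "poly ?P z \<noteq> 0" using Cons.prems by auto
  have "poly (pderiv ([:- e, 1:] * ?P)) z = poly ?P z + (z - e) * poly (pderiv ?P) z"
    by (subst pderiv_mult) (simp add: pderiv_pCons algebra_simps)
  moreover have "poly ([:- e, 1:] * ?P) z = (z - e) * poly ?P z" by (simp add: algebra_simps)
  ultimately have "poly (pderiv ([:- e, 1:] * ?P)) z / poly ([:- e, 1:] * ?P) z = 1 / (z - e) + poly (pderiv ?P) z / poly ?P z"
    using ne by (simp add: add_divide_distrib)
  then show ?case using Cons.IH[OF ne(2)] by simp
qed simp

lemma map_poly_of_real_mult:
  "map_poly complex_of_real (p * q) = map_poly complex_of_real p * map_poly complex_of_real q"
  by (rule poly_eqI) (simp add: coeff_map_poly coeff_mult)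

lemma map_poly_of_real_prod_linear:
  "map_poly complex_of_real (\<Prod>b\<leftarrow>bs. [:- b, 1:]) = (\<Prod>b\<leftarrow>bs. [:- complex_of_real b, 1:])"
  by (induction bs) (simp_all only: list.map prod_list.Cons prod_list.Nil map_poly_of_real_mult, simp_all add: map_poly_pCons map_poly_1)

lemma map_poly_of_real_inject:
  "map_poly complex_of_real p = map_poly complex_of_real q \<Longrightarrow> p = q"
  by (rule poly_eqI) (metis coeff_map_poly of_real_0 of_real_eq_iff)

lemma proots_prod_linear: "proots (\<Prod>b\<leftarrow>bs. [:- b, 1:]) = mset (bs :: real list)"
proof (induction bs)
  case (Cons b bs)
  have "(\<Prod>b\<leftarrow>bs. [:- b, 1:]) \<noteq> (0 :: real poly)" by (auto simp: prod_list_zero_iff)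
  then have "proots ([:- b, 1:] * (\<Prod>b\<leftarrow>bs. [:- b, 1:])) = proots [:- b, 1:] + mset bs"
    by (subst proots_mult) (auto simp: Cons.IH)
  then show ?case by (simp add: proots_linear_factor)
qed simp

lemma integral_pmf_of_multiset_mset:
  fixes f :: "real \<Rightarrow> complex"
  assumes "bs \<noteq> []"
  shows "(\<integral>x. f x \<partial>measure_pmf (pmf_of_multiset (mset bs))) = (\<Sum>b\<leftarrow>bs. f b) / of_nat (length bs)"
proof -
  have ne: "{..<length bs} \<noteq> {}" using assms by auto
  have "mset bs = image_mset ((!) bs) (mset_set {..<length bs})"
    by (metis map_nth mset_map mset_upt lessThan_atLeast0)
  then have "pmf_of_multiset (mset bs) = map_pmf ((!) bs) (pmf_of_set {..<length bs})"
    using ne by (simp add: map_pmf_of_set)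
  then have "(\<integral>x. f x \<partial>measure_pmf (pmf_of_multiset (mset bs))) = (\<Sum>i<length bs. f (bs ! i)) / of_nat (length bs)"
    using ne by (simp, subst integral_measure_pmf[where A = "{..<length bs}"])
      (auto simp: scaleR_conv_of_real sum_divide_distrib)
  also have "(\<Sum>i<length bs. f (bs ! i)) = (\<Sum>b\<leftarrow>bs. f b)"
    by (simp add: sum_list_sum_nth lessThan_atLeast0)
  finally show ?thesis .
qed

lemma real_distribution_esd: "real_distribution (esd A)"
  unfolding esd_def by (intro prob_space.real_distribution_distr prob_space_measure_pmf) simp

text \<open>Both sides equal \<chi>'(z) / (n \<chi>(z)), with \<chi> the characteristic polynomial:
  for the eigenvalues by the logarithmic derivative, and for the trace because \<chi>'(z) is the sum
  of the principal minors of z - A, which form the diagonal of the adjugate. No eigenvectors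
  enter.\<close>

lemma cauchy_transform_esd:
  assumes A: "A \<in> carrier_mat n n" and sym: "transpose_mat A = A" and n: "0 < n" and z: "0 < Im z"
  shows "cauchy_transform (esd A) z = norm_trace n (\<lambda>i j. A $$ (i, j)) z"
proof -
  let ?a = "\<lambda>i j. A $$ (i, j)"
  let ?C = "map_mat complex_of_real A"
  have C: "?C \<in> carrier_mat n n" using A by simp
  have a: "sym_array n ?a"
    unfolding sym_array_def
  proof (intro allI impI)
    fix i j assume "i < n" "j < n"
    then have "transpose_mat A $$ (i, j) = A $$ (j, i)" using A by simp
    then show "A $$ (i, j) = A $$ (j, i)" using sym by simp
  qed
  have chi: "poly (char_poly ?C) w = Determinant.det (shifted_mat n ?a w)" for w
    unfolding poly_char_poly[OF C] shifted_mat_def using A by (intro arg_cong[of _ _ Determinant.det] cong_mat) auto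
  obtain es where es: "char_poly ?C = (\<Prod>e\<leftarrow>es. [:- e, 1:])" "length es = n"
    using char_poly_factorized[OF C] by blast
  \<comment> \<open>A nonreal root would contradict the invertibility of the shifted matrix. So the
    complex factorisation is real and determines \<open>proots\<close> of the real
    polynomial.\<close>
  have real: "Im e = 0" if "e \<in> set es" for e
  proof (rule ccontr)
    assume "Im e \<noteq> 0"
    then have "poly (char_poly ?C) e \<noteq> 0" unfolding chi by (rule det_shifted_mat_nonzero[OF a])
    moreover have "poly (char_poly ?C) e = 0"
      unfolding es(1) using that by (induction es) auto
    ultimately show False by simp
  qed
  define bs where "bs = map Re es"
  have es_bs: "es = map complex_of_real bs"
    unfolding bs_def map_map using real by (intro map_idI[symmetric]) (auto simp: complex_eq_iff)
  have lbs: "length bs = n" "bs \<noteq> []" using es(2) n unfolding bs_def by auto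
  have "map_poly complex_of_real (char_poly A) = char_poly ?C"
    by (rule of_real_hom.char_poly_hom[OF A, symmetric])
  also have "\<dots> = (\<Prod>b\<leftarrow>bs. [:- complex_of_real b, 1:])" unfolding es(1) es_bs by (simp add: o_def)
  also have "\<dots> = map_poly complex_of_real (\<Prod>b\<leftarrow>bs. [:- b, 1:])" by (rule map_poly_of_real_prod_linear[symmetric])
  finally have "char_poly A = (\<Prod>b\<leftarrow>bs. [:- b, 1:])" by (rule map_poly_of_real_inject)
  then have pr: "proots (char_poly A) = mset bs" by (simp only: proots_prod_linear)
  have z': "Im z \<noteq> 0" using z by simp
  have chi_ne: "poly (char_poly ?C) z \<noteq> 0" unfolding chi by (rule det_shifted_mat_nonzero[OF a z'])
  have "(\<Sum>b\<leftarrow>bs. 1 / (z - complex_of_real b)) = (\<Sum>e\<leftarrow>es. 1 / (z - e))" unfolding es_bs by (simp add: o_def)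
  also have "\<dots> = poly (pderiv (char_poly ?C)) z / poly (char_poly ?C) z"
    using poly_pderiv_div_prod_linear[of es z] chi_ne unfolding es(1) by simp
  also have "poly (pderiv (char_poly ?C)) z = (\<Sum>i<n. poly (char_poly (mat_delete ?C i i)) z)"
    unfolding pderiv_char_poly[OF C] by (simp add: poly_sum)
  also have "\<dots> = (\<Sum>i<n. adj_mat (shifted_mat n ?a z) $$ (i, i))"
  proof (rule sum.cong[OF refl])
    fix i assume i: "i \<in> {..<n}"
    have "mat_delete ?C i i \<in> carrier_mat (n - 1) (n - 1)" using C by (simp add: mat_delete_def)
    note p = poly_char_poly[OF this, of z]
    have "mat (n - 1) (n - 1) (\<lambda>(k, j). (if k = j then z else 0) - mat_delete ?C i i $$ (k, j)) = mat_delete (shifted_mat n ?a z) i i"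
      using A i by (intro eq_matI) (auto simp: mat_delete_def shifted_mat_def)
    then have "poly (char_poly (mat_delete ?C i i)) z = Determinant.det (mat_delete (shifted_mat n ?a z) i i)"
      using p by simp
    also have "\<dots> = cofactor (shifted_mat n ?a z) i i" by (simp add: cofactor_def flip: mult_2)
    also have "\<dots> = adj_mat (shifted_mat n ?a z) $$ (i, i)" using i by (simp add: adj_mat_def shifted_mat_def)
    finally show "poly (char_poly (mat_delete ?C i i)) z = adj_mat (shifted_mat n ?a z) $$ (i, i)" .
  qed
  finally have tr: "(\<Sum>b\<leftarrow>bs. 1 / (z - complex_of_real b)) = (\<Sum>i<n. resolvent n ?a z i i)"
    unfolding chi by (simp add: resolvent_def sum_divide_distrib)
  have "cauchy_transform (esd A) z = (\<integral>t. 1 / (z - complex_of_real t) \<partial>measure_pmf (pmf_of_multiset (mset bs)))"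
    unfolding cauchy_transform_def esd_def pr by (subst integral_distr) auto
  also have "\<dots> = (\<Sum>b\<leftarrow>bs. 1 / (z - complex_of_real b)) / of_nat n"
    using integral_pmf_of_multiset_mset[OF lbs(2)] lbs(1) by simp
  finally show ?thesis unfolding tr norm_trace_def .
qed

section \<open>The Efron-Stein inequality and variances of linear and quadratic forms\<close>

lemma (in prob_space) integrable_of_square:
  fixes h :: "'a \<Rightarrow> real"
  assumes [measurable]: "h \<in> borel_measurable M" and fin: "(\<integral>\<^sup>+x. ennreal ((h x)\<^sup>2) \<partial>M) < \<infinity>"
  shows "integrable M (\<lambda>x. (h x)\<^sup>2)" "integrable M h"
proof -
  show 1: "integrable M (\<lambda>x. (h x)\<^sup>2)" using fin by (intro integrableI_nonneg) auto
  then show "integrable M h" by (rule square_integrable_imp_integrable[rotated]) simp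
qed

text \<open>Bias-variance decomposition, in \<open>ennreal\<close> for use with Tonelli. In
  particular the mean is the best centre.\<close>

lemma (in prob_space) nn_integral_square_diff:
  fixes h :: "'a \<Rightarrow> real"
  assumes [measurable]: "h \<in> borel_measurable M" and fin: "(\<integral>\<^sup>+x. ennreal ((h x)\<^sup>2) \<partial>M) < \<infinity>"
  shows "(\<integral>\<^sup>+x. ennreal ((h x - c)\<^sup>2) \<partial>M) = (\<integral>\<^sup>+x. ennreal ((h x - expectation h)\<^sup>2) \<partial>M) + ennreal ((expectation h - c)\<^sup>2)"
proof -
  note int = integrable_of_square[OF assms]
  have *: "integrable M (\<lambda>x. (h x - d)\<^sup>2) \<and> (\<integral>x. (h x - d)\<^sup>2 \<partial>M) = (\<integral>x. (h x)\<^sup>2 \<partial>M) - 2 * d * expectation h + d\<^sup>2" for d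
  proof
    have e: "(h x - d)\<^sup>2 = (h x)\<^sup>2 - 2 * d * h x + d\<^sup>2" for x by (simp add: power2_diff)
    show "integrable M (\<lambda>x. (h x - d)\<^sup>2)" unfolding e using int by simp
    show "(\<integral>x. (h x - d)\<^sup>2 \<partial>M) = (\<integral>x. (h x)\<^sup>2 \<partial>M) - 2 * d * expectation h + d\<^sup>2"
      unfolding e using int by (simp add: prob_space)
  qed
  have nn: "(\<integral>\<^sup>+x. ennreal ((h x - d)\<^sup>2) \<partial>M) = ennreal ((\<integral>x. (h x)\<^sup>2 \<partial>M) - 2 * d * expectation h + d\<^sup>2)" for d
    using * by (subst nn_integral_eq_integral) auto
  have "0 \<le> (\<integral>x. (h x - expectation h)\<^sup>2 \<partial>M)" by simp
  then have "0 \<le> (\<integral>x. (h x)\<^sup>2 \<partial>M) - 2 * expectation h * expectation h + (expectation h)\<^sup>2" using * by simp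
  from ennreal_plus[OF this zero_le_power2[of "expectation h - c"]]
  show ?thesis unfolding nn by (simp add: power2_eq_square algebra_simps)
qed

text \<open>Jensen's inequality. Square integrability is assumed of \<open>h\<close> alone: in the
  application \<open>h'\<close> is a section of a function at the value 0 of some coordinate,
  possibly a null set, where nothing is known. When the right-hand side is finite, \<open>h'\<close>
  is integrable as a difference.\<close>

lemma (in prob_space) square_expectation_diff_le:
  fixes h h' :: "'a \<Rightarrow> real"
  assumes [measurable]: "h \<in> borel_measurable M" "h' \<in> borel_measurable M"
    and fin: "(\<integral>\<^sup>+x. ennreal ((h x)\<^sup>2) \<partial>M) < \<infinity>"
  shows "ennreal ((expectation h - expectation h')\<^sup>2) \<le> (\<integral>\<^sup>+x. ennreal ((h x - h' x)\<^sup>2) \<partial>M)"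
proof (cases "(\<integral>\<^sup>+x. ennreal ((h x - h' x)\<^sup>2) \<partial>M) < \<infinity>")
  case True
  let ?u = "\<lambda>x. h x - h' x"
  have u: "integrable M ?u" by (rule integrable_of_square(2)[OF _ True]) simp
  have "integrable M (\<lambda>x. h x - ?u x)" using integrable_of_square(2)[OF assms(1) fin] u by (rule Bochner_Integration.integrable_diff)
  then have h': "integrable M h'" by simp
  have "expectation h - expectation h' = expectation ?u"
    using integrable_of_square(2)[OF assms(1) fin] h' by simp
  moreover have "(\<integral>\<^sup>+x. ennreal ((?u x - 0)\<^sup>2) \<partial>M) = (\<integral>\<^sup>+x. ennreal ((?u x - expectation ?u)\<^sup>2) \<partial>M) + ennreal ((expectation ?u - 0)\<^sup>2)"
    by (rule nn_integral_square_diff[OF _ True]) simp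
  ultimately show ?thesis by simp
next
  case False
  then show ?thesis by (simp add: not_less top_unique)
qed

text \<open>A bounded-difference form of the Efron--Stein inequality, in which the resampled coordinate is
  replaced by the constant 0. The induction is the law of total variance.\<close>

lemma efron_stein_real:
  fixes M :: "'i \<Rightarrow> real measure" and f :: "('i \<Rightarrow> real) \<Rightarrow> real"
  assumes "finite I" and M: "\<And>i. prob_space (M i)" "\<And>i. sets (M i) = sets borel"
    and "f \<in> borel_measurable (Pi\<^sub>M I M)" "(\<integral>\<^sup>+x. ennreal ((f x)\<^sup>2) \<partial>Pi\<^sub>M I M) < \<infinity>"
  shows "(\<integral>\<^sup>+x. ennreal ((f x - (\<integral>x. f x \<partial>Pi\<^sub>M I M))\<^sup>2) \<partial>Pi\<^sub>M I M) \<le>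
    (\<Sum>i\<in>I. \<integral>\<^sup>+x. ennreal ((f x - f (x(i := 0)))\<^sup>2) \<partial>Pi\<^sub>M I M)"
  using assms(1,4,5)
proof (induction I arbitrary: f)
  case empty
  interpret product_prob_space M by (rule product_prob_spaceI) (rule M)
  have "(\<integral>x. f x \<partial>Pi\<^sub>M {} M) = f (\<lambda>_. undefined)"
    by (simp add: PiM_empty lebesgue_integral_count_space_finite)
  then show ?case by (simp add: PiM_empty nn_integral_count_space_finite)
next
  case (insert i I)
  interpret product_prob_space M by (rule product_prob_spaceI) (rule M)
  note [measurable] = insert.prems(1)
  note fin = insert.prems(2)
  have [measurable_cong]: "sets (M j) = sets borel" for j by (rule M)
  interpret J: prob_space "Pi\<^sub>M (insert i I) M" by (rule prob_space_PiM) (rule M)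
  have sf: "sigma_finite_measure (M i)" by (intro prob_space_imp_sigma_finite M)
  have upd [measurable]: "(\<lambda>(x, y). x(i := y)) \<in> measurable (Pi\<^sub>M I M \<Otimes>\<^sub>M M i) (Pi\<^sub>M (insert i I) M)"
    by (rule measurable_add_dim)
  have fm [measurable]: "(\<lambda>(x, y). f (x(i := y))) \<in> borel_measurable (Pi\<^sub>M I M \<Otimes>\<^sub>M M i)"
    using measurable_compose[OF upd insert.prems(1)] by (simp add: split_beta)
  have fx [measurable]: "(\<lambda>y. f (x(i := y))) \<in> borel_measurable (M i)" if "x \<in> space (Pi\<^sub>M I M)" for x
    using measurable_compose[OF measurable_Pair1'[OF that] fm] by simp
  have zero: "(\<lambda>x. x(k := 0)) \<in> measurable (Pi\<^sub>M J M) (Pi\<^sub>M J M)" if "k \<in> J" for k J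
    by (rule measurable_fun_upd[where J = J]) (use that in \<open>auto simp: sets_eq_imp_space_eq[OF M(2)]\<close>)
  \<comment> \<open>The conditional mean of \<open>f\<close> given the coordinates in
    \<open>I\<close>. The variance of \<open>f\<close> is the mean of its variance in coordinate
    \<open>i\<close> plus the variance of \<open>g\<close>.\<close>
  define g where "g = (\<lambda>x. \<integral>y. f (x(i := y)) \<partial>M i)"
  have g [measurable]: "g \<in> borel_measurable (Pi\<^sub>M I M)"
    unfolding g_def by (rule sigma_finite_measure.borel_measurable_lebesgue_integral[OF sf]) (rule fm)
  have ins: "(\<integral>\<^sup>+x. u x \<partial>Pi\<^sub>M (insert i I) M) = (\<integral>\<^sup>+x. (\<integral>\<^sup>+y. u (x(i := y)) \<partial>M i) \<partial>Pi\<^sub>M I M)"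
    if "u \<in> borel_measurable (Pi\<^sub>M (insert i I) M)" for u :: "_ \<Rightarrow> ennreal"
    by (rule product_nn_integral_insert[OF insert.hyps that])
  have m2 [measurable]: "(\<lambda>x. \<integral>\<^sup>+y. ennreal ((f (x(i := y)))\<^sup>2) \<partial>M i) \<in> borel_measurable (Pi\<^sub>M I M)"
    using fm by (intro sigma_finite_measure.borel_measurable_nn_integral[OF sf]) (simp add: split_beta)
  have "(\<integral>\<^sup>+x. (\<integral>\<^sup>+y. ennreal ((f (x(i := y)))\<^sup>2) \<partial>M i) \<partial>Pi\<^sub>M I M) < \<infinity>"
    using fin by (subst (asm) ins) auto
  then have ae: "AE x in Pi\<^sub>M I M. (\<integral>\<^sup>+y. ennreal ((f (x(i := y)))\<^sup>2) \<partial>M i) < \<infinity>"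
    using nn_integral_PInf_AE[OF m2] by (auto simp: less_top)
  have "(\<integral>\<^sup>+x. ennreal ((g x)\<^sup>2) \<partial>Pi\<^sub>M I M) \<le> (\<integral>\<^sup>+x. (\<integral>\<^sup>+y. ennreal ((f (x(i := y)))\<^sup>2) \<partial>M i) \<partial>Pi\<^sub>M I M)"
  proof (rule nn_integral_mono_AE, use ae AE_space in eventually_elim)
    case (elim x)
    show ?case
      using prob_space.square_expectation_diff_le[OF M(1)[of i], OF fx[OF elim(2)] _ elim(1), of "\<lambda>_. 0"]
      by (simp add: g_def)
  qed
  then have g2: "(\<integral>\<^sup>+x. ennreal ((g x)\<^sup>2) \<partial>Pi\<^sub>M I M) < \<infinity>"
    using fin by (subst (asm) ins[symmetric]) (auto simp: less_top top_unique)
  let ?u = "\<lambda>k w. ennreal ((f w - f (w(k := 0)))\<^sup>2)"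
  have um: "?u k \<in> borel_measurable (Pi\<^sub>M (insert i I) M)" if "k \<in> insert i I" for k
    using measurable_compose[OF zero[OF that] insert.prems(1)] by measurable
  have um2: "(\<lambda>x. \<integral>\<^sup>+y. ?u k (x(i := y)) \<partial>M i) \<in> borel_measurable (Pi\<^sub>M I M)" if "k \<in> insert i I" for k
    using measurable_compose[OF upd um[OF that]] by (intro sigma_finite_measure.borel_measurable_nn_integral[OF sf]) (simp only: split_beta')
  define c where "c = (\<integral>x. f x \<partial>Pi\<^sub>M (insert i I) M)"
  have c: "c = (\<integral>x. g x \<partial>Pi\<^sub>M I M)"
    unfolding c_def g_def
    by (rule product_integral_insert[OF insert.hyps J.integrable_of_square(2)[OF insert.prems]])
  have s0: "(\<integral>\<^sup>+x. ennreal ((f x - c)\<^sup>2) \<partial>Pi\<^sub>M (insert i I) M) = (\<integral>\<^sup>+x. (\<integral>\<^sup>+y. ennreal ((f (x(i := y)) - c)\<^sup>2) \<partial>M i) \<partial>Pi\<^sub>M I M)"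
    by (rule ins) simp
  also have "\<dots> \<le> (\<integral>\<^sup>+x. (\<integral>\<^sup>+y. ?u i (x(i := y)) \<partial>M i) + ennreal ((g x - c)\<^sup>2) \<partial>Pi\<^sub>M I M)"
  proof (rule nn_integral_mono_AE, use ae AE_space in eventually_elim)
    case (elim x)
    \<comment> \<open>Used with two centres: at the value for coordinate \<open>i\<close> equal to
      0, which only increases the variance, and at \<open>c\<close>, which splits off the deviation
      of \<open>g\<close>.\<close>
    note eq = prob_space.nn_integral_square_diff[OF M(1)[of i], OF fx[OF elim(2)] elim(1)]
    have "(\<integral>\<^sup>+y. ennreal ((f (x(i := y)) - g x)\<^sup>2) \<partial>M i) \<le> (\<integral>\<^sup>+y. ennreal ((f (x(i := y)) - f (x(i := 0)))\<^sup>2) \<partial>M i)"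
      unfolding eq[of "f (x(i := 0))"] g_def by simp
    then show ?case unfolding eq[of c] g_def by (simp add: add_right_mono)
  qed
  also have "\<dots> = (\<integral>\<^sup>+x. ?u i x \<partial>Pi\<^sub>M (insert i I) M) + (\<integral>\<^sup>+x. ennreal ((g x - c)\<^sup>2) \<partial>Pi\<^sub>M I M)"
    by (subst nn_integral_add) (use um2[of i] ins[OF um[of i]] in auto)
  finally have s1: "(\<integral>\<^sup>+x. ennreal ((f x - c)\<^sup>2) \<partial>Pi\<^sub>M (insert i I) M) \<le>
      (\<integral>\<^sup>+x. ?u i x \<partial>Pi\<^sub>M (insert i I) M) + (\<integral>\<^sup>+x. ennreal ((g x - c)\<^sup>2) \<partial>Pi\<^sub>M I M)" .
  have "(\<integral>\<^sup>+x. ennreal ((g x - c)\<^sup>2) \<partial>Pi\<^sub>M I M) \<le> (\<Sum>k\<in>I. \<integral>\<^sup>+x. ennreal ((g x - g (x(k := 0)))\<^sup>2) \<partial>Pi\<^sub>M I M)"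
    unfolding c by (rule insert.IH[OF g g2])
  also have "\<dots> \<le> (\<Sum>k\<in>I. \<integral>\<^sup>+x. ?u k x \<partial>Pi\<^sub>M (insert i I) M)"
  proof (rule sum_mono)
    \<comment> \<open>Zeroing coordinate \<open>k\<close> commutes with averaging over coordinate
      \<open>i\<close>, and Jensen's inequality moves the square inside the average.\<close>
    fix k assume k: "k \<in> I"
    then have ki: "k \<noteq> i" using insert.hyps by auto
    have "(\<integral>\<^sup>+x. ennreal ((g x - g (x(k := 0)))\<^sup>2) \<partial>Pi\<^sub>M I M) \<le> (\<integral>\<^sup>+x. (\<integral>\<^sup>+y. ?u k (x(i := y)) \<partial>M i) \<partial>Pi\<^sub>M I M)"
    proof (rule nn_integral_mono_AE, use ae AE_space in eventually_elim)
      case (elim x)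
      have x': "x(k := 0) \<in> space (Pi\<^sub>M I M)" using measurable_space[OF zero[OF k] elim(2)] .
      show ?case
        using prob_space.square_expectation_diff_le[OF M(1)[of i], OF fx[OF elim(2)] fx[OF x'] elim(1)]
        unfolding g_def fun_upd_twist[OF ki] .
    qed
    also have "\<dots> = (\<integral>\<^sup>+x. ?u k x \<partial>Pi\<^sub>M (insert i I) M)"
      using k by (intro ins[symmetric] um) auto
    finally show "(\<integral>\<^sup>+x. ennreal ((g x - g (x(k := 0)))\<^sup>2) \<partial>Pi\<^sub>M I M) \<le> (\<integral>\<^sup>+x. ?u k x \<partial>Pi\<^sub>M (insert i I) M)" .
  qed
  finally show ?case
    unfolding c_def[symmetric] sum.insert[OF insert.hyps] by (intro order.trans[OF s1] add_left_mono)
qed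

text \<open>The variances of the real and imaginary parts add up, so the real case is applied to
  each of them.\<close>

lemma efron_stein:
  fixes M :: "'i \<Rightarrow> real measure" and f :: "('i \<Rightarrow> real) \<Rightarrow> complex"
  assumes I: "finite I" and M: "\<And>i. prob_space (M i)" "\<And>i. sets (M i) = sets borel"
    and f [measurable]: "f \<in> borel_measurable (Pi\<^sub>M I M)" and fin: "(\<integral>\<^sup>+x. ennreal ((cmod (f x))\<^sup>2) \<partial>Pi\<^sub>M I M) < \<infinity>"
  shows "(\<integral>\<^sup>+x. ennreal ((cmod (f x - (\<integral>x. f x \<partial>Pi\<^sub>M I M)))\<^sup>2) \<partial>Pi\<^sub>M I M) \<le>
    (\<Sum>i\<in>I. \<integral>\<^sup>+x. ennreal ((cmod (f x - f (x(i := 0))))\<^sup>2) \<partial>Pi\<^sub>M I M)"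
proof -
  let ?P = "Pi\<^sub>M I M"
  interpret P: prob_space ?P by (rule prob_space_PiM) (rule M)
  have [measurable_cong]: "sets (M j) = sets borel" for j by (rule M)
  have sq: "ennreal ((cmod w)\<^sup>2) = ennreal ((Re w)\<^sup>2) + ennreal ((Im w)\<^sup>2)" for w
    by (subst cmod_power2) (simp add: ennreal_plus)
  have "(\<integral>\<^sup>+x. ennreal ((Re (f x))\<^sup>2) \<partial>?P) \<le> (\<integral>\<^sup>+x. ennreal ((cmod (f x))\<^sup>2) \<partial>?P)"
    by (rule nn_integral_mono) (simp add: sq)
  with fin have re: "(\<integral>\<^sup>+x. ennreal ((Re (f x))\<^sup>2) \<partial>?P) < \<infinity>" by (auto simp: less_top top_unique)
  have "(\<integral>\<^sup>+x. ennreal ((Im (f x))\<^sup>2) \<partial>?P) \<le> (\<integral>\<^sup>+x. ennreal ((cmod (f x))\<^sup>2) \<partial>?P)"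
    by (rule nn_integral_mono) (simp add: sq)
  with fin have im: "(\<integral>\<^sup>+x. ennreal ((Im (f x))\<^sup>2) \<partial>?P) < \<infinity>" by (auto simp: less_top top_unique)
  have "integrable ?P (\<lambda>x. Re (f x))" "integrable ?P (\<lambda>x. Im (f x))"
    using P.integrable_of_square(2)[OF _ re] P.integrable_of_square(2)[OF _ im] by auto
  then have "integrable ?P (\<lambda>x. \<bar>Re (f x)\<bar> + \<bar>Im (f x)\<bar>)" by simp
  then have int: "integrable ?P f"
    by (rule Bochner_Integration.integrable_bound) (auto simp: cmod_le)
  have zero [measurable]: "(\<lambda>x. f (x(k := 0))) \<in> borel_measurable ?P" if "k \<in> I" for k
  proof (rule measurable_compose[OF _ f])
    show "(\<lambda>x. x(k := 0)) \<in> measurable ?P ?P" by (rule measurable_fun_upd[where J = I]) (use that in \<open>auto simp: sets_eq_imp_space_eq[OF M(2)]\<close>)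
  qed
  have "(\<integral>\<^sup>+x. ennreal ((cmod (f x - (\<integral>x. f x \<partial>?P)))\<^sup>2) \<partial>?P) =
      (\<integral>\<^sup>+x. ennreal ((Re (f x) - (\<integral>x. Re (f x) \<partial>?P))\<^sup>2) \<partial>?P) + (\<integral>\<^sup>+x. ennreal ((Im (f x) - (\<integral>x. Im (f x) \<partial>?P))\<^sup>2) \<partial>?P)"
    unfolding sq using int by (subst nn_integral_add) auto
  also have "\<dots> \<le> (\<Sum>i\<in>I. \<integral>\<^sup>+x. ennreal ((Re (f x) - Re (f (x(i := 0))))\<^sup>2) \<partial>?P)
      + (\<Sum>i\<in>I. \<integral>\<^sup>+x. ennreal ((Im (f x) - Im (f (x(i := 0))))\<^sup>2) \<partial>?P)"
    by (intro add_mono efron_stein_real[OF I M] re im) auto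
  also have "\<dots> = (\<Sum>i\<in>I. \<integral>\<^sup>+x. ennreal ((cmod (f x - f (x(i := 0))))\<^sup>2) \<partial>?P)"
    unfolding sum.distrib[symmetric] sq
    by (intro sum.cong refl, subst nn_integral_add) auto
  finally show ?thesis .
qed

context
  fixes M :: "'i \<Rightarrow> real measure" and J :: "'i set"
  assumes J: "finite J" and M: "\<And>i. prob_space (M i)" "\<And>i. sets (M i) = sets borel"
begin

lemma nn_integral_PiM_component:
  assumes "e \<in> J" "\<phi> \<in> borel_measurable borel"
  shows "(\<integral>\<^sup>+x. \<phi> (x e) \<partial>Pi\<^sub>M J M) = (\<integral>\<^sup>+t. \<phi> t \<partial>M e)"
proof -
  interpret product_prob_space M J by (rule product_prob_spaceI) (rule M)
  have [measurable_cong]: "sets (M j) = sets borel" for j by (rule M)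
  note [measurable] = assms(2)
  have "(\<integral>\<^sup>+t. \<phi> t \<partial>M e) = (\<integral>\<^sup>+t. \<phi> t \<partial>distr (Pi\<^sub>M J M) (M e) (\<lambda>x. x e))"
    using assms(1) by (subst PiM_component) auto
  also have "\<dots> = (\<integral>\<^sup>+x. \<phi> (x e) \<partial>Pi\<^sub>M J M)"
    using assms(1) by (subst nn_integral_distr) auto
  finally show ?thesis ..
qed

lemma integral_PiM_component:
  fixes \<phi> :: "real \<Rightarrow> 'b::{banach, second_countable_topology}"
  assumes "e \<in> J" "\<phi> \<in> borel_measurable borel"
  shows "(\<integral>x. \<phi> (x e) \<partial>Pi\<^sub>M J M) = (\<integral>t. \<phi> t \<partial>M e)"
proof -
  interpret product_prob_space M J by (rule product_prob_spaceI) (rule M)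
  have [measurable_cong]: "sets (M j) = sets borel" for j by (rule M)
  note [measurable] = assms(2)
  have "(\<integral>t. \<phi> t \<partial>M e) = (\<integral>t. \<phi> t \<partial>distr (Pi\<^sub>M J M) (M e) (\<lambda>x. x e))"
    using assms(1) by (subst PiM_component) auto
  also have "\<dots> = (\<integral>x. \<phi> (x e) \<partial>Pi\<^sub>M J M)"
    using assms(1) by (subst integral_distr) auto
  finally show ?thesis ..
qed

end

context
  fixes M :: "'i \<Rightarrow> real measure" and J :: "'i set"
  assumes J: "finite J" and M: "\<And>i. prob_space (M i)" "\<And>i. sets (M i) = sets borel"
    and mean: "\<And>e. e \<in> J \<Longrightarrow> (\<integral>t. t \<partial>M e) = 0"
    and var: "\<And>e. e \<in> J \<Longrightarrow> (\<integral>\<^sup>+t. ennreal (t\<^sup>2) \<partial>M e) = 1"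
begin

lemma square_integrable_component:
  assumes "e \<in> J"
  shows "integrable (Pi\<^sub>M J M) (\<lambda>x. (x e)\<^sup>2)" "integrable (Pi\<^sub>M J M) (\<lambda>x. x e)" "(\<integral>x. (x e)\<^sup>2 \<partial>Pi\<^sub>M J M) = 1"
proof -
  interpret P: prob_space "Pi\<^sub>M J M" by (rule prob_space_PiM) (rule M)
  have [measurable_cong]: "sets (M j) = sets borel" for j by (rule M)
  have m: "(\<lambda>x. x e) \<in> borel_measurable (Pi\<^sub>M J M)" using assms by measurable
  have 1: "(\<integral>\<^sup>+x. ennreal ((x e)\<^sup>2) \<partial>Pi\<^sub>M J M) = 1"
    using nn_integral_PiM_component[OF J M assms, of "\<lambda>t. ennreal (t\<^sup>2)"] var[OF assms] by simp
  then show "integrable (Pi\<^sub>M J M) (\<lambda>x. (x e)\<^sup>2)" "integrable (Pi\<^sub>M J M) (\<lambda>x. x e)"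
    using P.integrable_of_square[OF m] by simp_all
  then show "(\<integral>x. (x e)\<^sup>2 \<partial>Pi\<^sub>M J M) = 1"
    using 1 m by (subst integral_eq_nn_integral) auto
qed

text \<open>The form is centred, so its second moment is its variance, and zeroing coordinate
  \<open>i\<close> changes it by \<open>c i\<close> times that coordinate alone. Efron-Stein then
  gives the sum of the squared coefficients.\<close>

lemma linear_form_variance:
  fixes c :: "'i \<Rightarrow> complex"
  shows "(\<integral>\<^sup>+x. ennreal ((cmod (\<Sum>e\<in>J. c e * of_real (x e)))\<^sup>2) \<partial>Pi\<^sub>M J M) \<le> ennreal (\<Sum>e\<in>J. (cmod (c e))\<^sup>2)"
proof -
  let ?P = "Pi\<^sub>M J M"
  let ?L = "\<lambda>x. \<Sum>e\<in>J. c e * complex_of_real (x e)"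
  interpret P: prob_space ?P by (rule prob_space_PiM) (rule M)
  have [measurable_cong]: "sets (M j) = sets borel" for j by (rule M)
  have L [measurable]: "?L \<in> borel_measurable ?P" by measurable
  have "integrable ?P (\<lambda>x. \<Sum>e\<in>J. \<bar>cmod (c e)\<bar>\<^sup>2 * (x e)\<^sup>2)"
    using square_integrable_component by (intro Bochner_Integration.integrable_sum integrable_mult_right) auto
  then have "integrable ?P (\<lambda>x. real (card J) * (\<Sum>e\<in>J. \<bar>cmod (c e)\<bar>\<^sup>2 * (x e)\<^sup>2))" by (rule integrable_mult_right)
  then have "integrable ?P (\<lambda>x. (cmod (?L x))\<^sup>2)"
  proof (rule Bochner_Integration.integrable_bound)
    show "AE x in ?P. norm ((cmod (?L x))\<^sup>2) \<le> norm (real (card J) * (\<Sum>e\<in>J. \<bar>cmod (c e)\<bar>\<^sup>2 * (x e)\<^sup>2))"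
    proof (rule AE_I2)
      fix x
      have "cmod (?L x) \<le> (\<Sum>e\<in>J. 1 * (cmod (c e) * \<bar>x e\<bar>))"
        by (rule order.trans[OF norm_sum]) (simp add: norm_mult)
      then have "(cmod (?L x))\<^sup>2 \<le> (\<Sum>e\<in>J. 1 * (cmod (c e) * \<bar>x e\<bar>))\<^sup>2" by (rule power_mono) simp
      also have "\<dots> \<le> (\<Sum>e\<in>J. 1\<^sup>2) * (\<Sum>e\<in>J. (cmod (c e) * \<bar>x e\<bar>)\<^sup>2)" by (rule Cauchy_Schwarz_ineq_sum)
      finally have "(cmod (?L x))\<^sup>2 \<le> real (card J) * (\<Sum>e\<in>J. \<bar>cmod (c e)\<bar>\<^sup>2 * (x e)\<^sup>2)" by (simp add: power_mult_distrib)
      then show "norm ((cmod (?L x))\<^sup>2) \<le> norm (real (card J) * (\<Sum>e\<in>J. \<bar>cmod (c e)\<bar>\<^sup>2 * (x e)\<^sup>2))"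
        by (simp add: abs_of_nonneg sum_nonneg)
    qed
  qed measurable
  then have fin: "(\<integral>\<^sup>+x. ennreal ((cmod (?L x))\<^sup>2) \<partial>?P) < \<infinity>"
    by (subst nn_integral_eq_integral) auto
  have z: "(\<integral>x. x e \<partial>?P) = 0" if "e \<in> J" for e
    using integral_PiM_component[OF J M that, of "\<lambda>t. t"] mean[OF that] by simp
  have "(\<integral>x. ?L x \<partial>?P) = (\<Sum>e\<in>J. c e * complex_of_real (\<integral>x. x e \<partial>?P))"
    using square_integrable_component by (subst Bochner_Integration.integral_sum) auto
  also have "\<dots> = 0" using z by simp
  finally have mean0: "(\<integral>x. ?L x \<partial>?P) = 0" .
  have diff: "?L x - ?L (x(i := 0)) = c i * complex_of_real (x i)" if "i \<in> J" for x i
  proof -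
    have "?L x - ?L (x(i := 0)) = (\<Sum>e\<in>J. if e = i then c e * complex_of_real (x e) else 0)"
      unfolding sum_subtractf[symmetric] by (intro sum.cong) auto
    then show ?thesis using that J by simp
  qed
  have "(\<integral>\<^sup>+x. ennreal ((cmod (?L x))\<^sup>2) \<partial>?P) = (\<integral>\<^sup>+x. ennreal ((cmod (?L x - (\<integral>x. ?L x \<partial>?P)))\<^sup>2) \<partial>?P)"
    unfolding mean0 by simp
  also have "\<dots> \<le> (\<Sum>i\<in>J. \<integral>\<^sup>+x. ennreal ((cmod (?L x - ?L (x(i := 0))))\<^sup>2) \<partial>?P)"
    by (rule efron_stein[OF J M L fin])
  also have "\<dots> = (\<Sum>i\<in>J. ennreal ((cmod (c i))\<^sup>2))"
  proof (rule sum.cong[OF refl])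
    fix i assume i: "i \<in> J"
    have "(\<integral>\<^sup>+x. ennreal ((cmod (?L x - ?L (x(i := 0))))\<^sup>2) \<partial>?P) = (\<integral>\<^sup>+x. ennreal ((cmod (c i))\<^sup>2) * ennreal ((x i)\<^sup>2) \<partial>?P)"
      unfolding diff[OF i] by (simp add: norm_mult power_mult_distrib ennreal_mult)
    also have "\<dots> = ennreal ((cmod (c i))\<^sup>2) * (\<integral>\<^sup>+x. ennreal ((x i)\<^sup>2) \<partial>?P)"
      using i by (intro nn_integral_cmult) measurable
    also have "(\<integral>\<^sup>+x. ennreal ((x i)\<^sup>2) \<partial>?P) = 1"
      using nn_integral_PiM_component[OF J M i, of "\<lambda>t. ennreal (t\<^sup>2)"] var[OF i] by simp
    finally show "(\<integral>\<^sup>+x. ennreal ((cmod (?L x - ?L (x(i := 0))))\<^sup>2) \<partial>?P) = ennreal ((cmod (c i))\<^sup>2)" by simp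
  qed
  finally show ?thesis by simp
qed

end

lemma norm_add_square_le: "(cmod (a + b))\<^sup>2 \<le> 2 * (cmod a)\<^sup>2 + 2 * (cmod b)\<^sup>2"
proof -
  have "(cmod (a + b))\<^sup>2 \<le> (cmod a + cmod b)\<^sup>2" by (rule power_mono[OF norm_triangle_ineq]) simp
  also have "\<dots> \<le> 2 * (cmod a)\<^sup>2 + 2 * (cmod b)\<^sup>2"
    using zero_le_power2[of "cmod a - cmod b"] by (simp add: power2_eq_square algebra_simps)
  finally show ?thesis .
qed

text \<open>Zeroing x_k changes the form by B(k, k) x_k^2 + x_k L_k, where L_k is linear in the
  other coordinates. The first part costs a fourth moment; in the second x_k is independent of L_k,
  and \<open>linear_form_variance\<close> applies. Splitting squares with a factor 2 gives 2 C for
  the diagonal, and 4 for each of the coefficients B(k, l) and B(l, k), whence 8.\<close>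

lemma quadratic_form_variance:
  fixes M :: "'i \<Rightarrow> real measure" and B :: "'i \<Rightarrow> 'i \<Rightarrow> complex"
  assumes J: "finite J" and M: "\<And>i. prob_space (M i)" "\<And>i. sets (M i) = sets borel"
    and mean: "\<And>e. e \<in> J \<Longrightarrow> (\<integral>t. t \<partial>M e) = 0"
    and var: "\<And>e. e \<in> J \<Longrightarrow> (\<integral>\<^sup>+t. ennreal (t\<^sup>2) \<partial>M e) = 1"
    and m4: "\<And>e. e \<in> J \<Longrightarrow> (\<integral>\<^sup>+t. ennreal (t ^ 4) \<partial>M e) \<le> ennreal C" and C: "0 \<le> C"
  shows "(\<integral>\<^sup>+x. ennreal ((cmod ((\<Sum>e\<in>J. \<Sum>f\<in>J. of_real (x e) * B e f * of_real (x f)) - (\<Sum>e\<in>J. B e e)))\<^sup>2) \<partial>Pi\<^sub>M J M)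
    \<le> ennreal ((2 * C + 8) * (\<Sum>e\<in>J. \<Sum>f\<in>J. (cmod (B e f))\<^sup>2))"
proof -
  let ?P = "Pi\<^sub>M J M"
  let ?T = "\<lambda>x. \<Sum>e\<in>J. \<Sum>f\<in>J. complex_of_real (x e) * B e f * complex_of_real (x f)"
  interpret product_prob_space M by (rule product_prob_spaceI) (rule M)
  interpret PJ: prob_space ?P by (rule prob_space_PiM) (rule M)
  have [measurable_cong]: "sets (M j) = sets borel" for j by (rule M)
  have comp: "integrable ?P (\<lambda>x. (x e)\<^sup>2)" "integrable ?P (\<lambda>x. x e)" "(\<integral>x. (x e)\<^sup>2 \<partial>?P) = 1"
    if "e \<in> J" for e
    by (rule square_integrable_component[where J = J]; fact)+
  have T [measurable]: "?T \<in> borel_measurable ?P" by measurable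
  have m4': "(\<integral>\<^sup>+x. ennreal ((x e) ^ 4) \<partial>?P) \<le> ennreal C" if "e \<in> J" for e
    using nn_integral_PiM_component[OF J M that, of "\<lambda>t. ennreal (t ^ 4)"] m4[OF that] by simp
  have prod_int: "integrable ?P (\<lambda>x. x e * x f)" if "e \<in> J" "f \<in> J" for e f
  proof (rule Bochner_Integration.integrable_bound)
    show "integrable ?P (\<lambda>x. (x e)\<^sup>2 + (x f)\<^sup>2)" using comp that by simp
    show "AE x in ?P. norm (x e * x f) \<le> norm ((x e)\<^sup>2 + (x f)\<^sup>2)"
    proof (rule AE_I2)
      fix x :: "'i \<Rightarrow> real"
      have "2 * \<bar>x e * x f\<bar> \<le> (x e)\<^sup>2 + (x f)\<^sup>2"
        using sum_squares_bound[of "\<bar>x e\<bar>" "\<bar>x f\<bar>"] by (simp add: abs_mult)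
      then show "norm (x e * x f) \<le> norm ((x e)\<^sup>2 + (x f)\<^sup>2)" by simp
    qed
  qed (use that in measurable)
  have prod_mean: "(\<integral>x. x e * x f \<partial>?P) = (if e = f then 1 else 0)" if e: "e \<in> J" and f: "f \<in> J" for e f
  proof (cases "e = f")
    case True
    then show ?thesis using comp(3)[OF e] by (simp add: power2_eq_square)
  next
    case False
    have ins: "insert e (J - {e}) = J" using e by auto
    have "(\<integral>x. x e * x f \<partial>?P) = (\<integral>x. (\<integral>y. (x(e := y)) e * (x(e := y)) f \<partial>M e) \<partial>Pi\<^sub>M (J - {e}) M)"
      using product_integral_insert[of "J - {e}" e "\<lambda>x. x e * x f"] prod_int[OF e f] J unfolding ins by simp
    also have "\<dots> = 0" using False mean[OF e] by simp
    finally show ?thesis using False by simp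
  qed
  have "(\<integral>x. ?T x \<partial>?P) = (\<Sum>e\<in>J. \<Sum>f\<in>J. (\<integral>x. B e f * complex_of_real (x e * x f) \<partial>?P))"
  proof -
    have ci: "integrable ?P (\<lambda>x. B e f * complex_of_real (x e * x f))" if "e \<in> J" "f \<in> J" for e f
      using prod_int[OF that] by (intro integrable_mult_right integrable_of_real)
    have "(\<integral>x. ?T x \<partial>?P) = (\<integral>x. (\<Sum>e\<in>J. \<Sum>f\<in>J. B e f * complex_of_real (x e * x f)) \<partial>?P)"
      by (simp add: mult_ac)
    also have "\<dots> = (\<Sum>e\<in>J. \<integral>x. (\<Sum>f\<in>J. B e f * complex_of_real (x e * x f)) \<partial>?P)"
      by (intro Bochner_Integration.integral_sum Bochner_Integration.integrable_sum ci)
    also have "\<dots> = (\<Sum>e\<in>J. \<Sum>f\<in>J. (\<integral>x. B e f * complex_of_real (x e * x f) \<partial>?P))"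
      by (intro sum.cong refl Bochner_Integration.integral_sum ci)
    finally show ?thesis .
  qed
  also have "\<dots> = (\<Sum>e\<in>J. \<Sum>f\<in>J. if f = e then B e e else 0)"
  proof (intro sum.cong refl)
    fix e f assume "e \<in> J" "f \<in> J"
    then show "(\<integral>x. B e f * complex_of_real (x e * x f) \<partial>?P) = (if f = e then B e e else 0)"
      using prod_mean[of e f] by (simp del: of_real_mult)
  qed
  also have "\<dots> = (\<Sum>e\<in>J. B e e)" using J by simp
  finally have T_mean: "(\<integral>x. ?T x \<partial>?P) = (\<Sum>e\<in>J. B e e)" .

  \<comment> \<open>A crude bound, with a constant that depends on \<open>B\<close> and the size of
    \<open>J\<close>; it only serves the finiteness that Efron-Stein asks for.\<close>
  define b where "b = (\<Sum>e\<in>J. \<Sum>f\<in>J. cmod (B e f))"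
  have b0: "0 \<le> b" unfolding b_def by (intro sum_nonneg) auto
  have T_le: "(cmod (?T x))\<^sup>2 \<le> b\<^sup>2 * (real (card J) * (\<Sum>g\<in>J. (x g) ^ 4))" for x
  proof -
    let ?q = "\<Sum>g\<in>J. (x g)\<^sup>2"
    have q0: "0 \<le> ?q" by (intro sum_nonneg) auto
    have q: "\<bar>x e\<bar> * \<bar>x f\<bar> \<le> ?q" if "e \<in> J" "f \<in> J" for e f
    proof -
      have "(x e)\<^sup>2 \<le> ?q" "(x f)\<^sup>2 \<le> ?q" using that J by (auto intro!: member_le_sum)
      then show ?thesis using sum_squares_bound[of "\<bar>x e\<bar>" "\<bar>x f\<bar>"] by simp
    qed
    have "cmod (?T x) \<le> (\<Sum>e\<in>J. \<Sum>f\<in>J. cmod (B e f) * ?q)"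
    proof (intro order.trans[OF norm_sum] sum_mono)
      fix e f assume "e \<in> J" "f \<in> J"
      from mult_left_mono[OF q[OF this], of "cmod (B e f)"]
      show "cmod (complex_of_real (x e) * B e f * complex_of_real (x f)) \<le> cmod (B e f) * ?q"
        by (simp add: norm_mult mult_ac)
    qed
    also have "\<dots> = b * ?q" unfolding b_def by (simp add: sum_distrib_right)
    finally have "(cmod (?T x))\<^sup>2 \<le> (b * ?q)\<^sup>2" by (rule power_mono) simp
    also have "\<dots> = b\<^sup>2 * (\<Sum>g\<in>J. 1 * (x g)\<^sup>2)\<^sup>2" by (simp add: power_mult_distrib)
    also have "\<dots> \<le> b\<^sup>2 * ((\<Sum>g\<in>J. 1\<^sup>2) * (\<Sum>g\<in>J. ((x g)\<^sup>2)\<^sup>2))"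
      by (intro mult_left_mono Cauchy_Schwarz_ineq_sum) simp
    finally show ?thesis by (simp add: power_mult[symmetric])
  qed
  have "integrable ?P (\<lambda>x. (x e) ^ 4)" if "e \<in> J" for e
    using m4'[OF that] that by (intro integrableI_nonneg) (auto simp: le_less_trans)
  then have "integrable ?P (\<lambda>x. b\<^sup>2 * (real (card J) * (\<Sum>g\<in>J. (x g) ^ 4)))"
    by (intro integrable_mult_right Bochner_Integration.integrable_sum)
  then have "integrable ?P (\<lambda>x. (cmod (?T x))\<^sup>2)"
  proof (rule Bochner_Integration.integrable_bound)
    show "AE x in ?P. norm ((cmod (?T x))\<^sup>2) \<le> norm (b\<^sup>2 * (real (card J) * (\<Sum>g\<in>J. (x g) ^ 4)))"
      using T_le order.trans[OF T_le abs_ge_self] by (intro AE_I2) simp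
  qed measurable
  then have fin: "(\<integral>\<^sup>+x. ennreal ((cmod (?T x))\<^sup>2) \<partial>?P) < \<infinity>"
    by (subst nn_integral_eq_integral) auto

  let ?L = "\<lambda>k x. \<Sum>l\<in>J - {k}. (B k l + B l k) * complex_of_real (x l)"
  have diff: "?T x - ?T (x(k := 0)) = B k k * complex_of_real ((x k)\<^sup>2) + complex_of_real (x k) * ?L k x" if k: "k \<in> J" for x k
  proof -
    let ?X = "\<lambda>e. complex_of_real (x e)"
    have rem: "(\<Sum>e\<in>J. g e) = g k + (\<Sum>e\<in>J - {k}. g e)" for g :: "_ \<Rightarrow> complex" by (rule sum.remove[OF J k])
    have "?T x = (?X k * B k k * ?X k + (\<Sum>f\<in>J - {k}. ?X k * B k f * ?X f)) +
        ((\<Sum>e\<in>J - {k}. ?X e * B e k * ?X k) + (\<Sum>e\<in>J - {k}. \<Sum>f\<in>J - {k}. ?X e * B e f * ?X f))"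
      unfolding rem sum.distrib by (simp only: add_ac)
    moreover have "?T (x(k := 0)) = (\<Sum>e\<in>J - {k}. \<Sum>f\<in>J - {k}. ?X e * B e f * ?X f)"
      unfolding rem sum.distrib by simp
    ultimately show ?thesis
      by (simp add: sum_distrib_left sum.distrib algebra_simps power2_eq_square)
  qed
  have each: "(\<integral>\<^sup>+x. ennreal ((cmod (?T x - ?T (x(k := 0))))\<^sup>2) \<partial>?P) \<le>
      ennreal (2 * C * (cmod (B k k))\<^sup>2 + 4 * (\<Sum>l\<in>J. (cmod (B k l))\<^sup>2 + (cmod (B l k))\<^sup>2))" if k: "k \<in> J" for k
  proof -
    have ins: "insert k (J - {k}) = J" using k by auto
    have fJ: "finite (J - {k})" using J by simp
    have Lm: "?L k \<in> borel_measurable ?P" by measurable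
    have "(\<integral>\<^sup>+x. ennreal ((cmod (?T x - ?T (x(k := 0))))\<^sup>2) \<partial>?P) \<le>
      (\<integral>\<^sup>+x. ennreal (2 * (cmod (B k k))\<^sup>2) * ennreal ((x k) ^ 4) + 2 * (ennreal ((x k)\<^sup>2) * ennreal ((cmod (?L k x))\<^sup>2)) \<partial>?P)"
    proof (rule nn_integral_mono)
      fix x :: "'i \<Rightarrow> real"
      have "(cmod (?T x - ?T (x(k := 0))))\<^sup>2 \<le> 2 * (cmod (B k k * complex_of_real ((x k)\<^sup>2)))\<^sup>2 + 2 * (cmod (complex_of_real (x k) * ?L k x))\<^sup>2"
        unfolding diff[OF k] by (rule norm_add_square_le)
      also have "\<dots> = (2 * (cmod (B k k))\<^sup>2) * (x k) ^ 4 + 2 * ((x k)\<^sup>2 * (cmod (?L k x))\<^sup>2)"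
        by (simp add: norm_mult power_mult_distrib norm_power power_mult[symmetric])
      finally have "ennreal ((cmod (?T x - ?T (x(k := 0))))\<^sup>2) \<le> ennreal ((2 * (cmod (B k k))\<^sup>2) * (x k) ^ 4 + 2 * ((x k)\<^sup>2 * (cmod (?L k x))\<^sup>2))"
        by (rule ennreal_leI)
      then show "ennreal ((cmod (?T x - ?T (x(k := 0))))\<^sup>2) \<le> ennreal (2 * (cmod (B k k))\<^sup>2) * ennreal ((x k) ^ 4) + 2 * (ennreal ((x k)\<^sup>2) * ennreal ((cmod (?L k x))\<^sup>2))"
        by (simp add: ennreal_plus ennreal_mult)
    qed
    also have "\<dots> = ennreal (2 * (cmod (B k k))\<^sup>2) * (\<integral>\<^sup>+x. ennreal ((x k) ^ 4) \<partial>?P) + 2 * (\<integral>\<^sup>+x. ennreal ((x k)\<^sup>2) * ennreal ((cmod (?L k x))\<^sup>2) \<partial>?P)"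
      using k Lm by (subst nn_integral_add, measurable, subst nn_integral_cmult, measurable, subst nn_integral_cmult, measurable)
    \<comment> \<open>Integrating coordinate \<open>k\<close> first separates the factors, since
      \<open>?L k\<close> does not read that coordinate; the inner integral of its square is
      1.\<close>
    also have "(\<integral>\<^sup>+x. ennreal ((x k)\<^sup>2) * ennreal ((cmod (?L k x))\<^sup>2) \<partial>?P) =
        (\<integral>\<^sup>+x. (\<integral>\<^sup>+y. ennreal (((x(k := y)) k)\<^sup>2) * ennreal ((cmod (?L k (x(k := y))))\<^sup>2) \<partial>M k) \<partial>Pi\<^sub>M (J - {k}) M)"
      using product_nn_integral_insert[of "J - {k}" k "\<lambda>x. ennreal ((x k)\<^sup>2) * ennreal ((cmod (?L k x))\<^sup>2)"] fJ k Lm unfolding ins by simp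
    also have "\<dots> = (\<integral>\<^sup>+x. ennreal ((cmod (?L k x))\<^sup>2) \<partial>Pi\<^sub>M (J - {k}) M)"
    proof (rule nn_integral_cong)
      fix x :: "'i \<Rightarrow> real"
      have "?L k (x(k := y)) = ?L k x" for y by (intro sum.cong) auto
      then show "(\<integral>\<^sup>+y. ennreal (((x(k := y)) k)\<^sup>2) * ennreal ((cmod (?L k (x(k := y))))\<^sup>2) \<partial>M k) = ennreal ((cmod (?L k x))\<^sup>2)"
        using var[OF k] by (simp add: nn_integral_multc)
    qed
    also have "\<dots> \<le> ennreal (\<Sum>l\<in>J - {k}. (cmod (B k l + B l k))\<^sup>2)"
      using mean var by (intro linear_form_variance fJ M) auto
    also have "(\<Sum>l\<in>J - {k}. (cmod (B k l + B l k))\<^sup>2) \<le> (\<Sum>l\<in>J. 2 * ((cmod (B k l))\<^sup>2 + (cmod (B l k))\<^sup>2))"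
      using J norm_add_square_le by (intro order.trans[OF sum_mono2[of J "J - {k}"] sum_mono]) (auto simp: distrib_left)
    also have "\<dots> = 2 * (\<Sum>l\<in>J. (cmod (B k l))\<^sup>2 + (cmod (B l k))\<^sup>2)" by (simp add: sum_distrib_left)
    finally have "(\<integral>\<^sup>+x. ennreal ((cmod (?T x - ?T (x(k := 0))))\<^sup>2) \<partial>?P) \<le>
        ennreal (2 * (cmod (B k k))\<^sup>2) * (\<integral>\<^sup>+x. ennreal ((x k) ^ 4) \<partial>?P) + 2 * ennreal (2 * (\<Sum>l\<in>J. (cmod (B k l))\<^sup>2 + (cmod (B l k))\<^sup>2))"
      by (simp add: add_left_mono mult_left_mono ennreal_leI)
    also have "\<dots> \<le> ennreal (2 * (cmod (B k k))\<^sup>2) * ennreal C + 2 * ennreal (2 * (\<Sum>l\<in>J. (cmod (B k l))\<^sup>2 + (cmod (B l k))\<^sup>2))"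
      using m4'[OF k] by (intro add_right_mono mult_left_mono) auto
    also have "\<dots> = ennreal (2 * C * (cmod (B k k))\<^sup>2 + 4 * (\<Sum>l\<in>J. (cmod (B k l))\<^sup>2 + (cmod (B l k))\<^sup>2))"
    proof -
      let ?S = "\<Sum>l\<in>J. (cmod (B k l))\<^sup>2 + (cmod (B l k))\<^sup>2"
      have S: "0 \<le> ?S" by (intro sum_nonneg) auto
      have "ennreal (2 * (cmod (B k k))\<^sup>2) * ennreal C = ennreal (2 * C * (cmod (B k k))\<^sup>2)"
        using C by (simp add: ennreal_mult[symmetric] mult_ac)
      moreover have "2 * ennreal (2 * ?S) = ennreal (4 * ?S)"
        using ennreal_mult'[of 2 "2 * ?S"] by simp
      ultimately show ?thesis using S C by (simp add: ennreal_plus)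
    qed
    finally show ?thesis .
  qed
  have "(\<integral>\<^sup>+x. ennreal ((cmod (?T x - (\<Sum>e\<in>J. B e e)))\<^sup>2) \<partial>?P) \<le> (\<Sum>k\<in>J. \<integral>\<^sup>+x. ennreal ((cmod (?T x - ?T (x(k := 0))))\<^sup>2) \<partial>?P)"
    unfolding T_mean[symmetric] by (rule efron_stein[OF J M T fin])
  also have "\<dots> \<le> (\<Sum>k\<in>J. ennreal (2 * C * (cmod (B k k))\<^sup>2 + 4 * (\<Sum>l\<in>J. (cmod (B k l))\<^sup>2 + (cmod (B l k))\<^sup>2)))"
    by (rule sum_mono) (rule each)
  also have "\<dots> = ennreal (\<Sum>k\<in>J. 2 * C * (cmod (B k k))\<^sup>2 + 4 * (\<Sum>l\<in>J. (cmod (B k l))\<^sup>2 + (cmod (B l k))\<^sup>2))"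
    using C by (intro sum_ennreal) (auto intro!: add_nonneg_nonneg sum_nonneg mult_nonneg_nonneg)
  also have "\<dots> \<le> ennreal ((2 * C + 8) * (\<Sum>e\<in>J. \<Sum>f\<in>J. (cmod (B e f))\<^sup>2))"
  proof (rule ennreal_leI)
    let ?S = "\<Sum>e\<in>J. \<Sum>f\<in>J. (cmod (B e f))\<^sup>2"
    have "(\<Sum>k\<in>J. (cmod (B k k))\<^sup>2) \<le> ?S"
      using J by (intro sum_mono member_le_sum) auto
    then have "2 * C * (\<Sum>k\<in>J. (cmod (B k k))\<^sup>2) \<le> 2 * C * ?S" using C by (intro mult_left_mono) auto
    moreover have "(\<Sum>k\<in>J. \<Sum>l\<in>J. (cmod (B l k))\<^sup>2) = ?S" by (rule sum.swap)
    ultimately show "(\<Sum>k\<in>J. 2 * C * (cmod (B k k))\<^sup>2 + 4 * (\<Sum>l\<in>J. (cmod (B k l))\<^sup>2 + (cmod (B l k))\<^sup>2)) \<le> (2 * C + 8) * ?S"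
      by (simp add: sum.distrib sum_distrib_left[symmetric] distrib_right)
  qed
  finally show ?thesis .
qed

section \<open>Characteristic functions of linear forms\<close>

lemma integral_power_exp:
  "integrable lborel (\<lambda>u::real. indicator {0..} u * (u ^ k * exp (- u)))"
  "(\<integral>u. indicator {0..} u * (u ^ k * exp (- u)) \<partial>lborel) = (fact k :: real)"
proof -
  let ?w = "\<lambda>u::real. indicator {0..} u * (u ^ k * exp (- u))"
  have nn: "0 \<le> ?w u" for u by (auto simp: indicator_def)
  have "(\<integral>\<^sup>+u. ennreal (?w u) \<partial>lborel) = (\<integral>\<^sup>+u. ennreal (u ^ k * exp (- u)) * indicator {0..} u \<partial>lborel)"
    by (intro nn_integral_cong) (auto simp: indicator_def)
  also have "\<dots> = ennreal (fact k)" using nn_intergal_power_times_exp_Ici[of k] by simp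
  finally have e: "(\<integral>\<^sup>+u. ennreal (?w u) \<partial>lborel) = ennreal (fact k)" .
  then show i: "integrable lborel ?w" using nn by (intro integrableI_nonneg) auto
  show "(\<integral>u. ?w u \<partial>lborel) = fact k"
    by (rule integral_eq_nn_integral[THEN trans]) (use nn e in auto)
qed

lemma norm_exp_half_line_le:
  assumes "1 \<le> Im w" "0 \<le> u"
  shows "cmod (exp (\<i> * complex_of_real u * w)) \<le> exp (- u)"
proof -
  have "u * 1 \<le> u * Im w" using assms by (intro mult_left_mono) auto
  then show ?thesis by simp
qed

lemma set_integrable_exp_half_line:
  assumes "1 \<le> Im w"
  shows "integrable lborel (\<lambda>u. indicator {0..} u *\<^sub>R exp (\<i> * complex_of_real u * w))"
proof (rule Bochner_Integration.integrable_bound[OF integral_power_exp(1)[of 0]])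
  show "AE u in lborel. norm (indicator {0..} u *\<^sub>R exp (\<i> * complex_of_real u * w)) \<le> norm (indicator {0..} u * (u ^ 0 * exp (- u)))"
    using norm_exp_half_line_le[OF assms] by (intro AE_I2) (auto simp: indicator_def)
qed measurable

text \<open>The character exp (i u w) decays at least like exp (- u) when Im w \<ge> 1, and it has
  the primitive exp (i u w) / (i w). This writes the Cauchy kernel as a superposition of
  characters.\<close>

lemma inverse_eq_half_line_integral:
  assumes w: "1 \<le> Im w"
  shows "1 / w = - \<i> * (\<integral>u. indicator {0..} u *\<^sub>R exp (\<i> * complex_of_real u * w) \<partial>lborel)"
proof -
  have w0: "w \<noteq> 0" using w by auto
  let ?f = "\<lambda>u. exp (\<i> * complex_of_real u * w)"
  let ?F = "\<lambda>u. exp (\<i> * complex_of_real u * w) / (\<i> * w)"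
  have ind: "indicator (einterval (ereal 0) \<infinity>) u *\<^sub>R ?f u = indicator {0<..} u *\<^sub>R ?f u" for u
    by (auto simp: einterval_def indicator_def)
  have ae: "AE u in lborel. indicator {0<..} u *\<^sub>R ?f u = indicator {0..} u *\<^sub>R ?f u"
    using AE_lborel_singleton[of 0] by eventually_elim (auto simp: indicator_def)
  have "(LBINT u=ereal 0..\<infinity>. ?f u) = 0 - 1 / (\<i> * w)"
  proof (rule interval_integral_FTC_integrable)
    fix u :: real
    have "((\<lambda>s. exp (\<i> * s * w) / (\<i> * w)) has_field_derivative exp (\<i> * complex_of_real u * w)) (at (complex_of_real u))"
      using w0 by (auto intro!: derivative_eq_intros)
    from has_vector_derivative_real_field[OF this]
    show "(?F has_vector_derivative ?f u) (at u)" .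
    show "isCont ?f u" by (intro continuous_intros)
  next
    show "set_integrable lborel (einterval (ereal 0) \<infinity>) ?f"
      unfolding set_integrable_def ind
      by (rule integrable_cong_AE_imp[OF set_integrable_exp_half_line[OF w]]) (use ae in \<open>auto elim: eventually_mono\<close>)
    have "(?F \<longlongrightarrow> ?F 0) (at_right 0)" using w0
      by (intro tendsto_intros) auto
    then show "((?F \<circ> real_of_ereal) \<longlongrightarrow> 1 / (\<i> * w)) (at_right (ereal 0))"
      by (simp add: ereal_tendsto_simps)
    have "(?F \<longlongrightarrow> 0) at_top"
    proof (rule Lim_null_comparison)
      show "\<forall>\<^sub>F u in at_top. cmod (?F u) \<le> exp (- u) / cmod w"
        using eventually_ge_at_top[of 0]
        by eventually_elim (use norm_exp_half_line_le[OF w] in \<open>simp add: norm_divide norm_mult divide_right_mono\<close>)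
      show "((\<lambda>u. exp (- u) / cmod w) \<longlongrightarrow> 0) at_top" using w0 by real_asymp
    qed
    then show "((?F \<circ> real_of_ereal) \<longlongrightarrow> 0) (at_left \<infinity>)"
      by (simp add: ereal_tendsto_simps)
  qed simp
  also have "(LBINT u=ereal 0..\<infinity>. ?f u) = (\<integral>u. indicator {0..} u *\<^sub>R ?f u \<partial>lborel)"
    unfolding interval_lebesgue_integral_def set_lebesgue_integral_def ind
    using ae by (simp, intro integral_cong_AE) auto
  finally show ?thesis using w0 by (simp add: field_simps)
qed

text \<open>The shift by q x is real, so the modulus of the integrand does not depend on x and
  Fubini's condition is immediate. The inner integral is then the characteristic function at - q
  u.\<close>

lemma (in real_distribution) cauchy_kernel_integral_char:
  assumes \<zeta>: "1 \<le> Im \<zeta>"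
  shows "integrable lborel (\<lambda>u. indicator {0..} u *\<^sub>R (exp (\<i> * complex_of_real u * \<zeta>) * char M (- (q * u))))"
    and "(\<integral>x. 1 / (\<zeta> - complex_of_real (q * x)) \<partial>M) =
    - \<i> * (\<integral>u. indicator {0..} u *\<^sub>R (exp (\<i> * complex_of_real u * \<zeta>) * char M (- (q * u))) \<partial>lborel)"
proof -
  let ?f = "\<lambda>x u. indicator {0..} u *\<^sub>R exp (\<i> * complex_of_real u * (\<zeta> - complex_of_real (q * x)))"
  interpret P: pair_sigma_finite M lborel
    by (intro pair_sigma_finite.intro sigma_finite_measure_axioms sigma_finite_lborel)
  have Im: "1 \<le> Im (\<zeta> - complex_of_real (q * x))" for x using \<zeta> by simp
  have norm_f: "cmod (?f x u) = indicator {0..} u *\<^sub>R exp (- (u * Im \<zeta>))" for x u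
    by (auto simp: indicator_def)
  have int: "integrable (M \<Otimes>\<^sub>M lborel) (\<lambda>(x, u). ?f x u)"
  proof (rule P.Fubini_integrable)
    show "(\<lambda>(x, u). ?f x u) \<in> borel_measurable (M \<Otimes>\<^sub>M lborel)"
      unfolding split_beta' by measurable
    show "integrable M (\<lambda>x. \<integral>u. norm (case (x, u) of (x, u) \<Rightarrow> ?f x u) \<partial>lborel)"
      unfolding case_prod_conv norm_f by simp
    show "AE x in M. integrable lborel (\<lambda>u. case (x, u) of (x, u) \<Rightarrow> ?f x u)"
      unfolding case_prod_conv by (intro AE_I2 set_integrable_exp_half_line Im)
  qed
  have char: "(\<integral>x. ?f x u \<partial>M) = indicator {0..} u *\<^sub>R (exp (\<i> * complex_of_real u * \<zeta>) * char M (- (q * u)))" for u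
  proof -
    have "?f x u = (indicator {0..} u *\<^sub>R exp (\<i> * complex_of_real u * \<zeta>)) * iexp (- (q * u) * x)" for x
      by (simp add: mult_exp_exp algebra_simps)
    then have "(\<integral>x. ?f x u \<partial>M) = (indicator {0..} u *\<^sub>R exp (\<i> * complex_of_real u * \<zeta>)) * (\<integral>x. iexp (- (q * u) * x) \<partial>M)"
      by (simp only: integral_mult_right_zero)
    then show ?thesis unfolding char_def by simp
  qed
  from P.integrable_snd[OF int]
  show "integrable lborel (\<lambda>u. indicator {0..} u *\<^sub>R (exp (\<i> * complex_of_real u * \<zeta>) * char M (- (q * u))))"
    unfolding char .
  have "(\<integral>x. 1 / (\<zeta> - complex_of_real (q * x)) \<partial>M) = (\<integral>x. - \<i> * (\<integral>u. ?f x u \<partial>lborel) \<partial>M)"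
    by (intro Bochner_Integration.integral_cong refl inverse_eq_half_line_integral Im)
  also have "\<dots> = - \<i> * (\<integral>x. (\<integral>u. ?f x u \<partial>lborel) \<partial>M)" by (rule integral_mult_right_zero)
  also have "(\<integral>x. (\<integral>u. ?f x u \<partial>lborel) \<partial>M) = (\<integral>u. (\<integral>x. ?f x u \<partial>M) \<partial>lborel)"
    by (rule P.Fubini_integral[OF int, symmetric])
  finally show "(\<integral>x. 1 / (\<zeta> - complex_of_real (q * x)) \<partial>M) =
    - \<i> * (\<integral>u. indicator {0..} u *\<^sub>R (exp (\<i> * complex_of_real u * \<zeta>) * char M (- (q * u))) \<partial>lborel)"
    unfolding char .
qed

text \<open>The hypothesis has the shape of the error in the normal approximation of a row sum, used
  at t = - q u. Integrated against exp (- u), the powers 2, 3 and 4 of u give the factorials 2, 6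
  and 24.\<close>

lemma cauchy_kernel_diff_le_char:
  assumes rM: "real_distribution M" and rN: "real_distribution N" and \<zeta>: "1 \<le> Im \<zeta>"
    and c: "0 \<le> c" and diff: "\<And>t. cmod (char M t - char N t) \<le> c * (t\<^sup>2 + \<bar>t\<bar> ^ 3 + t ^ 4)"
  shows "cmod ((\<integral>x. 1 / (\<zeta> - complex_of_real (q * x)) \<partial>M) - (\<integral>x. 1 / (\<zeta> - complex_of_real (q * x)) \<partial>N))
    \<le> c * (2 * q\<^sup>2 + 6 * \<bar>q\<bar> ^ 3 + 24 * q ^ 4)"
proof -
  let ?w = "\<lambda>k u::real. indicator {0..} u * (u ^ k * exp (- u))"
  let ?g = "\<lambda>M u. indicator {0..} u *\<^sub>R (exp (\<i> * complex_of_real u * \<zeta>) * char M (- (q * u)))"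
  note M = real_distribution.cauchy_kernel_integral_char[OF rM \<zeta>, where q = q]
  note N = real_distribution.cauchy_kernel_integral_char[OF rN \<zeta>, where q = q]
  have "(\<integral>x. 1 / (\<zeta> - complex_of_real (q * x)) \<partial>M) - (\<integral>x. 1 / (\<zeta> - complex_of_real (q * x)) \<partial>N) =
      - \<i> * (\<integral>u. ?g M u - ?g N u \<partial>lborel)"
    unfolding M(2) N(2) using M(1) N(1) by (simp add: right_diff_distrib)
  then have "cmod ((\<integral>x. 1 / (\<zeta> - complex_of_real (q * x)) \<partial>M) - (\<integral>x. 1 / (\<zeta> - complex_of_real (q * x)) \<partial>N))
      = cmod (\<integral>u. ?g M u - ?g N u \<partial>lborel)" by (simp add: norm_mult)
  also have "\<dots> \<le> (\<integral>u. cmod (?g M u - ?g N u) \<partial>lborel)" by simp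
  also have "\<dots> \<le> (\<integral>u. c * (q\<^sup>2 * ?w 2 u + \<bar>q\<bar> ^ 3 * ?w 3 u + q ^ 4 * ?w 4 u) \<partial>lborel)"
  proof (rule integral_mono)
    show "integrable lborel (\<lambda>u. cmod (?g M u - ?g N u))" using M(1) N(1) by (intro integrable_norm Bochner_Integration.integrable_diff)
    show "integrable lborel (\<lambda>u. c * (q\<^sup>2 * ?w 2 u + \<bar>q\<bar> ^ 3 * ?w 3 u + q ^ 4 * ?w 4 u))"
      by (intro integrable_mult_right Bochner_Integration.integrable_add integral_power_exp)
    fix u :: real
    show "cmod (?g M u - ?g N u) \<le> c * (q\<^sup>2 * ?w 2 u + \<bar>q\<bar> ^ 3 * ?w 3 u + q ^ 4 * ?w 4 u)"
    proof (cases "0 \<le> u")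
      case True
      have "?g M u - ?g N u = exp (\<i> * complex_of_real u * \<zeta>) * (char M (- (q * u)) - char N (- (q * u)))"
        using True by (simp add: right_diff_distrib)
      then have "cmod (?g M u - ?g N u) = cmod (exp (\<i> * complex_of_real u * \<zeta>)) * cmod (char M (- (q * u)) - char N (- (q * u)))"
        by (simp only: norm_mult)
      also have "\<dots> \<le> exp (- u) * (c * ((- (q * u))\<^sup>2 + \<bar>- (q * u)\<bar> ^ 3 + (- (q * u)) ^ 4))"
        by (intro mult_mono norm_exp_half_line_le[OF \<zeta> True] diff) auto
      also have "\<dots> = c * (q\<^sup>2 * ?w 2 u + \<bar>q\<bar> ^ 3 * ?w 3 u + q ^ 4 * ?w 4 u)"
        using True by (simp add: abs_mult power_mult_distrib algebra_simps)
      finally show ?thesis .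
    qed simp
  qed
  also have "\<dots> = c * (q\<^sup>2 * fact 2 + \<bar>q\<bar> ^ 3 * fact 3 + q ^ 4 * fact 4)"
    using integral_power_exp by simp
  also have "\<dots> = c * (2 * q\<^sup>2 + 6 * \<bar>q\<bar> ^ 3 + 24 * q ^ 4)" by (simp add: fact_numeral)
  finally show ?thesis .
qed

section \<open>Normal approximation of characteristic functions\<close>

lemma exp_taylor2_bound:
  assumes "0 \<le> (y::real)"
  shows "\<bar>exp (- y) - (1 - y)\<bar> \<le> y\<^sup>2 / 2"
proof -
  have "1 - y \<le> exp (- y)" using exp_ge_add_one_self[of "- y"] by simp
  moreover have "exp (- y) \<le> 1 - y + y\<^sup>2 / 2"
  proof -
    let ?h = "\<lambda>y::real. 1 - y + y\<^sup>2 / 2 - exp (- y)"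
    have "?h 0 \<le> ?h y"
    proof (rule DERIV_nonneg_imp_nondecreasing[OF assms])
      fix x :: real assume "0 \<le> x"
      have "(?h has_real_derivative (x - 1 + exp (- x))) (at x)"
        by (auto intro!: derivative_eq_intros)
      moreover have "0 \<le> x - 1 + exp (- x)" using exp_ge_add_one_self[of "- x"] by simp
      ultimately show "\<exists>z. (?h has_real_derivative z) (at x) \<and> 0 \<le> z" by blast
    qed
    then show ?thesis by simp
  qed
  ultimately show ?thesis by simp
qed

lemma exp_minus_diff_le:
  assumes "0 \<le> (a::real)" "a \<le> b"
  shows "\<bar>exp (- a) - exp (- b)\<bar> \<le> b - a"
proof -
  have "exp (- b) \<le> exp (- a)" using assms by simp
  moreover have "exp (- a) * (1 - (b - a)) \<le> exp (- a) * exp (- (b - a))"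
    using exp_ge_add_one_self[of "- (b - a)"] by (intro mult_left_mono) (auto simp: algebra_simps)
  moreover have "exp (- a) * exp (- (b - a)) = exp (- b)" by (simp flip: exp_add)
  moreover have "exp (- a) * (b - a) \<le> 1 * (b - a)" using assms by (intro mult_right_mono) auto
  ultimately show ?thesis by (simp add: algebra_simps)
qed

text \<open>Both functions are compared with 1 - t^2 / 2: the characteristic function by its
  expansion with a third absolute moment, the Gaussian by the second-order bound on exp. The
  constants are then enlarged for a short formula.\<close>

lemma char_gaussian_approx:
  assumes "real_distribution M" "(\<integral>x. x \<partial>M) = 0" "integrable M (\<lambda>x. x\<^sup>2)" "(\<integral>x. x\<^sup>2 \<partial>M) = 1"
    and "integrable M (\<lambda>x. \<bar>x\<bar> ^ 3)" "(\<integral>x. \<bar>x\<bar> ^ 3 \<partial>M) \<le> C"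
  shows "cmod (char M t - complex_of_real (exp (- (t\<^sup>2 / 2)))) \<le> C * \<bar>t\<bar> ^ 3 + t ^ 4"
proof -
  interpret real_distribution M by fact
  have "integrable M (\<lambda>x. x)" by (rule square_integrable_imp_integrable) (use assms in auto)
  then have "cmod (char M t - complex_of_real (1 - t\<^sup>2 * 1 / 2)) \<le> t\<^sup>2 / 6 * (\<integral>x. min (6 * x\<^sup>2) (\<bar>t\<bar> * \<bar>x\<bar> ^ 3) \<partial>M)"
    using assms by (intro char_approx3) auto
  also have "\<dots> \<le> t\<^sup>2 / 6 * (\<integral>x. \<bar>t\<bar> * \<bar>x\<bar> ^ 3 \<partial>M)"
    using assms by (intro mult_left_mono integral_mono Bochner_Integration.integrable_min) auto
  also have "\<dots> = \<bar>t\<bar> ^ 3 / 6 * (\<integral>x. \<bar>x\<bar> ^ 3 \<partial>M)"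
  proof -
    have "\<bar>t\<bar> ^ 3 = t\<^sup>2 * \<bar>t\<bar>" by (simp add: power3_eq_cube power2_eq_square)
    then show ?thesis by simp
  qed
  also have "\<dots> \<le> \<bar>t\<bar> ^ 3 / 6 * C" using assms by (intro mult_left_mono) auto
  finally have 1: "cmod (char M t - complex_of_real (1 - t\<^sup>2 / 2)) \<le> \<bar>t\<bar> ^ 3 / 6 * C" by simp
  have C: "0 \<le> C" using assms(6) by (rule order.trans[rotated]) simp
  have "\<bar>exp (- (t\<^sup>2 / 2)) - (1 - t\<^sup>2 / 2)\<bar> \<le> (t\<^sup>2 / 2)\<^sup>2 / 2" by (rule exp_taylor2_bound) simp
  then have 2: "cmod (complex_of_real (1 - t\<^sup>2 / 2) - complex_of_real (exp (- (t\<^sup>2 / 2)))) \<le> (t\<^sup>2 / 2)\<^sup>2 / 2"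
    by (simp only: of_real_diff[symmetric] norm_of_real abs_minus_commute)
  have "cmod (char M t - complex_of_real (exp (- (t\<^sup>2 / 2)))) \<le> \<bar>t\<bar> ^ 3 / 6 * C + (t\<^sup>2 / 2)\<^sup>2 / 2"
    using norm_triangle_le[OF add_mono[OF 1 2]] by simp
  also have "\<dots> \<le> C * \<bar>t\<bar> ^ 3 + t ^ 4"
  proof (rule add_mono)
    show "\<bar>t\<bar> ^ 3 / 6 * C \<le> C * \<bar>t\<bar> ^ 3" using C by (simp add: mult.commute mult_left_mono)
    show "(t\<^sup>2 / 2)\<^sup>2 / 2 \<le> t ^ 4" by (simp add: power_divide power_mult[symmetric])
  qed
  finally show ?thesis .
qed

section \<open>Rows and minors of the model\<close>

text \<open>Coordinates are indexed by the upper triangle, where the independent entries are; min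
  and max read the symmetric matrix off them.\<close>

definition entry :: "(nat \<times> nat \<Rightarrow> real) \<Rightarrow> nat \<Rightarrow> nat \<Rightarrow> real" where
  "entry x i k = x (min i k, max i k)"

definition model :: "real \<Rightarrow> real \<Rightarrow> nat \<Rightarrow> (nat \<times> nat \<Rightarrow> real) \<Rightarrow> nat \<Rightarrow> nat \<Rightarrow> real" where
  "model p q n x i k = (p * entry x i k + (if i = k then q * (\<Sum>l<n. entry x i l) else 0)) / sqrt (real n)"

text \<open>The size stays \<open>n\<close>: row and column j become zero, and with them their
  contributions to all other row sums. Index j decouples, and the rest of the model is independent
  of the row.\<close>

definition drop_row :: "nat \<Rightarrow> (nat \<times> nat \<Rightarrow> real) \<Rightarrow> nat \<times> nat \<Rightarrow> real" where
  "drop_row j x = (\<lambda>(i, k). if i = j \<or> k = j then 0 else x (i, k))"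

text \<open>The diagonal entry is left out, since its mean and variance are not prescribed; it is
  treated as an error term.\<close>

definition row_vec :: "nat \<Rightarrow> nat \<Rightarrow> (nat \<times> nat \<Rightarrow> real) \<Rightarrow> nat \<Rightarrow> real" where
  "row_vec n j x k = (if k = j then 0 else entry x j k / sqrt (real n))"

lemma entry_commute: "entry x i k = entry x k i"
  by (simp add: entry_def min.commute max.commute)

lemma entry_drop_row: "entry (drop_row j x) i k = (if i = j \<or> k = j then 0 else entry x i k)"
  by (auto simp: entry_def drop_row_def min_def max_def)

lemma sym_array_model: "sym_array n (model p q n x)"
  by (auto simp: sym_array_def model_def entry_commute)

text \<open>An entry acts through \<open>p\<close> at its own place and through \<open>q\<close> in
  the sum of its row, whence the factor |p| + |q|.\<close>

lemma sum_model_diff_le: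
  "(\<Sum>i<n. \<Sum>k<n. \<bar>model p q n x i k - model p q n y i k\<bar>) \<le>
    (\<bar>p\<bar> + \<bar>q\<bar>) / sqrt (real n) * (\<Sum>i<n. \<Sum>k<n. \<bar>entry x i k - entry y i k\<bar>)"
proof -
  let ?d = "\<lambda>i k. entry x i k - entry y i k" and ?s = "sqrt (real n)"
  have "\<bar>model p q n x i k - model p q n y i k\<bar> \<le>
      (\<bar>p\<bar> * \<bar>?d i k\<bar> + (if i = k then \<bar>q\<bar> * (\<Sum>l<n. \<bar>?d i l\<bar>) else 0)) / ?s" for i k
  proof -
    have "model p q n x i k - model p q n y i k = (p * ?d i k + (if i = k then q * (\<Sum>l<n. ?d i l) else 0)) / ?s"
      by (simp add: model_def sum_subtractf diff_divide_distrib[symmetric] algebra_simps)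
    also have "\<bar>\<dots>\<bar> = \<bar>p * ?d i k + (if i = k then q * (\<Sum>l<n. ?d i l) else 0)\<bar> / ?s" by (simp add: abs_divide)
    also have "\<dots> \<le> (\<bar>p\<bar> * \<bar>?d i k\<bar> + (if i = k then \<bar>q\<bar> * (\<Sum>l<n. \<bar>?d i l\<bar>) else 0)) / ?s"
    proof (rule divide_right_mono)
      have "\<bar>q * (\<Sum>l<n. ?d i l)\<bar> \<le> \<bar>q\<bar> * (\<Sum>l<n. \<bar>?d i l\<bar>)"
        unfolding abs_mult by (intro mult_left_mono sum_abs) auto
      then have "\<bar>p * ?d i k + q * (\<Sum>l<n. ?d i l)\<bar> \<le> \<bar>p\<bar> * \<bar>?d i k\<bar> + \<bar>q\<bar> * (\<Sum>l<n. \<bar>?d i l\<bar>)"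
        using abs_triangle_ineq[of "p * ?d i k" "q * (\<Sum>l<n. ?d i l)"] unfolding abs_mult[of p] by linarith
      then show "\<bar>p * ?d i k + (if i = k then q * (\<Sum>l<n. ?d i l) else 0)\<bar> \<le>
          \<bar>p\<bar> * \<bar>?d i k\<bar> + (if i = k then \<bar>q\<bar> * (\<Sum>l<n. \<bar>?d i l\<bar>) else 0)"
        by (cases "i = k") (simp_all add: abs_mult[of p])
    qed simp
    finally show ?thesis .
  qed
  then have "(\<Sum>i<n. \<Sum>k<n. \<bar>model p q n x i k - model p q n y i k\<bar>) \<le>
      (\<Sum>i<n. \<Sum>k<n. (\<bar>p\<bar> * \<bar>?d i k\<bar> + (if i = k then \<bar>q\<bar> * (\<Sum>l<n. \<bar>?d i l\<bar>) else 0)) / ?s)"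
    by (intro sum_mono)
  also have "\<dots> = ((\<Sum>i<n. \<Sum>k<n. \<bar>p\<bar> * \<bar>?d i k\<bar>) + (\<Sum>i<n. \<Sum>k<n. if i = k then \<bar>q\<bar> * (\<Sum>l<n. \<bar>?d i l\<bar>) else 0)) / ?s"
    by (simp only: sum_divide_distrib[symmetric] sum.distrib)
  also have "(\<Sum>i<n. \<Sum>k<n. if i = k then \<bar>q\<bar> * (\<Sum>l<n. \<bar>?d i l\<bar>) else 0) = (\<Sum>i<n. \<bar>q\<bar> * (\<Sum>l<n. \<bar>?d i l\<bar>))"
    by (intro sum.cong refl) simp
  also have "((\<Sum>i<n. \<Sum>k<n. \<bar>p\<bar> * \<bar>?d i k\<bar>) + (\<Sum>i<n. \<bar>q\<bar> * (\<Sum>l<n. \<bar>?d i l\<bar>))) / ?s = (\<bar>p\<bar> + \<bar>q\<bar>) / ?s * (\<Sum>i<n. \<Sum>k<n. \<bar>?d i k\<bar>)"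
    by (simp add: sum_distrib_left[symmetric] distrib_right)
  finally show ?thesis .
qed

lemma norm_trace_model_diff_le:
  assumes "1 \<le> Im z"
  shows "cmod (norm_trace n (model p q n x) z - norm_trace n (model p q n y) z) \<le>
    (\<bar>p\<bar> + \<bar>q\<bar>) * (\<Sum>i<n. \<Sum>k<n. \<bar>entry x i k - entry y i k\<bar>) / (real n * sqrt (real n))"
proof -
  have "cmod (norm_trace n (model p q n x) z - norm_trace n (model p q n y) z) \<le>
    (\<Sum>i<n. \<Sum>k<n. \<bar>model p q n x i k - model p q n y i k\<bar>) / real n"
    by (intro norm_trace_diff_le sym_array_model assms)
  also have "\<dots> \<le> ((\<bar>p\<bar> + \<bar>q\<bar>) / sqrt (real n) * (\<Sum>i<n. \<Sum>k<n. \<bar>entry x i k - entry y i k\<bar>)) / real n"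
    by (intro divide_right_mono sum_model_diff_le) simp
  finally show ?thesis by (simp add: mult_ac)
qed

lemma model_zero_at:
  assumes "e \<in> {(i, k). i \<le> k}"
  shows "(\<Sum>i<n. \<Sum>k<n. \<bar>entry x i k - entry (x(e := 0)) i k\<bar>) \<le> 2 * \<bar>x e\<bar>"
proof -
  obtain a b where e: "e = (a, b)" "a \<le> b" using assms by auto
  have "\<bar>entry x i k - entry (x(e := 0)) i k\<bar> \<le> (if i = a then if k = b then \<bar>x e\<bar> else 0 else 0) + (if i = b then if k = a then \<bar>x e\<bar> else 0 else 0)" for i k
    using e by (auto simp: entry_def min_def max_def)
  then have "(\<Sum>i<n. \<Sum>k<n. \<bar>entry x i k - entry (x(e := 0)) i k\<bar>) \<le>
    (\<Sum>i<n. \<Sum>k<n. (if i = a then if k = b then \<bar>x e\<bar> else 0 else 0) + (if i = b then if k = a then \<bar>x e\<bar> else 0 else 0))"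
    by (intro sum_mono)
  also have "\<dots> = (\<Sum>i<n. if i = a then \<Sum>k<n. if k = b then \<bar>x e\<bar> else 0 else 0) + (\<Sum>i<n. if i = b then \<Sum>k<n. if k = a then \<bar>x e\<bar> else 0 else 0)"
    by (simp only: sum.distrib) (intro arg_cong2[of _ _ _ _ "(+)"] sum.cong refl; simp)
  also have "\<dots> \<le> 2 * \<bar>x e\<bar>" by simp
  finally show ?thesis .
qed

lemma model_drop_row:
  assumes "j < n"
  shows "(\<Sum>i<n. \<Sum>k<n. \<bar>entry x i k - entry (drop_row j x) i k\<bar>) \<le> 2 * (\<Sum>k<n. \<bar>entry x j k\<bar>)"
proof -
  have "\<bar>entry x i k - entry (drop_row j x) i k\<bar> \<le> (if i = j then \<bar>entry x j k\<bar> else 0) + (if k = j then \<bar>entry x j i\<bar> else 0)" for i k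
    by (auto simp: entry_drop_row entry_commute[of x i j])
  then have "(\<Sum>i<n. \<Sum>k<n. \<bar>entry x i k - entry (drop_row j x) i k\<bar>) \<le>
      (\<Sum>i<n. \<Sum>k<n. (if i = j then \<bar>entry x j k\<bar> else 0) + (if k = j then \<bar>entry x j i\<bar> else 0))"
    by (intro sum_mono)
  also have "\<dots> = (\<Sum>i<n. if i = j then \<Sum>k<n. \<bar>entry x j k\<bar> else 0) + (\<Sum>i<n. \<bar>entry x j i\<bar>)"
    using assms by (simp only: sum.distrib) (intro arg_cong2[of _ _ _ _ "(+)"] sum.cong refl; simp)
  also have "\<dots> = 2 * (\<Sum>k<n. \<bar>entry x j k\<bar>)" using assms by simp
  finally show ?thesis .
qed

section \<open>Expansion of the resolvent along one row\<close>

context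
  fixes p q :: real and n j :: nat and x :: "nat \<times> nat \<Rightarrow> real" and z :: complex
begin

definition "full_res = resolvent n (model p q n x) z"
definition "minor_res = resolvent n (model p q n (drop_row j x)) z"
definition "cvec k = complex_of_real (row_vec n j x k)"
definition "row_form = (\<Sum>k<n. \<Sum>l<n. cvec k * minor_res k l * cvec l)"
definition "row_total = (\<Sum>k<n. row_vec n j x k)"
text \<open>The mark left by the row sums: without row j the diagonal entries at the other indices
  lose q times the entries of the row, a perturbation that couples the minor with column j of the
  full resolvent.\<close>

definition "cross = (\<Sum>k<n. cvec k * (\<Sum>l<n. minor_res k l * (cvec l * full_res l j)))"

lemma cvec_self [simp]: "cvec j = 0" by (simp add: cvec_def row_vec_def)

context
  assumes jn: "j < n" and z: "1 \<le> Im z"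
begin

lemma model_drop_row_zero: "model p q n (drop_row j x) i j = 0" "model p q n (drop_row j x) j i = 0"
  by (auto simp: model_def entry_drop_row)

lemma model_row:
  "k \<noteq> j \<Longrightarrow> complex_of_real (model p q n x j k) = of_real p * cvec k"
  "model p q n x j j = q * row_total + (p + q) * x (j, j) / sqrt (real n)"
proof -
  show "k \<noteq> j \<Longrightarrow> complex_of_real (model p q n x j k) = of_real p * cvec k"
    by (simp add: model_def cvec_def row_vec_def)
  have "(\<Sum>l<n. entry x j l) = entry x j j + (\<Sum>l\<in>{..<n} - {j}. entry x j l)"
    by (rule sum.remove) (use jn in auto)
  moreover have "row_total = (\<Sum>l\<in>{..<n} - {j}. entry x j l) / sqrt (real n)"
  proof -
    have "row_total = row_vec n j x j + (\<Sum>l\<in>{..<n} - {j}. row_vec n j x l)"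
      unfolding row_total_def by (rule sum.remove) (use jn in auto)
    also have "\<dots> = (\<Sum>l\<in>{..<n} - {j}. entry x j l / sqrt (real n))"
      by (simp add: row_vec_def)
    finally show ?thesis by (simp add: sum_divide_distrib)
  qed
  ultimately show "model p q n x j j = q * row_total + (p + q) * x (j, j) / sqrt (real n)"
    by (simp add: model_def entry_def[of x j j] add_divide_distrib algebra_simps)
qed

lemma model_diff:
  assumes "i \<noteq> j"
  shows "complex_of_real (model p q n x i k - model p q n (drop_row j x) i k) =
    (if k = j then of_real p * cvec i else 0) + (if k = i then of_real q * cvec i else 0)"
proof -
  have "(\<Sum>l<n. entry x i l) - (\<Sum>l<n. entry (drop_row j x) i l) = (\<Sum>l<n. if l = j then entry x i l else 0)"
    unfolding sum_subtractf[symmetric] using assms by (intro sum.cong) (auto simp: entry_drop_row)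
  also have "\<dots> = entry x j i" using jn by (simp add: entry_commute)
  finally have s: "(\<Sum>l<n. entry x i l) - (\<Sum>l<n. entry (drop_row j x) i l) = entry x j i" .
  have "model p q n x i k - model p q n (drop_row j x) i k =
      (p * (entry x i k - entry (drop_row j x) i k) + (if i = k then q * ((\<Sum>l<n. entry x i l) - (\<Sum>l<n. entry (drop_row j x) i l)) else 0)) / sqrt (real n)"
    by (simp add: model_def diff_divide_distrib[symmetric] algebra_simps)
  also have "\<dots> = (if k = j then p * row_vec n j x i else 0) + (if k = i then q * row_vec n j x i else 0)"
    unfolding s using assms by (auto simp: entry_drop_row row_vec_def entry_commute[of x i j])
  finally show ?thesis using assms by (auto simp: cvec_def)
qed

text \<open>A Schur complement with an extra term. Column j of the full resolvent solves the
  equation of the minor, with a right-hand side made of the row and of the entrywise product of the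
  row with that column. Applying the resolvent of the minor and inserting the outcome in the
  equation of row j gives p^2 \<open>row_form\<close> from the first part and p q
  \<open>cross\<close> from the second.\<close>

lemma resolvent_row_identity:
  "(z - of_real (q * row_total) - of_real (p\<^sup>2) * row_form - of_real ((p + q) * x (j, j) / sqrt (real n))) * full_res j j =
    1 + of_real (p * q) * cross"
proof -
  let ?M = "model p q n x" and ?N = "model p q n (drop_row j x)"
  have z0: "Im z \<noteq> 0" "z \<noteq> 0" using z by auto
  \<comment> \<open>Index j is decoupled in the minor, so the component z R(j, j) of the right-hand
    side never meets the row vector.\<close>
  have R0j: "minor_res i j = 0" if "i < n" "i \<noteq> j" for i
    using resolvent_inverse(2)[OF sym_array_model z0(1) that(1) jn, of p q "drop_row j x"] that(2) z0(2)
    unfolding minor_res_def by (simp add: model_drop_row_zero)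
  have inv: "z * full_res i j - (\<Sum>k<n. complex_of_real (?M i k) * full_res k j) = (if i = j then 1 else 0)" if "i < n" for i
    unfolding full_res_def by (rule resolvent_inverse(1)[OF sym_array_model z0(1) that jn])
  \<comment> \<open>The image of column j of the full resolvent under z minus the model without row
    j.\<close>
  let ?u = "\<lambda>i. (if i = j then z * full_res j j else 0) + of_real p * full_res j j * cvec i + of_real q * cvec i * full_res i j"
  have u: "?u i = z * full_res i j - (\<Sum>k<n. complex_of_real (?N i k) * full_res k j)" if i: "i < n" for i
  proof (cases "i = j")
    case True
    then show ?thesis by (simp add: model_drop_row_zero)
  next
    case False
    have "(\<Sum>k<n. complex_of_real (?M i k) * full_res k j) - (\<Sum>k<n. complex_of_real (?N i k) * full_res k j) =
        (\<Sum>k<n. ((if k = j then of_real p * cvec i else 0) + (if k = i then of_real q * cvec i else 0)) * full_res k j)"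
      unfolding sum_subtractf[symmetric] model_diff[OF False, symmetric]
      by (intro sum.cong refl) (simp add: left_diff_distrib)
    also have "\<dots> = (\<Sum>k<n. (if k = j then of_real p * cvec i * full_res k j else 0)) + (\<Sum>k<n. (if k = i then of_real q * cvec i * full_res k j else 0))"
      unfolding sum.distrib[symmetric] by (intro sum.cong refl) (simp add: distrib_right)
    also have "\<dots> = of_real p * cvec i * full_res j j + of_real q * cvec i * full_res i j" using jn i by simp
    finally show ?thesis using inv[OF i] False by (simp add: algebra_simps)
  qed
  have sol: "full_res i j = (\<Sum>k<n. minor_res i k * ?u k)" if "i < n" for i
    unfolding minor_res_def by (rule resolvent_solve[OF sym_array_model z0(1) that u])
  have vR0: "(\<Sum>i<n. cvec i * (\<Sum>k<n. minor_res i k * (if k = j then z * full_res j j else 0))) = 0"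
  proof (rule sum.neutral, rule ballI)
    fix i assume "i \<in> {..<n}"
    then show "cvec i * (\<Sum>k<n. minor_res i k * (if k = j then z * full_res j j else 0)) = 0"
      using R0j[of i] by (cases "i = j") (auto intro!: sum.neutral)
  qed
  have "(\<Sum>i<n. cvec i * full_res i j) = (\<Sum>i<n. cvec i * (\<Sum>k<n. minor_res i k * ?u k))"
    using sol by (intro sum.cong refl) simp
  also have "\<dots> = (\<Sum>i<n. cvec i * (\<Sum>k<n. minor_res i k * (if k = j then z * full_res j j else 0)))
      + (\<Sum>i<n. cvec i * (\<Sum>k<n. minor_res i k * (of_real p * full_res j j * cvec k))) + (\<Sum>i<n. cvec i * (\<Sum>k<n. minor_res i k * (of_real q * cvec k * full_res k j)))"
    by (simp only: distrib_left sum.distrib)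
  also have "(\<Sum>i<n. cvec i * (\<Sum>k<n. minor_res i k * (of_real p * full_res j j * cvec k))) = of_real p * full_res j j * row_form"
    unfolding row_form_def sum_distrib_left by (intro sum.cong refl) (simp add: mult_ac)
  also have "(\<Sum>i<n. cvec i * (\<Sum>k<n. minor_res i k * (of_real q * cvec k * full_res k j))) = of_real q * cross"
    unfolding cross_def sum_distrib_left by (intro sum.cong refl) (simp add: mult_ac)
  finally have vr: "(\<Sum>i<n. cvec i * full_res i j) = of_real p * full_res j j * row_form + of_real q * cross" unfolding vR0 by simp
  have "(\<Sum>k<n. complex_of_real (?M j k) * full_res k j) = complex_of_real (?M j j) * full_res j j + (\<Sum>k\<in>{..<n} - {j}. complex_of_real (?M j k) * full_res k j)"
    by (rule sum.remove) (use jn in auto)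
  also have "(\<Sum>k\<in>{..<n} - {j}. complex_of_real (?M j k) * full_res k j) = (\<Sum>k\<in>{..<n} - {j}. of_real p * (cvec k * full_res k j))"
    by (intro sum.cong refl) (simp add: model_row)
  also have "\<dots> = (\<Sum>k<n. of_real p * (cvec k * full_res k j))"
    by (rule sum.mono_neutral_left) auto
  also have "\<dots> = of_real p * (\<Sum>k<n. cvec k * full_res k j)" by (rule sum_distrib_left[symmetric])
  finally have "z * full_res j j - (complex_of_real (?M j j) * full_res j j + of_real p * (of_real p * full_res j j * row_form + of_real q * cross)) = 1"
    using inv[OF jn] unfolding vr by simp
  then show ?thesis
    unfolding model_row(2) by (simp add: algebra_simps power2_eq_square)
qed

text \<open>The row and the full resolvent are dependent, so the estimate is pointwise. By
  Cauchy-Schwarz |cross|^2 is at most |w|^2 times the sum of w_l^2 |R(l, j)|^2, and the weight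
  \<open>\<delta>\<close> splits the latter into the norm of a column and the fourth powers of the
  row. A second weight \<open>\<epsilon>\<close> removes the square root, so that expectations can
  be taken termwise.\<close>

lemma cross_le:
  assumes "0 < \<epsilon>" "0 < \<delta>"
  shows "cmod cross \<le> (\<epsilon> * (\<Sum>k<n. (row_vec n j x k)\<^sup>2) + ((\<delta> + (\<Sum>k<n. (row_vec n j x k) ^ 4) / \<delta>) / 2) / \<epsilon>) / 2"
proof -
  let ?V = "\<Sum>k<n. (row_vec n j x k)\<^sup>2" and ?V4 = "\<Sum>k<n. (row_vec n j x k) ^ 4"
  let ?Y = "(\<delta> + ?V4 / \<delta>) / 2"
  have V0: "0 \<le> ?V" by (intro sum_nonneg) auto
  have "0 \<le> ?V4" by (intro sum_nonneg) auto
  then have Y0: "0 \<le> ?Y" using assms by simp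
  have col: "(\<Sum>l<n. (cmod (full_res l j))\<^sup>2) \<le> 1"
    unfolding full_res_def by (rule resolvent_column_le[OF sym_array_model z jn])
  have "(\<Sum>k<n. (cmod (\<Sum>l<n. minor_res k l * (cvec l * full_res l j)))\<^sup>2) \<le> (\<Sum>l<n. (cmod (cvec l * full_res l j))\<^sup>2)"
    unfolding minor_res_def by (rule resolvent_contraction[OF sym_array_model z])
  also have "\<dots> \<le> (\<Sum>l<n. (\<delta> * (cmod (full_res l j))\<^sup>2 + (row_vec n j x l) ^ 4 / \<delta>) / 2)"
  proof (rule sum_mono)
    fix l assume l: "l \<in> {..<n}"
    let ?a = "(cmod (full_res l j))\<^sup>2" and ?b = "(row_vec n j x l)\<^sup>2"
    have "cmod (full_res l j) \<le> 1" unfolding full_res_def using l jn z by (intro norm_resolvent_le_1 sym_array_model) auto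
    then have a: "?a \<le> 1" "0 \<le> ?a" by (auto simp: power_le_one)
    have "0 \<le> (\<delta> * ?a - ?b)\<^sup>2" by simp
    then have "2 * \<delta> * (?b * ?a) \<le> (\<delta> * ?a)\<^sup>2 + ?b\<^sup>2" by (simp add: power2_diff mult_ac)
    \<comment> \<open>Entries of the resolvent have modulus at most 1, so |R|^4 \<le> |R|^2, and
      only the norm of the column is left.\<close>
    also have "(\<delta> * ?a)\<^sup>2 \<le> \<delta>\<^sup>2 * ?a"
    proof -
      have "?a\<^sup>2 \<le> ?a" using a by (simp only: power2_eq_square mult_left_le)
      then show ?thesis unfolding power_mult_distrib by (rule mult_left_mono) simp
    qed
    finally have "2 * \<delta> * (?b * ?a) \<le> \<delta>\<^sup>2 * ?a + ?b\<^sup>2" by simp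
    then have "(2 * \<delta> * (?b * ?a)) / (2 * \<delta>) \<le> (\<delta>\<^sup>2 * ?a + ?b\<^sup>2) / (2 * \<delta>)" using assms by (intro divide_right_mono) auto
    then have "?b * ?a \<le> (\<delta> * ?a + ?b\<^sup>2 / \<delta>) / 2"
      using assms by (simp add: add_divide_distrib power2_eq_square)
    then show "(cmod (cvec l * full_res l j))\<^sup>2 \<le> (\<delta> * ?a + (row_vec n j x l) ^ 4 / \<delta>) / 2"
      by (simp add: cvec_def norm_mult power_mult_distrib power_mult[symmetric])
  qed
  also have "\<dots> = (\<delta> * (\<Sum>l<n. (cmod (full_res l j))\<^sup>2) + ?V4 / \<delta>) / 2"
    by (simp only: sum_divide_distrib[symmetric] sum.distrib sum_distrib_left[symmetric])
  also have "\<dots> \<le> ?Y" using mult_left_mono[OF col, of \<delta>] assms by simp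
  finally have w: "(\<Sum>k<n. (cmod (\<Sum>l<n. minor_res k l * (cvec l * full_res l j)))\<^sup>2) \<le> ?Y" .
  have "(cmod cross)\<^sup>2 \<le> (\<Sum>k<n. (cmod (cvec k))\<^sup>2) * (\<Sum>k<n. (cmod (\<Sum>l<n. minor_res k l * (cvec l * full_res l j)))\<^sup>2)"
    unfolding cross_def by (rule norm_sum_mult_le)
  also have "\<dots> \<le> ?V * ?Y"
  proof -
    have "(\<Sum>k<n. (cmod (cvec k))\<^sup>2) = ?V" by (simp add: cvec_def)
    then show ?thesis using mult_left_mono[OF w V0] by simp
  qed
  also have "\<dots> \<le> ((\<epsilon> * ?V + ?Y / \<epsilon>) / 2)\<^sup>2"
  proof -
    have amgm: "a * b \<le> ((a + b) / 2)\<^sup>2" for a b :: real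
      using zero_le_power2[of "a - b"] by (simp add: power2_eq_square field_simps)
    have "(\<epsilon> * ?V) * (?Y / \<epsilon>) = ?V * ?Y" using assms by simp
    then show ?thesis using amgm[of "\<epsilon> * ?V" "?Y / \<epsilon>"] by simp
  qed
  finally show ?thesis
    using V0 Y0 assms by (intro power2_le_imp_le[of "cmod cross"]) auto
qed

text \<open>Since Im g \<le> 0, the denominator \<zeta> has modulus at least 1. So it is enough to
  bound \<zeta> R(j, j) - 1, which the row identity expresses by three errors. The value
  \<open>g\<close> is free here; the mean trace, a constant, is inserted for it later.\<close>

lemma resolvent_diag_approx:
  assumes g: "Im g \<le> 0" and "0 < \<epsilon>" "0 < \<delta>"
  shows "cmod (full_res j j - 1 / (z - of_real (p\<^sup>2) * g - of_real (q * row_total))) \<le>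
    p\<^sup>2 * cmod (row_form - g) + \<bar>p + q\<bar> * \<bar>x (j, j)\<bar> / sqrt (real n) + \<bar>p * q\<bar> *
     ((\<epsilon> * (\<Sum>k<n. (row_vec n j x k)\<^sup>2) + ((\<delta> + (\<Sum>k<n. (row_vec n j x k) ^ 4) / \<delta>) / 2) / \<epsilon>) / 2)"
proof -
  let ?\<zeta> = "z - of_real (p\<^sup>2) * g - of_real (q * row_total)"
  let ?d = "complex_of_real ((p + q) * x (j, j) / sqrt (real n))"
  have "p\<^sup>2 * Im g \<le> 0" using g by (intro mult_nonneg_nonpos) auto
  then have "1 \<le> Im ?\<zeta>" using z by simp
  then have \<zeta>: "1 \<le> cmod ?\<zeta>" using abs_Im_le_cmod[of ?\<zeta>] by linarith
  then have \<zeta>0: "?\<zeta> \<noteq> 0" by auto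
  have Rj: "cmod (full_res j j) \<le> 1" unfolding full_res_def by (rule norm_resolvent_le_1[OF sym_array_model z jn jn])
  have "?\<zeta> * full_res j j - 1 = (of_real (p\<^sup>2) * (row_form - g) + ?d) * full_res j j + of_real (p * q) * cross"
    using resolvent_row_identity by (simp add: algebra_simps)
  then have "cmod (?\<zeta> * full_res j j - 1) \<le> cmod ((of_real (p\<^sup>2) * (row_form - g) + ?d) * full_res j j) + cmod (of_real (p * q) * cross)"
    using norm_triangle_ineq by metis
  also have "cmod ((of_real (p\<^sup>2) * (row_form - g) + ?d) * full_res j j) \<le> cmod (of_real (p\<^sup>2) * (row_form - g) + ?d) * 1"
    unfolding norm_mult[of _ "full_res j j"] using Rj by (intro mult_left_mono) auto
  also have "cmod (of_real (p\<^sup>2) * (row_form - g) + ?d) \<le> cmod (of_real (p\<^sup>2) * (row_form - g)) + cmod ?d" by (rule norm_triangle_ineq)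
  also have "cmod (of_real (p\<^sup>2) * (row_form - g)) = p\<^sup>2 * cmod (row_form - g)" unfolding norm_mult norm_of_real by simp
  also have "cmod ?d = \<bar>p + q\<bar> * \<bar>x (j, j)\<bar> / sqrt (real n)" unfolding norm_of_real by (simp add: abs_mult)
  also have "cmod (of_real (p * q) * cross) = \<bar>p * q\<bar> * cmod cross" unfolding norm_mult norm_of_real ..
  also have "cmod cross \<le> (\<epsilon> * (\<Sum>k<n. (row_vec n j x k)\<^sup>2) + ((\<delta> + (\<Sum>k<n. (row_vec n j x k) ^ 4) / \<delta>) / 2) / \<epsilon>) / 2"
    by (rule cross_le[OF assms(2,3)])
  finally have 1: "cmod (?\<zeta> * full_res j j - 1) \<le> p\<^sup>2 * cmod (row_form - g) + \<bar>p + q\<bar> * \<bar>x (j, j)\<bar> / sqrt (real n) + \<bar>p * q\<bar> *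
     ((\<epsilon> * (\<Sum>k<n. (row_vec n j x k)\<^sup>2) + ((\<delta> + (\<Sum>k<n. (row_vec n j x k) ^ 4) / \<delta>) / 2) / \<epsilon>) / 2)"
    by (simp add: mult_left_mono)
  have "cmod (full_res j j - 1 / ?\<zeta>) * 1 \<le> cmod (full_res j j - 1 / ?\<zeta>) * cmod ?\<zeta>"
    using \<zeta> by (intro mult_left_mono) auto
  also have "\<dots> = cmod (?\<zeta> * full_res j j - 1)"
  proof -
    have "(r - 1 / w) * w = w * r - 1" if "w \<noteq> 0" for r w :: complex using that by (simp add: field_simps)
    from this[OF \<zeta>0] show ?thesis unfolding norm_mult[symmetric] by simp
  qed
  finally show ?thesis using 1 by simp
qed

end

end

section \<open>The model on a product space\<close>

definition pair_index :: "nat \<Rightarrow> (nat \<times> nat) set" where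
  "pair_index n = {(i, k). i \<le> k \<and> k < n}"

lemma pair_index_subset: "pair_index n \<subseteq> {..<n} \<times> {..<n}"
  by (auto simp: pair_index_def)

lemma finite_pair_index [simp]: "finite (pair_index n)"
  using pair_index_subset by (rule finite_subset) auto

lemma card_pair_index_le: "card (pair_index n) \<le> n * n"
  using card_mono[OF _ pair_index_subset[of n]] by simp

text \<open>Weighted arithmetic-geometric mean: 2 |X| \<le> 1 / sqrt n + sqrt n |X|^2. It takes the
  place of Cauchy-Schwarz and stays linear in the integrals.\<close>

lemma (in prob_space) nn_integral_abs_le_of_square:
  fixes X :: "'a \<Rightarrow> complex"
  assumes [measurable]: "X \<in> borel_measurable M" and n: "0 < n" and C: "0 \<le> C"
    and sq: "(\<integral>\<^sup>+x. ennreal ((cmod (X x))\<^sup>2) \<partial>M) \<le> ennreal (C / real n)"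
  shows "(\<integral>\<^sup>+x. ennreal (cmod (X x)) \<partial>M) \<le> ennreal ((1 + C) / (2 * sqrt (real n)))"
proof -
  let ?s = "sqrt (real n)"
  have s: "0 < ?s" using n by simp
  have "cmod (X x) \<le> 1 / (2 * ?s) + ?s / 2 * (cmod (X x))\<^sup>2" for x
  proof -
    have "(1 - a * b)\<^sup>2 = 1 + a * a * b\<^sup>2 - 2 * a * b" for a b :: real
      by (simp add: power2_eq_square algebra_simps)
    from this[of ?s "cmod (X x)"] zero_le_power2[of "1 - ?s * cmod (X x)"]
    have "2 * ?s * cmod (X x) \<le> 1 + ?s * ?s * (cmod (X x))\<^sup>2" by linarith
    then have "2 * ?s * cmod (X x) / (2 * ?s) \<le> (1 + ?s * ?s * (cmod (X x))\<^sup>2) / (2 * ?s)"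
      using s by (intro divide_right_mono) auto
    moreover have "(1 + a * a * b) / (2 * a) = 1 / (2 * a) + a / 2 * b" "2 * a * b / (2 * a) = b" if "0 < a" for a b :: real
      using that by (simp_all add: field_simps)
    ultimately show ?thesis using s by metis
  qed
  then have "(\<integral>\<^sup>+x. ennreal (cmod (X x)) \<partial>M) \<le> (\<integral>\<^sup>+x. ennreal (1 / (2 * ?s) + ?s / 2 * (cmod (X x))\<^sup>2) \<partial>M)"
    by (intro nn_integral_mono ennreal_leI)
  also have "\<dots> = (\<integral>\<^sup>+x. ennreal (1 / (2 * ?s)) + ennreal (?s / 2) * ennreal ((cmod (X x))\<^sup>2) \<partial>M)"
    using s by (intro nn_integral_cong, subst ennreal_mult[symmetric]) (auto simp: ennreal_plus)
  also have "\<dots> = ennreal (1 / (2 * ?s)) + ennreal (?s / 2) * (\<integral>\<^sup>+x. ennreal ((cmod (X x))\<^sup>2) \<partial>M)"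
    by (subst nn_integral_add; simp add: nn_integral_cmult emeasure_space_1)
  also have "\<dots> \<le> ennreal (1 / (2 * ?s)) + ennreal (?s / 2) * ennreal (C / real n)"
    by (intro add_left_mono mult_left_mono sq) auto
  also have "\<dots> = ennreal (1 / (2 * ?s) + ?s / 2 * (C / real n))"
    using s C by (subst ennreal_mult[symmetric]) (auto simp: ennreal_plus)
  also have "1 / (2 * ?s) + ?s / 2 * (C / real n) = (1 + C) / (2 * ?s)"
  proof -
    have "real n = ?s * ?s" by simp
    then have "?s / 2 * (C / real n) = C / (2 * ?s)" using s by (simp add: divide_simps del: real_sqrt_mult_self)
    then show ?thesis by (simp add: add_divide_distrib)
  qed
  finally show ?thesis .
qed

text \<open>The mean trace depends only on the joint law of the upper triangle, so the entries are
  taken to be the coordinates of a product space, where Efron-Stein and Fubini apply.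
  \<open>K\<close> bounds the first four moments of all entries; being at least 1, it absorbs
  constants.\<close>

locale wigner_product =
  fixes \<mu> :: "nat \<times> nat \<Rightarrow> real measure" and n :: nat and K :: real and z :: complex and p q :: real
  assumes n: "0 < n" and z: "1 \<le> Im z"
    and prob: "\<And>e. prob_space (\<mu> e)" and sets: "\<And>e. sets (\<mu> e) = sets borel"
    and K: "1 \<le> K"
    and moment: "\<And>e l. e \<in> pair_index n \<Longrightarrow> l \<in> {1, 2, 3, 4} \<Longrightarrow> (\<integral>\<^sup>+t. ennreal (\<bar>t\<bar> ^ l) \<partial>\<mu> e) \<le> ennreal K"
    and mean: "\<And>i k. i < k \<Longrightarrow> k < n \<Longrightarrow> (\<integral>t. t \<partial>\<mu> (i, k)) = 0"
    and var: "\<And>i k. i < k \<Longrightarrow> k < n \<Longrightarrow> (\<integral>\<^sup>+t. ennreal (t\<^sup>2) \<partial>\<mu> (i, k)) = 1"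
begin

abbreviation "P \<equiv> Pi\<^sub>M (pair_index n) \<mu>"
abbreviation "tr \<equiv> \<lambda>x. norm_trace n (model p q n x) z"
definition "mean_tr = (\<integral>x. tr x \<partial>P)"

lemma prob_P: "prob_space P"
  by (rule prob_space_PiM) (rule prob)

lemma index_min_max: "i < n \<Longrightarrow> k < n \<Longrightarrow> (min i k, max i k) \<in> pair_index n"
  by (auto simp: pair_index_def)

lemma measurable_component [measurable]: "e \<in> pair_index n \<Longrightarrow> (\<lambda>x. x e) \<in> borel_measurable P"
proof -
  assume "e \<in> pair_index n"
  then have "(\<lambda>x. x e) \<in> measurable P (\<mu> e)" by simp
  then show ?thesis using measurable_cong_sets[OF refl sets] by blast
qed

lemma measurable_entry [measurable]: "i < n \<Longrightarrow> k < n \<Longrightarrow> (\<lambda>x. entry x i k) \<in> borel_measurable P"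
  unfolding entry_def by (intro measurable_component index_min_max)

lemma measurable_model: "i < n \<Longrightarrow> k < n \<Longrightarrow> (\<lambda>x. model p q n x i k) \<in> borel_measurable P"
  unfolding model_def by (cases "i = k") (auto intro!: borel_measurable_divide borel_measurable_add borel_measurable_times borel_measurable_sum measurable_entry)

lemma measurable_model_drop_row: "i < n \<Longrightarrow> k < n \<Longrightarrow> (\<lambda>x. model p q n (drop_row j x) i k) \<in> borel_measurable P"
proof -
  have e: "(\<lambda>x. entry (drop_row j x) i k) \<in> borel_measurable P" if "i < n" "k < n" for i k
    unfolding entry_drop_row using that by (cases "i = j \<or> k = j") (auto intro: measurable_entry)
  show "i < n \<Longrightarrow> k < n \<Longrightarrow> (\<lambda>x. model p q n (drop_row j x) i k) \<in> borel_measurable P"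
    unfolding model_def by (cases "i = k") (auto intro!: borel_measurable_divide borel_measurable_add borel_measurable_times borel_measurable_sum e)
qed

lemma measurable_tr [measurable]: "tr \<in> borel_measurable P"
  by (intro borel_measurable_norm_trace measurable_model borel_measurable_const)

lemma measurable_tr_drop [measurable]: "(\<lambda>x. tr (drop_row j x)) \<in> borel_measurable P"
  by (intro borel_measurable_norm_trace measurable_model_drop_row borel_measurable_const)

lemma measurable_full_res: "j < n \<Longrightarrow> (\<lambda>x. full_res p q n x z j j) \<in> borel_measurable P"
  unfolding full_res_def by (intro borel_measurable_resolvent measurable_model borel_measurable_const)

lemma measurable_minor_res: "k < n \<Longrightarrow> l < n \<Longrightarrow> (\<lambda>x. minor_res p q n j x z k l) \<in> borel_measurable P"
  unfolding minor_res_def by (intro borel_measurable_resolvent measurable_model_drop_row borel_measurable_const)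

lemma measurable_row_vec: "j < n \<Longrightarrow> k < n \<Longrightarrow> (\<lambda>x. row_vec n j x k) \<in> borel_measurable P"
  unfolding row_vec_def by (cases "k = j") (auto intro!: borel_measurable_divide measurable_entry)

lemma measurable_row_form: "j < n \<Longrightarrow> (\<lambda>x. row_form p q n j x z) \<in> borel_measurable P"
proof -
  assume j: "j < n"
  have "(\<lambda>x. cvec n j x k) \<in> borel_measurable P" if "k < n" for k
    unfolding cvec_def using measurable_row_vec[OF j that] by measurable
  then show ?thesis
    unfolding row_form_def
    by (intro borel_measurable_sum borel_measurable_times measurable_minor_res) auto
qed

lemma measurable_row_total: "j < n \<Longrightarrow> (\<lambda>x. row_total n j x) \<in> borel_measurable P"
  unfolding row_total_def by (intro borel_measurable_sum measurable_row_vec) auto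

lemma entry_moment:
  assumes "i < n" "k < n" "l \<in> {1, 2, 3, 4}"
  shows "(\<integral>\<^sup>+x. ennreal (\<bar>entry x i k\<bar> ^ l) \<partial>P) \<le> ennreal K"
  unfolding entry_def
  using moment[OF index_min_max[OF assms(1,2)] assms(3)]
    nn_integral_PiM_component[OF finite_pair_index prob sets index_min_max[OF assms(1,2)], of "\<lambda>t. ennreal (\<bar>t\<bar> ^ l)"]
  by simp

lemma norm_tr_le: "cmod (tr x) \<le> 1"
  by (rule norm_norm_trace_le_1[OF sym_array_model z])

lemma integrable_tr: "integrable P tr"
proof -
  interpret prob_space P by (rule prob_P)
  show ?thesis using norm_tr_le by (intro integrable_const_bound[where B = 1]) auto
qed

lemma Im_mean_tr: "Im mean_tr \<le> 0"
proof -
  have "0 \<le> (\<integral>x. - Im (tr x) \<partial>P)"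
    using z Im_norm_trace_le_0[OF sym_array_model] by (intro Bochner_Integration.integral_nonneg) auto
  then show ?thesis unfolding mean_tr_def using integral_Im[OF integrable_tr] by simp
qed

text \<open>There are at most n^2 coordinates, and zeroing one changes the trace by O(n^(-3/2)), so
  Efron-Stein gives O(1 / n). The 2 in \<open>?c\<close> stands for the two places of an entry in
  the symmetric matrix.\<close>

lemma variance_tr: "(\<integral>\<^sup>+x. ennreal ((cmod (tr x - mean_tr))\<^sup>2) \<partial>P) \<le> ennreal (4 * (\<bar>p\<bar> + \<bar>q\<bar>)\<^sup>2 * K / real n)"
proof -
  interpret prob_space P by (rule prob_P)
  let ?c = "2 * (\<bar>p\<bar> + \<bar>q\<bar>) / (real n * sqrt (real n))"
  have "(\<integral>\<^sup>+x. ennreal ((cmod (tr x))\<^sup>2) \<partial>P) \<le> (\<integral>\<^sup>+x. 1 \<partial>P)"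
    using norm_tr_le by (intro nn_integral_mono) (simp add: power_le_one)
  then have fin: "(\<integral>\<^sup>+x. ennreal ((cmod (tr x))\<^sup>2) \<partial>P) < \<infinity>"
    by (simp add: emeasure_space_1 le_less_trans)
  have "(\<integral>\<^sup>+x. ennreal ((cmod (tr x - mean_tr))\<^sup>2) \<partial>P) \<le> (\<Sum>e\<in>pair_index n. \<integral>\<^sup>+x. ennreal ((cmod (tr x - tr (x(e := 0))))\<^sup>2) \<partial>P)"
    unfolding mean_tr_def by (rule efron_stein[OF finite_pair_index prob sets measurable_tr fin])
  also have "\<dots> \<le> (\<Sum>e\<in>pair_index n. ennreal (?c\<^sup>2 * K))"
  proof (rule sum_mono)
    fix e assume e: "e \<in> pair_index n"
    then have e': "e \<in> {(i, k). i \<le> k}" by (auto simp: pair_index_def)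
    have "(\<integral>\<^sup>+x. ennreal ((cmod (tr x - tr (x(e := 0))))\<^sup>2) \<partial>P) \<le> (\<integral>\<^sup>+x. ennreal (?c\<^sup>2) * ennreal (\<bar>x e\<bar> ^ 2) \<partial>P)"
    proof (rule nn_integral_mono)
      fix x
      have "cmod (tr x - tr (x(e := 0))) \<le> (\<bar>p\<bar> + \<bar>q\<bar>) * (2 * \<bar>x e\<bar>) / (real n * sqrt (real n))"
        by (intro order.trans[OF norm_trace_model_diff_le[OF z]] divide_right_mono mult_left_mono model_zero_at[OF e']) auto
      then have "cmod (tr x - tr (x(e := 0))) \<le> ?c * \<bar>x e\<bar>" by (simp add: mult_ac)
      then have "(cmod (tr x - tr (x(e := 0))))\<^sup>2 \<le> (?c * \<bar>x e\<bar>)\<^sup>2" by (rule power_mono) simp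
      then have "ennreal ((cmod (tr x - tr (x(e := 0))))\<^sup>2) \<le> ennreal (?c\<^sup>2 * \<bar>x e\<bar> ^ 2)" unfolding power_mult_distrib by (rule ennreal_leI)
      then show "ennreal ((cmod (tr x - tr (x(e := 0))))\<^sup>2) \<le> ennreal (?c\<^sup>2) * ennreal (\<bar>x e\<bar> ^ 2)"
        by (simp add: ennreal_mult)
    qed
    also have "\<dots> = ennreal (?c\<^sup>2) * (\<integral>\<^sup>+x. ennreal (\<bar>x e\<bar> ^ 2) \<partial>P)"
      using measurable_component[OF e] by (intro nn_integral_cmult) simp
    also have "(\<integral>\<^sup>+x. ennreal (\<bar>x e\<bar> ^ 2) \<partial>P) \<le> ennreal K"
      using nn_integral_PiM_component[OF finite_pair_index prob sets e, of "\<lambda>t. ennreal (\<bar>t\<bar> ^ 2)"] moment[OF e, of 2] by simp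
    finally show "(\<integral>\<^sup>+x. ennreal ((cmod (tr x - tr (x(e := 0))))\<^sup>2) \<partial>P) \<le> ennreal (?c\<^sup>2 * K)"
      using K by (subst ennreal_mult) (auto simp: mult_left_mono)
  qed
  also have "\<dots> = ennreal (real (card (pair_index n)) * (?c\<^sup>2 * K))"
    using K by (simp add: ennreal_mult ennreal_of_nat_eq_real_of_nat)
  also have "\<dots> \<le> ennreal ((real n * real n) * (?c\<^sup>2 * K))"
    using card_pair_index_le[of n] K by (intro ennreal_leI mult_right_mono) (auto simp flip: of_nat_mult)
  also have "(real n * real n) * (?c\<^sup>2 * K) = 4 * (\<bar>p\<bar> + \<bar>q\<bar>)\<^sup>2 * K / real n"
  proof -
    have "(real n * real n) * ((2 * A / (real n * sqrt (real n)))\<^sup>2 * K) = 4 * A\<^sup>2 * K / real n" for A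
      using n by (simp add: power_divide power_mult_distrib field_simps power2_eq_square[of "real n"])
    then show ?thesis by blast
  qed
  finally show ?thesis .
qed

text \<open>A row has n entries, each with an influence O(n^(-3/2)) on the trace.\<close>

lemma drop_row_tr_diff:
  assumes "j < n"
  shows "(\<integral>\<^sup>+x. ennreal (cmod (tr (drop_row j x) - tr x)) \<partial>P) \<le> ennreal (2 * (\<bar>p\<bar> + \<bar>q\<bar>) * K / sqrt (real n))"
proof -
  let ?c = "2 * (\<bar>p\<bar> + \<bar>q\<bar>) / (real n * sqrt (real n))"
  have m: "(\<lambda>x. ennreal (\<bar>entry x j k\<bar> ^ 1)) \<in> borel_measurable P" if "k < n" for k
    using measurable_entry[OF assms that] by measurable
  have "(\<integral>\<^sup>+x. ennreal (cmod (tr (drop_row j x) - tr x)) \<partial>P) \<le> (\<integral>\<^sup>+x. ennreal ?c * (\<Sum>k<n. ennreal (\<bar>entry x j k\<bar> ^ 1)) \<partial>P)"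
  proof (rule nn_integral_mono)
    fix x
    have "cmod (tr x - tr (drop_row j x)) \<le> (\<bar>p\<bar> + \<bar>q\<bar>) * (2 * (\<Sum>k<n. \<bar>entry x j k\<bar>)) / (real n * sqrt (real n))"
      by (intro order.trans[OF norm_trace_model_diff_le[OF z]] divide_right_mono mult_left_mono model_drop_row assms) auto
    then have "cmod (tr (drop_row j x) - tr x) \<le> ?c * (\<Sum>k<n. \<bar>entry x j k\<bar>)" by (simp add: algebra_simps norm_minus_commute)
    then have "ennreal (cmod (tr (drop_row j x) - tr x)) \<le> ennreal (?c * (\<Sum>k<n. \<bar>entry x j k\<bar>))" by (rule ennreal_leI)
    also have "ennreal (?c * (\<Sum>k<n. \<bar>entry x j k\<bar>)) = ennreal ?c * ennreal (\<Sum>k<n. \<bar>entry x j k\<bar>)"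
      by (rule ennreal_mult) (auto intro: sum_nonneg)
    also have "ennreal (\<Sum>k<n. \<bar>entry x j k\<bar>) = (\<Sum>k<n. ennreal (\<bar>entry x j k\<bar> ^ 1))"
      by simp
    finally show "ennreal (cmod (tr (drop_row j x) - tr x)) \<le> ennreal ?c * (\<Sum>k<n. ennreal (\<bar>entry x j k\<bar> ^ 1))" .
  qed
  also have "\<dots> = ennreal ?c * (\<integral>\<^sup>+x. (\<Sum>k<n. ennreal (\<bar>entry x j k\<bar> ^ 1)) \<partial>P)"
    by (intro nn_integral_cmult borel_measurable_sum m) auto
  also have "(\<integral>\<^sup>+x. (\<Sum>k<n. ennreal (\<bar>entry x j k\<bar> ^ 1)) \<partial>P) = (\<Sum>k<n. \<integral>\<^sup>+x. ennreal (\<bar>entry x j k\<bar> ^ 1) \<partial>P)"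
    by (intro nn_integral_sum m) auto
  also have "ennreal ?c * (\<Sum>k<n. \<integral>\<^sup>+x. ennreal (\<bar>entry x j k\<bar> ^ 1) \<partial>P) \<le> ennreal ?c * (\<Sum>k<n. ennreal K)"
    using assms by (intro mult_left_mono sum_mono entry_moment) auto
  also have "\<dots> = ennreal (?c * (real n * K))"
  proof -
    have "(\<Sum>k<n. ennreal K) = ennreal (real n * K)"
      using K by (simp add: ennreal_mult ennreal_of_nat_eq_real_of_nat)
    then show ?thesis using K by (subst ennreal_mult) auto
  qed
  also have "?c * (real n * K) = 2 * (\<bar>p\<bar> + \<bar>q\<bar>) * K / sqrt (real n)" using n by simp
  finally show ?thesis .
qed

text \<open>Index j is excluded because the row vector vanishes there, and the division is by
  \<open>n\<close> because the other entries of the row vector have variance 1 / n. So this is the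
  conditional mean of \<open>row_form\<close> given the minor.\<close>

definition "minor_tr j x = (\<Sum>k\<in>{..<n} - {j}. minor_res p q n j x z k k) / of_nat n"

lemma measurable_minor_tr: "j < n \<Longrightarrow> minor_tr j \<in> borel_measurable P"
  unfolding minor_tr_def
  by (intro borel_measurable_divide borel_measurable_sum measurable_minor_res borel_measurable_const) auto

lemma minor_tr_diff:
  assumes "j < n"
  shows "cmod (minor_tr j x - tr (drop_row j x)) \<le> 1 / sqrt (real n)"
proof -
  have "(\<Sum>k<n. minor_res p q n j x z k k) = minor_res p q n j x z j j + (\<Sum>k\<in>{..<n} - {j}. minor_res p q n j x z k k)"
    by (rule sum.remove) (use assms in auto)
  then have "minor_tr j x - tr (drop_row j x) = - minor_res p q n j x z j j / of_nat n"
    unfolding minor_tr_def norm_trace_def minor_res_def[symmetric] by (simp add: diff_divide_distrib[symmetric])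
  then have "cmod (minor_tr j x - tr (drop_row j x)) = cmod (minor_res p q n j x z j j) / real n"
    by (simp add: norm_divide)
  also have "\<dots> \<le> 1 / real n"
    unfolding minor_res_def using assms by (intro divide_right_mono norm_resolvent_le_1 sym_array_model z) auto
  also have "\<dots> \<le> 1 / sqrt (real n)"
    using n by (intro divide_left_mono) (auto simp: real_le_lsqrt self_le_power power2_eq_square)
  finally show ?thesis .
qed

text \<open>Given the entries outside row j, the resolvent of the minor is a fixed matrix, and
  \<open>row_form\<close> is a quadratic form in independent centred variables. Its coefficients are
  those of the resolvent divided by n, with squared Hilbert-Schmidt norm at most n / n^2.\<close>

lemma row_form_variance:
  assumes j: "j < n"
  shows "(\<integral>\<^sup>+x. ennreal ((cmod (row_form p q n j x z - minor_tr j x))\<^sup>2) \<partial>P) \<le> ennreal ((2 * K + 8) / real n)"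
proof -
  interpret product_prob_space \<mu> by (rule product_prob_spaceI) (rule prob)
  let ?N = "{..<n} - {j}"
  \<comment> \<open>\<open>\<rho> k\<close> is the coordinate that stores the entry (j, k), and
    \<open>\<kappa>\<close> recovers \<open>k\<close> from it. Sums over indices and sums over
    coordinates are exchanged along this bijection.\<close>
  define \<rho> where "\<rho> k = (min j k, max j k)" for k
  define \<kappa> where "\<kappa> e = (if fst e = j then snd e else fst e)" for e :: "nat \<times> nat"
  have \<kappa>\<rho>: "\<kappa> (\<rho> k) = k" for k by (auto simp: \<kappa>_def \<rho>_def min_def max_def)
  define J where "J = \<rho> ` ?N"
  define L where "L = pair_index n - J"
  have inj: "inj_on \<rho> ?N" by (rule inj_on_inverseI) (rule \<kappa>\<rho>)
  have Jsub: "J \<subseteq> pair_index n" using j unfolding J_def \<rho>_def by (auto simp: pair_index_def)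
  have J: "finite J" "finite L" "L \<inter> J = {}" "L \<union> J = pair_index n"
    using Jsub unfolding L_def J_def by auto
  have off: "\<exists>a b. e = (a, b) \<and> a < b \<and> b < n" if e: "e \<in> J" for e
  proof -
    obtain k where k: "k < n" "k \<noteq> j" "e = \<rho> k" using e unfolding J_def by (elim imageE) blast
    then have "\<rho> k = (min j k, max j k) \<and> min j k < max j k \<and> max j k < n"
      using j unfolding \<rho>_def by (auto simp: min_def max_def)
    then show ?thesis using k(3) by blast
  qed
  let ?f = "\<lambda>x. ennreal ((cmod (row_form p q n j x z - minor_tr j x))\<^sup>2)"
  have f: "?f \<in> borel_measurable (Pi\<^sub>M (L \<union> J) \<mu>)"
    unfolding J(4) using measurable_row_form[OF j] measurable_minor_tr[OF j] by measurable
  \<comment> \<open>Tonelli for the splitting into the off-diagonal entries \<open>J\<close> of the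
    row and the rest \<open>L\<close>, which is frozen from here on.\<close>
  have "(\<integral>\<^sup>+x. ?f x \<partial>P) = (\<integral>\<^sup>+y. (\<integral>\<^sup>+x. ?f (merge L J (y, x)) \<partial>Pi\<^sub>M J \<mu>) \<partial>Pi\<^sub>M L \<mu>)"
    using product_nn_integral_fold[OF J(3,2,1) f] unfolding J(4) .
  also have "\<dots> \<le> (\<integral>\<^sup>+y. ennreal ((2 * K + 8) / real n) \<partial>Pi\<^sub>M L \<mu>)"
  proof (rule nn_integral_mono)
    fix y
    define r where "r = resolvent n (model p q n (drop_row j y)) z"
    define B where "B e f = r (\<kappa> e) (\<kappa> f) / of_nat n" for e f
    have mr: "minor_res p q n j (merge L J (y, x)) z = r" for x
      unfolding minor_res_def r_def
    proof (rule resolvent_cong)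
      have e: "entry (drop_row j (merge L J (y, x))) i k = entry (drop_row j y) i k" if "i < n" "k < n" for i k
      proof (cases "i = j \<or> k = j")
        case False
        then have "(min i k, max i k) \<in> L"
          using that index_min_max[OF that] unfolding L_def J_def \<rho>_def by (auto simp: min_def max_def split: if_splits)
        then show ?thesis using False by (simp add: entry_drop_row) (simp add: entry_def merge_def)
      qed (simp add: entry_drop_row)
      fix i k assume "i < n" "k < n"
      then show "model p q n (drop_row j (merge L J (y, x))) i k = model p q n (drop_row j y) i k"
        unfolding model_def by (simp add: e)
    qed
    have rv: "row_vec n j (merge L J (y, x)) k = x (\<rho> k) / sqrt (real n)" if "k \<in> ?N" for k x
    proof -
      have "\<rho> k \<in> J" unfolding J_def using that by blast
      moreover from this have "\<rho> k \<notin> L" using J(3) by auto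
      ultimately show ?thesis using that by (simp add: row_vec_def entry_def \<rho>_def[symmetric] merge_def)
    qed
    have rf: "row_form p q n j (merge L J (y, x)) z = (\<Sum>e\<in>J. \<Sum>f\<in>J. of_real (x e) * B e f * of_real (x f))" for x
    proof -
      have "row_form p q n j (merge L J (y, x)) z = (\<Sum>k\<in>?N. \<Sum>l\<in>?N. cvec n j (merge L J (y, x)) k * r k l * cvec n j (merge L J (y, x)) l)"
        unfolding row_form_def mr
        by (intro sum.mono_neutral_cong_right refl) (auto intro!: sum.neutral)
      also have "\<dots> = (\<Sum>k\<in>?N. \<Sum>l\<in>?N. of_real (x (\<rho> k)) * B (\<rho> k) (\<rho> l) * of_real (x (\<rho> l)))"
      proof (intro sum.cong refl)
        fix k l assume kl: "k \<in> ?N" "l \<in> ?N"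
        have nn: "complex_of_real (sqrt (real n)) * complex_of_real (sqrt (real n)) = of_nat n"
          by (simp flip: of_real_mult)
        show "cvec n j (merge L J (y, x)) k * r k l * cvec n j (merge L J (y, x)) l = of_real (x (\<rho> k)) * B (\<rho> k) (\<rho> l) * of_real (x (\<rho> l))"
          unfolding cvec_def rv[OF kl(1)] rv[OF kl(2)] B_def \<kappa>\<rho> nn[symmetric] by simp
      qed
      also have "\<dots> = (\<Sum>e\<in>J. \<Sum>f\<in>J. of_real (x e) * B e f * of_real (x f))"
        unfolding J_def by (simp add: sum.reindex[OF inj])
      finally show ?thesis .
    qed
    have mt: "minor_tr j (merge L J (y, x)) = (\<Sum>e\<in>J. B e e)" for x
      unfolding minor_tr_def mr by (simp add: J_def sum.reindex[OF inj] B_def \<kappa>\<rho> sum_divide_distrib)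
    have "(\<integral>\<^sup>+x. ?f (merge L J (y, x)) \<partial>Pi\<^sub>M J \<mu>) \<le> ennreal ((2 * K + 8) * (\<Sum>e\<in>J. \<Sum>f\<in>J. (cmod (B e f))\<^sup>2))"
      unfolding rf mt
    proof (rule quadratic_form_variance[OF J(1) prob sets])
      fix e assume e: "e \<in> J"
      show "(\<integral>t. t \<partial>\<mu> e) = 0" using off[OF e] mean by auto
      show "(\<integral>\<^sup>+t. ennreal (t\<^sup>2) \<partial>\<mu> e) = 1" using off[OF e] var by auto
      show "(\<integral>\<^sup>+t. ennreal (t ^ 4) \<partial>\<mu> e) \<le> ennreal K" using moment[of e 4] Jsub e by auto
    qed (use K in simp)
    also have "\<dots> \<le> ennreal ((2 * K + 8) / real n)"
    proof (rule ennreal_leI)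
      have "(\<Sum>e\<in>J. \<Sum>f\<in>J. (cmod (B e f))\<^sup>2) = (\<Sum>k\<in>?N. \<Sum>l\<in>?N. (cmod (r k l))\<^sup>2) / (real n)\<^sup>2"
        unfolding J_def by (simp add: sum.reindex[OF inj] B_def \<kappa>\<rho> norm_divide power_divide sum_divide_distrib)
      also have "(\<Sum>k\<in>?N. \<Sum>l\<in>?N. (cmod (r k l))\<^sup>2) \<le> (\<Sum>k<n. \<Sum>l<n. (cmod (r k l))\<^sup>2)"
        by (intro order.trans[OF sum_mono[OF sum_mono2] sum_mono2]) (auto intro!: sum_nonneg)
      also have "\<dots> \<le> real n" unfolding r_def by (rule sum_resolvent_sq_le[OF sym_array_model z])
      finally have "(\<Sum>e\<in>J. \<Sum>f\<in>J. (cmod (B e f))\<^sup>2) \<le> real n / (real n)\<^sup>2" by (simp add: divide_right_mono)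
      also have "\<dots> = 1 / real n" using n by (simp add: power2_eq_square)
      finally have "(2 * K + 8) * (\<Sum>e\<in>J. \<Sum>f\<in>J. (cmod (B e f))\<^sup>2) \<le> (2 * K + 8) * (1 / real n)"
        using K by (intro mult_left_mono) auto
      then show "(2 * K + 8) * (\<Sum>e\<in>J. \<Sum>f\<in>J. (cmod (B e f))\<^sup>2) \<le> (2 * K + 8) / real n" by simp
    qed
    finally show "(\<integral>\<^sup>+x. ?f (merge L J (y, x)) \<partial>Pi\<^sub>M J \<mu>) \<le> ennreal ((2 * K + 8) / real n)" .
  qed
  also have "\<dots> = ennreal ((2 * K + 8) / real n)"
  proof -
    have "prob_space (Pi\<^sub>M L \<mu>)" by (rule prob_space_PiM) (rule prob)
    then show ?thesis by (simp add: prob_space.emeasure_space_1)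
  qed
  finally show ?thesis .
qed

text \<open>Four replacements, each with an error O(n^(-1/2)) in mean: the form by the trace of the
  minor, then index j is put back, then the deleted row, and finally the trace is replaced by its
  mean.\<close>

lemma row_form_approx:
  assumes j: "j < n"
  shows "(\<integral>\<^sup>+x. ennreal (cmod (row_form p q n j x z - mean_tr)) \<partial>P) \<le>
    ennreal (((2 * K + 9) / 2 + 1 + 2 * (\<bar>p\<bar> + \<bar>q\<bar>) * K + (1 + 4 * (\<bar>p\<bar> + \<bar>q\<bar>)\<^sup>2 * K) / 2) / sqrt (real n))"
proof -
  interpret prob_space P by (rule prob_P)
  let ?s = "sqrt (real n)"
  note [measurable] = measurable_minor_tr[OF j] measurable_row_form[OF j]
  let ?A = "\<lambda>x. row_form p q n j x z - minor_tr j x" and ?B = "\<lambda>x. tr (drop_row j x) - tr x" and ?D = "\<lambda>x. tr x - mean_tr"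
  have "(\<integral>\<^sup>+x. ennreal (cmod (row_form p q n j x z - mean_tr)) \<partial>P) \<le>
      (\<integral>\<^sup>+x. ennreal (cmod (?A x)) + (ennreal (1 / ?s) + (ennreal (cmod (?B x)) + ennreal (cmod (?D x)))) \<partial>P)"
  proof (rule nn_integral_mono)
    fix x
    have "row_form p q n j x z - mean_tr = ?A x + ((minor_tr j x - tr (drop_row j x)) + (?B x + ?D x))" by simp
    then have "cmod (row_form p q n j x z - mean_tr) \<le> cmod (?A x) + (cmod (minor_tr j x - tr (drop_row j x)) + (cmod (?B x) + cmod (?D x)))"
      by (metis add_left_mono norm_triangle_le order_refl norm_triangle_ineq)
    also have "\<dots> \<le> cmod (?A x) + (1 / ?s + (cmod (?B x) + cmod (?D x)))"
      using minor_tr_diff[OF j, of x] by simp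
    finally have "ennreal (cmod (row_form p q n j x z - mean_tr)) \<le> ennreal (cmod (?A x) + (1 / ?s + (cmod (?B x) + cmod (?D x))))"
      by (rule ennreal_leI)
    then show "ennreal (cmod (row_form p q n j x z - mean_tr)) \<le> ennreal (cmod (?A x)) + (ennreal (1 / ?s) + (ennreal (cmod (?B x)) + ennreal (cmod (?D x))))"
      by (simp add: ennreal_plus)
  qed
  also have "\<dots> = (\<integral>\<^sup>+x. ennreal (cmod (?A x)) \<partial>P) + (ennreal (1 / ?s) + ((\<integral>\<^sup>+x. ennreal (cmod (?B x)) \<partial>P) + (\<integral>\<^sup>+x. ennreal (cmod (?D x)) \<partial>P)))"
    by (subst nn_integral_add, measurable)+ (simp add: emeasure_space_1)
  also have "\<dots> \<le> ennreal ((1 + (2 * K + 8)) / (2 * ?s)) + (ennreal (1 / ?s) + (ennreal (2 * (\<bar>p\<bar> + \<bar>q\<bar>) * K / ?s) + ennreal ((1 + 4 * (\<bar>p\<bar> + \<bar>q\<bar>)\<^sup>2 * K) / (2 * ?s))))"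
    using K n row_form_variance[OF j] variance_tr drop_row_tr_diff[OF j]
    by (intro add_mono order_refl nn_integral_abs_le_of_square) auto
  also have "\<dots> = ennreal ((1 + (2 * K + 8)) / (2 * ?s) + (1 / ?s + (2 * (\<bar>p\<bar> + \<bar>q\<bar>) * K / ?s + (1 + 4 * (\<bar>p\<bar> + \<bar>q\<bar>)\<^sup>2 * K) / (2 * ?s))))"
    using K by (simp add: ennreal_plus)
  also have "(1 + (2 * K + 8)) / (2 * ?s) + (1 / ?s + (2 * (\<bar>p\<bar> + \<bar>q\<bar>) * K / ?s + (1 + 4 * (\<bar>p\<bar> + \<bar>q\<bar>)\<^sup>2 * K) / (2 * ?s))) =
      ((2 * K + 9) / 2 + 1 + 2 * (\<bar>p\<bar> + \<bar>q\<bar>) * K + (1 + 4 * (\<bar>p\<bar> + \<bar>q\<bar>)\<^sup>2 * K) / 2) / ?s"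
    by (simp add: add_divide_distrib)
  finally show ?thesis .
qed

text \<open>The row contributes n terms with expectation at most K n^(-l/2), so the bound for the
  fourth powers is smaller than that for the squares by a factor n. This is what makes
  \<open>cross\<close> small.\<close>

lemma row_vec_moments:
  assumes j: "j < n"
  shows "(\<integral>\<^sup>+x. ennreal (\<Sum>k<n. (row_vec n j x k)\<^sup>2) \<partial>P) \<le> ennreal K"
    and "(\<integral>\<^sup>+x. ennreal (\<Sum>k<n. (row_vec n j x k) ^ 4) \<partial>P) \<le> ennreal (K / real n)"
proof -
  have *: "(\<integral>\<^sup>+x. ennreal (\<Sum>k<n. (row_vec n j x k) ^ l) \<partial>P) \<le> ennreal (real n * (K / (sqrt (real n)) ^ l))"
    if l: "l \<in> {2, 4}" for l
  proof -
    have ev: "even l" using l by auto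
    have pos: "0 \<le> (row_vec n j x k) ^ l" for x k using ev by (simp add: zero_le_even_power)
    have "(\<integral>\<^sup>+x. ennreal (\<Sum>k<n. (row_vec n j x k) ^ l) \<partial>P) \<le> (\<integral>\<^sup>+x. (\<Sum>k<n. ennreal (1 / (sqrt (real n)) ^ l) * ennreal (\<bar>entry x j k\<bar> ^ l)) \<partial>P)"
    proof (rule nn_integral_mono)
      fix x
      have "(row_vec n j x k) ^ l \<le> 1 / (sqrt (real n)) ^ l * \<bar>entry x j k\<bar> ^ l" for k
        using ev l by (auto simp: row_vec_def power_divide power_even_abs)
      then have "ennreal ((row_vec n j x k) ^ l) \<le> ennreal (1 / (sqrt (real n)) ^ l) * ennreal (\<bar>entry x j k\<bar> ^ l)" for k
        by (subst ennreal_mult[symmetric]) (auto intro: ennreal_leI)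
      then show "ennreal (\<Sum>k<n. (row_vec n j x k) ^ l) \<le> (\<Sum>k<n. ennreal (1 / (sqrt (real n)) ^ l) * ennreal (\<bar>entry x j k\<bar> ^ l))"
        by (subst sum_ennreal[symmetric]) (auto intro: sum_mono pos)
    qed
    also have "\<dots> = (\<Sum>k<n. ennreal (1 / (sqrt (real n)) ^ l) * (\<integral>\<^sup>+x. ennreal (\<bar>entry x j k\<bar> ^ l) \<partial>P))"
    proof -
      have m: "(\<lambda>x. ennreal (\<bar>entry x j k\<bar> ^ l)) \<in> borel_measurable P" if "k < n" for k
        using measurable_entry[OF j that] by measurable
      have "(\<integral>\<^sup>+x. (\<Sum>k<n. ennreal (1 / (sqrt (real n)) ^ l) * ennreal (\<bar>entry x j k\<bar> ^ l)) \<partial>P) = (\<Sum>k<n. \<integral>\<^sup>+x. ennreal (1 / (sqrt (real n)) ^ l) * ennreal (\<bar>entry x j k\<bar> ^ l) \<partial>P)"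
        by (intro nn_integral_sum borel_measurable_times_ennreal borel_measurable_const m) auto
      also have "\<dots> = (\<Sum>k<n. ennreal (1 / (sqrt (real n)) ^ l) * (\<integral>\<^sup>+x. ennreal (\<bar>entry x j k\<bar> ^ l) \<partial>P))"
        by (intro sum.cong refl nn_integral_cmult m) auto
      finally show ?thesis .
    qed
    also have "\<dots> \<le> (\<Sum>k<n. ennreal (1 / (sqrt (real n)) ^ l) * ennreal K)"
      using l by (intro sum_mono mult_left_mono entry_moment j) auto
    also have "\<dots> = (\<Sum>k<n. ennreal (K / (sqrt (real n)) ^ l))"
      using K by (intro sum.cong refl, subst ennreal_mult[symmetric]) auto
    also have "\<dots> = ennreal (\<Sum>k<n. K / (sqrt (real n)) ^ l)"
      using K by (intro sum_ennreal) auto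
    finally show ?thesis by simp
  qed
  show "(\<integral>\<^sup>+x. ennreal (\<Sum>k<n. (row_vec n j x k)\<^sup>2) \<partial>P) \<le> ennreal K"
    using *[of 2] n by simp
  have "sqrt (real n) ^ 4 = ((sqrt (real n))\<^sup>2)\<^sup>2" by (simp only: power_mult[symmetric]) simp
  also have "\<dots> = (real n)\<^sup>2" by simp
  finally have "real n * (K / sqrt (real n) ^ 4) = K / real n" using n by (simp add: power2_eq_square)
  then show "(\<integral>\<^sup>+x. ennreal (\<Sum>k<n. (row_vec n j x k) ^ 4) \<partial>P) \<le> ennreal (K / real n)"
    using *[of 4] by simp
qed

end

context wigner_product
begin

text \<open>With the weights \<epsilon> = n^(-1/4) and \<delta> = n^(-1/2) the three parts of the
  bound on \<open>cross\<close>, of sizes \<epsilon>, \<delta> / \<epsilon> and 1 / (n \<delta>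
  \<epsilon>), balance at \<eta> = n^(-1/4). The other errors are O(n^(-1/2)).\<close>

lemma full_res_approx:
  assumes j: "j < n"
  defines "\<eta> \<equiv> real n powr (- (1 / 4))"
  shows "(\<integral>\<^sup>+x. ennreal (cmod (full_res p q n x z j j - 1 / (z - of_real (p\<^sup>2) * mean_tr - of_real (q * row_total n j x)))) \<partial>P) \<le>
    ennreal ((p\<^sup>2 * ((2 * K + 9) / 2 + 1 + 2 * (\<bar>p\<bar> + \<bar>q\<bar>) * K + (1 + 4 * (\<bar>p\<bar> + \<bar>q\<bar>)\<^sup>2 * K) / 2) + \<bar>p + q\<bar> * K
      + \<bar>p * q\<bar> * (3 * K + 1) / 4) * \<eta>)"
proof -
  interpret prob_space P by (rule prob_P)
  let ?s = "sqrt (real n)"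
  let ?a = "(2 * K + 9) / 2 + 1 + 2 * (\<bar>p\<bar> + \<bar>q\<bar>) * K + (1 + 4 * (\<bar>p\<bar> + \<bar>q\<bar>)\<^sup>2 * K) / 2"
  have a0: "0 \<le> ?a" using K by (intro add_nonneg_nonneg) auto
  have \<eta>0: "0 < \<eta>" unfolding \<eta>_def using n by simp
  have "\<eta> * \<eta> = real n powr (- (1 / 4) + - (1 / 4))" unfolding \<eta>_def by (rule powr_add[symmetric])
  also have "\<dots> = 1 / real n powr (1 / 2)" by (simp add: powr_minus_divide)
  also have "\<dots> = 1 / ?s" by (simp add: powr_half_sqrt)
  finally have \<eta>2: "1 / ?s = \<eta> * \<eta>" by simp
  have "real n powr (- (1 / 4)) \<le> real n powr 0" using n by (intro powr_mono) auto
  then have \<eta>1: "\<eta> \<le> 1" unfolding \<eta>_def using n by simp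
  have \<eta>\<eta>: "1 / ?s \<le> \<eta>" unfolding \<eta>2 using \<eta>0 \<eta>1 by (simp add: mult_left_le)
  let ?V = "\<lambda>x. \<Sum>k<n. (row_vec n j x k)\<^sup>2" and ?V4 = "\<lambda>x. \<Sum>k<n. (row_vec n j x k) ^ 4"
  have V0: "0 \<le> ?V x" "0 \<le> ?V4 x" for x by (auto intro!: sum_nonneg simp: zero_le_even_power)
  have [measurable]: "?V \<in> borel_measurable P" "?V4 \<in> borel_measurable P"
    using measurable_row_vec[OF j] by (auto intro!: borel_measurable_sum borel_measurable_power)
  note [measurable] = measurable_row_form[OF j]
  have [measurable]: "(\<lambda>x. entry x j j) \<in> borel_measurable P" by (rule measurable_entry[OF j j])
  let ?F = "\<lambda>x. cmod (row_form p q n j x z - mean_tr)"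
  have lin: "(\<integral>\<^sup>+x. c\<^sub>1 * f\<^sub>1 x + (c\<^sub>2 * f\<^sub>2 x + (c\<^sub>3 * f\<^sub>3 x + (c\<^sub>4 + c\<^sub>5 * f\<^sub>4 x))) \<partial>P) =
      c\<^sub>1 * (\<integral>\<^sup>+x. f\<^sub>1 x \<partial>P) + (c\<^sub>2 * (\<integral>\<^sup>+x. f\<^sub>2 x \<partial>P) + (c\<^sub>3 * (\<integral>\<^sup>+x. f\<^sub>3 x \<partial>P) + (c\<^sub>4 + c\<^sub>5 * (\<integral>\<^sup>+x. f\<^sub>4 x \<partial>P))))"
    if "f\<^sub>1 \<in> borel_measurable P" "f\<^sub>2 \<in> borel_measurable P" "f\<^sub>3 \<in> borel_measurable P" "f\<^sub>4 \<in> borel_measurable P"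
    for c\<^sub>1 c\<^sub>2 c\<^sub>3 c\<^sub>4 c\<^sub>5 :: ennreal and f\<^sub>1 f\<^sub>2 f\<^sub>3 f\<^sub>4
    using that by (simp add: nn_integral_add nn_integral_cmult emeasure_space_1)
  have "(\<integral>\<^sup>+x. ennreal (cmod (full_res p q n x z j j - 1 / (z - of_real (p\<^sup>2) * mean_tr - of_real (q * row_total n j x)))) \<partial>P) \<le>
      (\<integral>\<^sup>+x. ennreal (p\<^sup>2) * ennreal (?F x) + (ennreal (\<bar>p + q\<bar> / ?s) * ennreal (\<bar>entry x j j\<bar> ^ 1) +
        (ennreal (\<bar>p * q\<bar> * \<eta> / 2) * ennreal (?V x) + (ennreal (\<bar>p * q\<bar> * \<eta> / 4) + ennreal (\<bar>p * q\<bar> * ?s / (4 * \<eta>)) * ennreal (?V4 x)))) \<partial>P)"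
  proof (rule nn_integral_mono)
    fix x
    have "\<bar>p * q\<bar> * ((\<eta> * ?V x + ((1 / ?s + ?V4 x / (1 / ?s)) / 2) / \<eta>) / 2) =
        \<bar>p * q\<bar> * \<eta> / 2 * ?V x + (\<bar>p * q\<bar> * ((1 / ?s) / \<eta>) / 4 + \<bar>p * q\<bar> * ?s / (4 * \<eta>) * ?V4 x)"
      using \<eta>0 n by (simp add: field_simps)
    also have "(1 / ?s) / \<eta> = \<eta>" unfolding \<eta>2 using \<eta>0 by simp
    finally have e: "\<bar>p * q\<bar> * ((\<eta> * ?V x + ((1 / ?s + ?V4 x / (1 / ?s)) / 2) / \<eta>) / 2) =
        \<bar>p * q\<bar> * \<eta> / 2 * ?V x + (\<bar>p * q\<bar> * \<eta> / 4 + \<bar>p * q\<bar> * ?s / (4 * \<eta>) * ?V4 x)" .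
    have "cmod (full_res p q n x z j j - 1 / (z - of_real (p\<^sup>2) * mean_tr - of_real (q * row_total n j x))) \<le>
        p\<^sup>2 * ?F x + \<bar>p + q\<bar> * \<bar>x (j, j)\<bar> / ?s + \<bar>p * q\<bar> * ((\<eta> * ?V x + ((1 / ?s + ?V4 x / (1 / ?s)) / 2) / \<eta>) / 2)"
      using n by (intro resolvent_diag_approx[OF j z Im_mean_tr \<eta>0]) simp
    also have "\<dots> = p\<^sup>2 * ?F x + (\<bar>p + q\<bar> / ?s * \<bar>entry x j j\<bar> ^ 1 +
        (\<bar>p * q\<bar> * \<eta> / 2 * ?V x + (\<bar>p * q\<bar> * \<eta> / 4 + \<bar>p * q\<bar> * ?s / (4 * \<eta>) * ?V4 x)))"
      unfolding e by (simp add: entry_def)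
    finally have "ennreal (cmod (full_res p q n x z j j - 1 / (z - of_real (p\<^sup>2) * mean_tr - of_real (q * row_total n j x)))) \<le>
      ennreal (p\<^sup>2 * ?F x + (\<bar>p + q\<bar> / ?s * \<bar>entry x j j\<bar> ^ 1 +
        (\<bar>p * q\<bar> * \<eta> / 2 * ?V x + (\<bar>p * q\<bar> * \<eta> / 4 + \<bar>p * q\<bar> * ?s / (4 * \<eta>) * ?V4 x))))"
      by (rule ennreal_leI)
    also have "\<dots> = ennreal (p\<^sup>2 * ?F x) + (ennreal (\<bar>p + q\<bar> / ?s * \<bar>entry x j j\<bar> ^ 1) +
        (ennreal (\<bar>p * q\<bar> * \<eta> / 2 * ?V x) + (ennreal (\<bar>p * q\<bar> * \<eta> / 4) + ennreal (\<bar>p * q\<bar> * ?s / (4 * \<eta>) * ?V4 x))))"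
    proof -
      have nn: "0 \<le> p\<^sup>2 * ?F x" "0 \<le> \<bar>p + q\<bar> / ?s * \<bar>entry x j j\<bar> ^ 1" "0 \<le> \<bar>p * q\<bar> * \<eta> / 2 * ?V x"
        "0 \<le> \<bar>p * q\<bar> * \<eta> / 4" "0 \<le> \<bar>p * q\<bar> * ?s / (4 * \<eta>) * ?V4 x"
        using V0[of x] \<eta>0 by (auto intro!: mult_nonneg_nonneg divide_nonneg_nonneg)
      show ?thesis
        using nn by (simp only: ennreal_plus add_nonneg_nonneg)
    qed
    also have "\<dots> = ennreal (p\<^sup>2) * ennreal (?F x) + (ennreal (\<bar>p + q\<bar> / ?s) * ennreal (\<bar>entry x j j\<bar> ^ 1) +
        (ennreal (\<bar>p * q\<bar> * \<eta> / 2) * ennreal (?V x) + (ennreal (\<bar>p * q\<bar> * \<eta> / 4) + ennreal (\<bar>p * q\<bar> * ?s / (4 * \<eta>)) * ennreal (?V4 x))))"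
      using V0[of x] \<eta>0 by (intro arg_cong2[of _ _ _ _ "(+)"] ennreal_mult refl) (auto intro!: mult_nonneg_nonneg divide_nonneg_nonneg)
    finally show "ennreal (cmod (full_res p q n x z j j - 1 / (z - of_real (p\<^sup>2) * mean_tr - of_real (q * row_total n j x)))) \<le> \<dots>" .
  qed
  also have "\<dots> = ennreal (p\<^sup>2) * (\<integral>\<^sup>+x. ennreal (?F x) \<partial>P) + (ennreal (\<bar>p + q\<bar> / ?s) * (\<integral>\<^sup>+x. ennreal (\<bar>entry x j j\<bar> ^ 1) \<partial>P) +
        (ennreal (\<bar>p * q\<bar> * \<eta> / 2) * (\<integral>\<^sup>+x. ennreal (?V x) \<partial>P) + (ennreal (\<bar>p * q\<bar> * \<eta> / 4) + ennreal (\<bar>p * q\<bar> * ?s / (4 * \<eta>)) * (\<integral>\<^sup>+x. ennreal (?V4 x) \<partial>P))))"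
    by (rule lin) measurable
  also have "\<dots> \<le> ennreal (p\<^sup>2) * ennreal (?a / ?s) + (ennreal (\<bar>p + q\<bar> / ?s) * ennreal K +
        (ennreal (\<bar>p * q\<bar> * \<eta> / 2) * ennreal K + (ennreal (\<bar>p * q\<bar> * \<eta> / 4) + ennreal (\<bar>p * q\<bar> * ?s / (4 * \<eta>)) * ennreal (K / real n))))"
    by (intro add_mono mult_left_mono order_refl row_form_approx j entry_moment row_vec_moments) auto
  also have "\<dots> = ennreal (p\<^sup>2 * (?a / ?s) + (\<bar>p + q\<bar> / ?s * K + (\<bar>p * q\<bar> * \<eta> / 2 * K + (\<bar>p * q\<bar> * \<eta> / 4 + \<bar>p * q\<bar> * ?s / (4 * \<eta>) * (K / real n)))))"
  proof -
    have nn: "0 \<le> p\<^sup>2 * (?a / ?s)" "0 \<le> \<bar>p + q\<bar> / ?s * K" "0 \<le> \<bar>p * q\<bar> * \<eta> / 2 * K"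
        "0 \<le> \<bar>p * q\<bar> * \<eta> / 4" "0 \<le> \<bar>p * q\<bar> * ?s / (4 * \<eta>) * (K / real n)"
      using a0 \<eta>0 K by (auto intro!: mult_nonneg_nonneg divide_nonneg_nonneg)
    have mm: "ennreal (p\<^sup>2 * (?a / ?s)) = ennreal (p\<^sup>2) * ennreal (?a / ?s)" "ennreal (\<bar>p + q\<bar> / ?s * K) = ennreal (\<bar>p + q\<bar> / ?s) * ennreal K"
      "ennreal (\<bar>p * q\<bar> * \<eta> / 2 * K) = ennreal (\<bar>p * q\<bar> * \<eta> / 2) * ennreal K"
      "ennreal (\<bar>p * q\<bar> * ?s / (4 * \<eta>) * (K / real n)) = ennreal (\<bar>p * q\<bar> * ?s / (4 * \<eta>)) * ennreal (K / real n)"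
      using a0 \<eta>0 K by (intro ennreal_mult; auto intro!: mult_nonneg_nonneg divide_nonneg_nonneg)+
    show ?thesis unfolding mm[symmetric] using nn by (simp only: ennreal_plus add_nonneg_nonneg)
  qed
  also have "\<dots> \<le> ennreal ((p\<^sup>2 * ?a + \<bar>p + q\<bar> * K + \<bar>p * q\<bar> * (3 * K + 1) / 4) * \<eta>)"
  proof (rule ennreal_leI)
    have "p\<^sup>2 * (?a / ?s) \<le> p\<^sup>2 * ?a * \<eta>"
      using mult_left_mono[OF \<eta>\<eta>, of "p\<^sup>2 * ?a"] a0 by simp
    moreover have "\<bar>p + q\<bar> / ?s * K \<le> \<bar>p + q\<bar> * K * \<eta>"
      using mult_left_mono[OF \<eta>\<eta>, of "\<bar>p + q\<bar> * K"] K by simp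
    moreover have "\<bar>p * q\<bar> * ?s / (4 * \<eta>) * (K / real n) = \<bar>p * q\<bar> * K / 4 * \<eta>"
    proof -
      have "?s / real n = 1 / ?s" using n by (simp add: divide_simps)
      have "\<bar>p * q\<bar> * ?s / (4 * \<eta>) * (K / real n) = \<bar>p * q\<bar> * K / 4 * ((?s / real n) / \<eta>)"
        by (simp add: mult_ac)
      also have "(?s / real n) / \<eta> = \<eta>" unfolding \<open>?s / real n = 1 / ?s\<close> \<eta>2 using \<eta>0 by simp
      finally show ?thesis .
    qed
    ultimately show "p\<^sup>2 * (?a / ?s) + (\<bar>p + q\<bar> / ?s * K + (\<bar>p * q\<bar> * \<eta> / 2 * K + (\<bar>p * q\<bar> * \<eta> / 4 + \<bar>p * q\<bar> * ?s / (4 * \<eta>) * (K / real n)))) \<le>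
        (p\<^sup>2 * ?a + \<bar>p + q\<bar> * K + \<bar>p * q\<bar> * (3 * K + 1) / 4) * \<eta>"
    proof -
      assume h: "p\<^sup>2 * (?a / ?s) \<le> p\<^sup>2 * ?a * \<eta>" "\<bar>p + q\<bar> / ?s * K \<le> \<bar>p + q\<bar> * K * \<eta>" "\<bar>p * q\<bar> * ?s / (4 * \<eta>) * (K / real n) = \<bar>p * q\<bar> * K / 4 * \<eta>"
      have "(p\<^sup>2 * ?a + \<bar>p + q\<bar> * K + \<bar>p * q\<bar> * (3 * K + 1) / 4) * \<eta> =
          p\<^sup>2 * ?a * \<eta> + (\<bar>p + q\<bar> * K * \<eta> + (\<bar>p * q\<bar> * \<eta> / 2 * K + (\<bar>p * q\<bar> * \<eta> / 4 + \<bar>p * q\<bar> * K / 4 * \<eta>)))"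
        by (simp add: distrib_right distrib_left add_divide_distrib)
      then show ?thesis unfolding h(3) using h(1,2) by linarith
    qed
  qed
  finally show ?thesis .
qed

lemma prob_real_distribution: "real_distribution (\<mu> e)"
  by (intro real_distribution.intro real_distribution_axioms.intro prob sets)

text \<open>Independence turns the characteristic function into a product of n - 1 factors at t /
  sqrt n. Each is close to a Gaussian factor, and for numbers in the unit disc the difference of two
  products is at most the sum of the differences of the factors.\<close>

lemma char_row_total_approx:
  assumes j: "j < n"
  shows "cmod (char (distr P borel (row_total n j)) t - char std_normal_distribution t) \<le>
    K / sqrt (real n) * (t\<^sup>2 + \<bar>t\<bar> ^ 3 + t ^ 4)"
proof -
  interpret product_prob_space \<mu> by (rule product_prob_spaceI) (rule prob)
  let ?s = "sqrt (real n)"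
  let ?N = "{..<n} - {j}"
  let ?u = "t / ?s"
  define \<rho> where "\<rho> k = (min j k, max j k)" for k
  have inj: "inj_on \<rho> ?N" by (rule inj_onI) (auto simp: \<rho>_def min_def max_def split: if_splits)
  define J where "J = \<rho> ` ?N"
  have Jsub: "J \<subseteq> pair_index n" using j unfolding J_def \<rho>_def by (auto simp: pair_index_def)
  have J: "finite J" unfolding J_def by simp
  have cardJ: "card J = n - 1" unfolding J_def using j by (simp add: card_image[OF inj])
  have off: "\<exists>a b. e = (a, b) \<and> a < b \<and> b < n" if e: "e \<in> J" for e
  proof -
    obtain k where k: "k < n" "k \<noteq> j" "e = \<rho> k" using e unfolding J_def by (elim imageE) blast
    then have "\<rho> k = (min j k, max j k) \<and> min j k < max j k \<and> max j k < n"
      using j unfolding \<rho>_def by (auto simp: min_def max_def)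
    then show ?thesis using k(3) by blast
  qed
  have tot: "row_total n j x = (\<Sum>e\<in>J. x e) / ?s" for x
  proof -
    have "row_total n j x = row_vec n j x j + (\<Sum>k\<in>?N. row_vec n j x k)"
      unfolding row_total_def by (rule sum.remove) (use j in auto)
    also have "\<dots> = (\<Sum>k\<in>?N. x (\<rho> k) / ?s)"
      by (simp add: row_vec_def entry_def \<rho>_def)
    also have "\<dots> = (\<Sum>e\<in>J. x e) / ?s" unfolding J_def by (simp add: sum.reindex[OF inj] sum_divide_distrib)
    finally show ?thesis .
  qed
  have "char (distr P borel (row_total n j)) t = (\<integral>x. iexp (t * row_total n j x) \<partial>P)"
    unfolding char_def by (rule integral_distr) (use measurable_row_total[OF j] in auto)
  also have "\<dots> = (\<integral>x. (\<Prod>e\<in>pair_index n. if e \<in> J then iexp (?u * x e) else 1) \<partial>P)"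
  proof (rule Bochner_Integration.integral_cong[OF refl])
    fix x
    have "iexp (t * row_total n j x) = exp (\<Sum>e\<in>J. \<i> * complex_of_real (?u * x e))"
      unfolding tot by (simp add: sum_distrib_left sum_divide_distrib mult_ac)
    also have "\<dots> = (\<Prod>e\<in>J. iexp (?u * x e))" by (rule exp_sum[OF J])
    also have "\<dots> = (\<Prod>e\<in>pair_index n. if e \<in> J then iexp (?u * x e) else 1)"
      using Jsub by (simp add: prod.If_cases Int_absorb1)
    finally show "iexp (t * row_total n j x) = (\<Prod>e\<in>pair_index n. if e \<in> J then iexp (?u * x e) else 1)" .
  qed
  also have "\<dots> = (\<Prod>e\<in>pair_index n. \<integral>y. (if e \<in> J then iexp (?u * y) else 1) \<partial>\<mu> e)"
  proof (rule product_integral_prod)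
    fix e
    interpret real_distribution "\<mu> e" by (rule prob_real_distribution)
    show "integrable (\<mu> e) (\<lambda>y. if e \<in> J then iexp (?u * y) else 1)"
      by (cases "e \<in> J") (auto intro!: integrable_bounded[where B = 1])
  qed simp
  also have "\<dots> = (\<Prod>e\<in>pair_index n. if e \<in> J then char (\<mu> e) ?u else 1)"
    using prob_space.prob_space[OF prob] by (intro prod.cong refl) (simp add: char_def)
  also have "\<dots> = (\<Prod>e\<in>J. char (\<mu> e) ?u)"
    using Jsub by (simp add: prod.If_cases Int_absorb1)
  finally have ch: "char (distr P borel (row_total n j)) t = (\<Prod>e\<in>J. char (\<mu> e) ?u)" .
  \<comment> \<open>The share of one entry: the characteristic function at \<open>t\<close> of the
    centred normal law with variance 1 / n.\<close>
  let ?g = "exp (- (?u\<^sup>2 / 2))"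
  have each: "cmod (char (\<mu> e) ?u - complex_of_real ?g) \<le> K * \<bar>?u\<bar> ^ 3 + ?u ^ 4" if e: "e \<in> J" for e
  proof -
    obtain a b where ab: "e = (a, b)" "a < b" "b < n" using off[OF e] by blast
    interpret real_distribution "\<mu> e" by (rule prob_real_distribution)
    have e': "e \<in> pair_index n" using e Jsub by auto
    have v: "(\<integral>\<^sup>+x. ennreal (x\<^sup>2) \<partial>\<mu> e) = 1" using var ab by simp
    have m3: "(\<integral>\<^sup>+x. ennreal (\<bar>x\<bar> ^ 3) \<partial>\<mu> e) \<le> ennreal K" using moment[OF e', of 3] by simp
    have i2: "integrable (\<mu> e) (\<lambda>x. x\<^sup>2)" using v by (intro integrableI_nonneg) auto
    have i3: "integrable (\<mu> e) (\<lambda>x. \<bar>x\<bar> ^ 3)" using m3 by (intro integrableI_nonneg) (auto simp: le_less_trans)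
    show ?thesis
    proof (rule char_gaussian_approx[OF prob_real_distribution])
      show "(\<integral>x. x \<partial>\<mu> e) = 0" using mean ab by simp
      show "integrable (\<mu> e) (\<lambda>x. x\<^sup>2)" by (rule i2)
      show "(\<integral>x. x\<^sup>2 \<partial>\<mu> e) = 1" using v by (subst integral_eq_nn_integral) auto
      show "integrable (\<mu> e) (\<lambda>x. \<bar>x\<bar> ^ 3)" by (rule i3)
      have "ennreal (\<integral>x. \<bar>x\<bar> ^ 3 \<partial>\<mu> e) \<le> ennreal K" using m3 i3 by (subst nn_integral_eq_integral[symmetric]) auto
      then show "(\<integral>x. \<bar>x\<bar> ^ 3 \<partial>\<mu> e) \<le> K" using K by (simp add: ennreal_le_iff)
    qed
  qed
  have "cmod ((\<Prod>e\<in>J. char (\<mu> e) ?u) - (\<Prod>e\<in>J. complex_of_real ?g)) \<le> (\<Sum>e\<in>J. cmod (char (\<mu> e) ?u - complex_of_real ?g))"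
    using real_distribution.cmod_char_le_1[OF prob_real_distribution] by (intro norm_prod_diff) auto
  also have "\<dots> \<le> (\<Sum>e\<in>J. K * \<bar>?u\<bar> ^ 3 + ?u ^ 4)" by (rule sum_mono) (rule each)
  also have "\<dots> \<le> real n * (K * \<bar>?u\<bar> ^ 3 + ?u ^ 4)"
    using K by (simp add: cardJ) (intro mult_right_mono add_nonneg_nonneg; simp)
  also have "\<dots> \<le> K / ?s * (\<bar>t\<bar> ^ 3 + t ^ 4)"
  proof -
    have s4: "?s ^ 4 = real n * real n"
    proof -
      have "?s ^ 4 = (?s * ?s) * (?s * ?s)" by (simp only: power4_eq_xxxx mult.assoc)
      then show ?thesis by simp
    qed
    have s3: "?s ^ 3 = real n * ?s" by (simp add: power3_eq_cube)
    have "real n * (K * \<bar>?u\<bar> ^ 3) = K / ?s * \<bar>t\<bar> ^ 3" using n by (simp add: power_divide s3)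
    moreover have "real n * ?u ^ 4 = 1 / real n * t ^ 4" using n by (simp add: power_divide s4)
    moreover have "1 / real n * t ^ 4 \<le> K / ?s * t ^ 4"
    proof (rule mult_right_mono)
      have "?s \<le> real n" using n by (simp add: real_le_lsqrt self_le_power power2_eq_square)
      then have "1 / real n \<le> 1 / ?s" using n by (intro divide_left_mono) auto
      also have "\<dots> \<le> K / ?s" using K by (intro divide_right_mono) auto
      finally show "1 / real n \<le> K / ?s" .
    qed (simp add: zero_le_even_power)
    ultimately show ?thesis by (simp only: distrib_left) 
  qed
  finally have 1: "cmod ((\<Prod>e\<in>J. char (\<mu> e) ?u) - (\<Prod>e\<in>J. complex_of_real ?g)) \<le> K / ?s * (\<bar>t\<bar> ^ 3 + t ^ 4)" .
  have u2: "?u\<^sup>2 = t\<^sup>2 / real n" by (simp add: power_divide)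
  \<comment> \<open>The row total omits the diagonal entry, so the n - 1 Gaussian factors have total
    variance (n - 1) / n. The missing 1 / n accounts for the term t^2 in the bound.\<close>
  have "(\<Prod>e\<in>J. complex_of_real ?g) = complex_of_real (exp (- (real (n - 1) * (t\<^sup>2 / real n / 2))))"
    unfolding prod_constant cardJ u2 by (simp add: exp_of_nat_mult[symmetric] flip: of_real_power)
  moreover have "char std_normal_distribution t = complex_of_real (exp (- (t\<^sup>2 / 2)))"
    by (simp add: char_std_normal_distribution)
  ultimately have "cmod ((\<Prod>e\<in>J. complex_of_real ?g) - char std_normal_distribution t) =
      \<bar>exp (- (real (n - 1) * (t\<^sup>2 / real n / 2))) - exp (- (t\<^sup>2 / 2))\<bar>"
    by (simp only: of_real_diff[symmetric] norm_of_real)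
  also have "\<dots> \<le> t\<^sup>2 / 2 - real (n - 1) * (t\<^sup>2 / real n / 2)"
  proof (rule exp_minus_diff_le)
    have "real (n - 1) / real n * (t\<^sup>2 / 2) \<le> 1 * (t\<^sup>2 / 2)" using n by (intro mult_right_mono) auto
    then show "real (n - 1) * (t\<^sup>2 / real n / 2) \<le> t\<^sup>2 / 2" by simp
  qed simp
  also have "\<dots> = 1 / real n * (t\<^sup>2 / 2)"
    using n by (simp add: of_nat_diff field_simps)
  also have "\<dots> \<le> K / ?s * t\<^sup>2"
  proof -
    have "?s \<le> real n" using n by (simp add: real_le_lsqrt self_le_power power2_eq_square)
    then have "1 / real n \<le> 1 / ?s" using n by (intro divide_left_mono) auto
    also have "\<dots> \<le> K / ?s" using K by (intro divide_right_mono) auto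
    finally show ?thesis using K by (intro mult_mono) auto
  qed
  finally have 2: "cmod ((\<Prod>e\<in>J. complex_of_real ?g) - char std_normal_distribution t) \<le> K / ?s * t\<^sup>2" .
  have "cmod (char (distr P borel (row_total n j)) t - char std_normal_distribution t) \<le>
      K / ?s * (\<bar>t\<bar> ^ 3 + t ^ 4) + K / ?s * t\<^sup>2"
    unfolding ch using norm_triangle_le[OF add_mono[OF 1 2]] by simp
  also have "\<dots> = K / ?s * (t\<^sup>2 + \<bar>t\<bar> ^ 3 + t ^ 4)" by (simp add: distrib_left)
  finally show ?thesis .
qed

text \<open>Averages the diagonal approximation over j. Since \<open>mean_tr\<close> is a number,
  the row total is the only random quantity in 1 / (\<zeta> - q d), and its law may be exchanged for
  the normal one; all bounds are uniform in j.\<close>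

lemma mean_tr_approx_equation:
  "cmod (mean_tr - cauchy_transform (normal_distr 0 (q\<^sup>2)) (z - of_real (p\<^sup>2) * mean_tr)) \<le>
    ((p\<^sup>2 * ((2 * K + 9) / 2 + 1 + 2 * (\<bar>p\<bar> + \<bar>q\<bar>) * K + (1 + 4 * (\<bar>p\<bar> + \<bar>q\<bar>)\<^sup>2 * K) / 2) + \<bar>p + q\<bar> * K
      + \<bar>p * q\<bar> * (3 * K + 1) / 4) * real n powr (- (1 / 4)))
    + K / sqrt (real n) * (2 * q\<^sup>2 + 6 * \<bar>q\<bar> ^ 3 + 24 * q ^ 4)"
  (is "cmod (mean_tr - ?G) \<le> ?e1 + ?e2")
proof -
  interpret prob_space P by (rule prob_P)
  let ?\<zeta> = "z - of_real (p\<^sup>2) * mean_tr"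
  have "p\<^sup>2 * Im mean_tr \<le> 0" using Im_mean_tr by (intro mult_nonneg_nonpos) auto
  then have \<zeta>: "1 \<le> Im ?\<zeta>" using z by simp
  have e1: "0 \<le> ?e1" using K by (intro mult_nonneg_nonneg add_nonneg_nonneg divide_nonneg_nonneg) auto
  have ki: "cmod (1 / (?\<zeta> - of_real r)) \<le> 1" for r
    using norm_inverse_diff_le[of 1 ?\<zeta> r] \<zeta> by simp
  have row: "cmod ((\<integral>x. full_res p q n x z j j \<partial>P) - ?G) \<le> ?e1 + ?e2" if j: "j < n" for j
  proof -
    let ?k = "\<lambda>x. 1 / (?\<zeta> - of_real (q * row_total n j x))"
    note [measurable] = measurable_row_total[OF j] measurable_full_res[OF j]
    have ir: "integrable P (\<lambda>x. full_res p q n x z j j)"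
      unfolding full_res_def
      by (intro integrable_const_bound[where B = 1] AE_I2 norm_resolvent_le_1 sym_array_model z j)
        (use measurable_full_res[OF j] in \<open>simp add: full_res_def\<close>)
    have ik: "integrable P ?k"
      by (intro integrable_const_bound[where B = 1] AE_I2 ki) measurable
    have "ennreal (cmod ((\<integral>x. full_res p q n x z j j \<partial>P) - (\<integral>x. ?k x \<partial>P))) = ennreal (cmod (\<integral>x. full_res p q n x z j j - ?k x \<partial>P))"
      using ir ik by simp
    also have "\<dots> \<le> (\<integral>\<^sup>+x. ennreal (cmod (full_res p q n x z j j - ?k x)) \<partial>P)"
      using ir ik by (intro integral_norm_bound_ennreal) auto
    also have "\<dots> \<le> ennreal ?e1" by (rule full_res_approx[OF j])
    finally have 1: "cmod ((\<integral>x. full_res p q n x z j j \<partial>P) - (\<integral>x. ?k x \<partial>P)) \<le> ?e1"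
      using e1 by (simp add: ennreal_le_iff)
    have "(\<integral>x. ?k x \<partial>P) = (\<integral>y. 1 / (?\<zeta> - complex_of_real (q * y)) \<partial>distr P borel (row_total n j))"
      by (subst integral_distr) auto
    moreover have "cmod ((\<integral>y. 1 / (?\<zeta> - complex_of_real (q * y)) \<partial>distr P borel (row_total n j)) -
        (\<integral>y. 1 / (?\<zeta> - complex_of_real (q * y)) \<partial>std_normal_distribution)) \<le> ?e2"
      using K by (intro cauchy_kernel_diff_le_char real_distribution_distr real_dist_normal_dist \<zeta> char_row_total_approx j) auto
    ultimately have 2: "cmod ((\<integral>x. ?k x \<partial>P) - ?G) \<le> ?e2"
      by (simp only: cauchy_transform_normal_distr)
    show ?thesis using norm_triangle_le[OF add_mono[OF 1 2]] by simp
  qed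
  have "mean_tr = (\<Sum>j<n. \<integral>x. full_res p q n x z j j \<partial>P) / of_nat n"
  proof -
    have "integrable P (\<lambda>x. full_res p q n x z j j)" if j: "j < n" for j
      unfolding full_res_def
      by (intro integrable_const_bound[where B = 1] AE_I2 norm_resolvent_le_1 sym_array_model z j)
        (use measurable_full_res[OF j] in \<open>simp add: full_res_def\<close>)
    then show ?thesis
      unfolding mean_tr_def norm_trace_def full_res_def[symmetric]
      by (subst integral_divide_zero, subst Bochner_Integration.integral_sum) auto
  qed
  then have "mean_tr - ?G = (\<Sum>j<n. (\<integral>x. full_res p q n x z j j \<partial>P) - ?G) / of_nat n"
    using n by (simp add: sum_subtractf diff_divide_distrib)
  then have "cmod (mean_tr - ?G) = cmod (\<Sum>j<n. (\<integral>x. full_res p q n x z j j \<partial>P) - ?G) / real n"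
    by (simp add: norm_divide)
  also have "\<dots> \<le> (\<Sum>j<n. ?e1 + ?e2) / real n"
    by (intro divide_right_mono order.trans[OF norm_sum] sum_mono row) auto
  also have "\<dots> = ?e1 + ?e2" using n by simp
  finally show ?thesis .
qed

end

section \<open>The limit\<close>

text \<open>Rules for the bind apply once the kernel is measurable. That reduces to distribution
  functions, as half lines generate the Borel sets and are stable under intersection; and by
  Stieltjes inversion these are limits of integrals of the normalised trace, which is jointly
  measurable.\<close>

lemma expected_esd_properties:
  assumes "prob_space \<Omega>" and n: "0 < n"
    and A: "\<And>\<omega>. \<omega> \<in> space \<Omega> \<Longrightarrow> A \<omega> \<in> carrier_mat n n \<and> transpose_mat (A \<omega>) = A \<omega>"
    and meas: "\<And>i j. i < n \<Longrightarrow> j < n \<Longrightarrow> (\<lambda>\<omega>. A \<omega> $$ (i, j)) \<in> borel_measurable \<Omega>"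
  shows "real_distribution (expected_esd \<Omega> A)"
    and "0 < Im z \<Longrightarrow> cauchy_transform (expected_esd \<Omega> A) z = (\<integral>\<omega>. norm_trace n (\<lambda>i j. A \<omega> $$ (i, j)) z \<partial>\<Omega>)"
proof -
  interpret prob_space \<Omega> by fact
  let ?a = "\<lambda>\<omega> i j. A \<omega> $$ (i, j)"
  have ct: "cauchy_transform (esd (A \<omega>)) z = norm_trace n (?a \<omega>) z" if "\<omega> \<in> space \<Omega>" "0 < Im z" for \<omega> z
    using A[OF that(1)] n that(2) by (intro cauchy_transform_esd) auto
  have approx: "stieltjes_approx (cauchy_transform (esd (A \<omega>))) b m = stieltjes_approx (norm_trace n (?a \<omega>)) b m"
    if "\<omega> \<in> space \<Omega>" for \<omega> b m
    unfolding stieltjes_approx_def using ct[OF that] by (simp del: of_nat_Suc)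
  have cdf_meas: "(\<lambda>\<omega>. cdf (esd (A \<omega>)) b) \<in> borel_measurable \<Omega>" for b
  proof (rule borel_measurable_LIMSEQ_real)
    show "(\<lambda>m. stieltjes_approx (norm_trace n (?a \<omega>)) b m) \<longlonglongrightarrow> cdf (esd (A \<omega>)) b" if "\<omega> \<in> space \<Omega>" for \<omega>
    proof -
      have "stieltjes_approx (cauchy_transform (esd (A \<omega>))) b = stieltjes_approx (norm_trace n (?a \<omega>)) b"
        by (rule ext) (rule approx[OF that])
      then show ?thesis
        using real_distribution.stieltjes_inversion[OF real_distribution_esd[of "A \<omega>"], of b] by simp
    qed
    fix m
    define c where "c = 1 / (real (Suc m))\<^sup>2"
    define S where "S = {- real (Suc m)..b + 1 / real (Suc m)}"
    have S: "S \<in> sets borel" unfolding S_def by simp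
    have "(\<lambda>(\<omega>, x). norm_trace n (?a \<omega>) (Complex x c)) \<in> borel_measurable (\<Omega> \<Otimes>\<^sub>M lborel)"
      unfolding split_beta' Complex_eq
    proof (rule borel_measurable_norm_trace)
      show "(\<lambda>p. ?a (fst p) i j) \<in> borel_measurable (\<Omega> \<Otimes>\<^sub>M lborel)" if "i < n" "j < n" for i j
        using measurable_compose[OF measurable_fst meas[OF that]] .
    qed measurable
    then have "(\<lambda>(\<omega>, x). indicator S x *\<^sub>R (- Im (norm_trace n (?a \<omega>) (Complex x c)))) \<in> borel_measurable (\<Omega> \<Otimes>\<^sub>M lborel)"
      unfolding split_beta' using S by measurable
    then show "(\<lambda>\<omega>. stieltjes_approx (norm_trace n (?a \<omega>)) b m) \<in> borel_measurable \<Omega>"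
      unfolding stieltjes_approx_def c_def[symmetric] S_def[symmetric]
      by (intro borel_measurable_divide borel_measurable_const sigma_finite_measure.borel_measurable_lebesgue_integral[OF sigma_finite_lborel])
  qed
  have kernel: "(\<lambda>\<omega>. esd (A \<omega>)) \<in> measurable \<Omega> (prob_algebra borel)"
  proof (rule measurable_prob_algebra_generated[where \<Omega> = UNIV and G = "range (\<lambda>b. {..b})"])
    show "sets borel = sigma_sets UNIV (range (\<lambda>b::real. {..b}))" by (subst borel_eq_atMost) simp
    show "Int_stable (range (\<lambda>b::real. {..b}))" by (auto simp: Int_stable_def)
    fix \<omega>
    interpret E: real_distribution "esd (A \<omega>)" by (rule real_distribution_esd)
    show "prob_space (esd (A \<omega>))" by unfold_locales
    show "sets (esd (A \<omega>)) = sets borel" by simp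
  next
    fix B :: "real set" assume "B \<in> range (\<lambda>b. {..b})"
    then obtain b where B: "B = {..b}" by auto
    have "emeasure (esd (A \<omega>)) B = ennreal (cdf (esd (A \<omega>)) b)" for \<omega>
    proof -
      interpret E: real_distribution "esd (A \<omega>)" by (rule real_distribution_esd)
      show ?thesis unfolding B cdf_def by (rule E.emeasure_eq_measure)
    qed
    then show "(\<lambda>\<omega>. emeasure (esd (A \<omega>)) B) \<in> borel_measurable \<Omega>" using cdf_meas[of b] by simp
  qed simp
  note sub = measurable_prob_algebraD[OF kernel]
  have pb: "prob_space (expected_esd \<Omega> A)"
    unfolding expected_esd_def
  proof (rule prob_space_bind[OF _ sub], rule AE_I2)
    fix \<omega>
    interpret E: real_distribution "esd (A \<omega>)" by (rule real_distribution_esd)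
    show "prob_space (esd (A \<omega>))" by unfold_locales
  qed
  have sets: "sets (expected_esd \<Omega> A) = sets borel"
    unfolding expected_esd_def
    by (rule sets_bind) (auto simp: not_empty real_distribution.events_eq_borel[OF real_distribution_esd])
  show rd: "real_distribution (expected_esd \<Omega> A)"
    using pb sets by (intro real_distribution.intro real_distribution_axioms.intro)
  show "cauchy_transform (expected_esd \<Omega> A) z = (\<integral>\<omega>. norm_trace n (?a \<omega>) z \<partial>\<Omega>)" if z: "0 < Im z"
  proof -
    interpret E: real_distribution "expected_esd \<Omega> A" by (rule rd)
    let ?k = "\<lambda>t. 1 / (z - complex_of_real t)"
    have tm: "(\<lambda>\<omega>. norm_trace n (?a \<omega>) z) \<in> borel_measurable \<Omega>"
      by (intro borel_measurable_norm_trace meas borel_measurable_const)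
    have bnd: "cmod (norm_trace n (?a \<omega>) z) \<le> 1 / Im z" if "\<omega> \<in> space \<Omega>" for \<omega>
      using real_distribution.norm_cauchy_transform_le[OF real_distribution_esd z order_refl] ct[OF that z] by metis
    have int: "integrable \<Omega> (\<lambda>\<omega>. norm_trace n (?a \<omega>) z)"
      using bnd tm by (intro integrable_const_bound[where B = "1 / Im z"] AE_I2)
    \<comment> \<open>The integral rule for a bind is used for bounded real functions;
      \<open>h\<close> stands for the real and for the imaginary part.\<close>
    have bind: "(\<integral>t. h (?k t) \<partial>expected_esd \<Omega> A) = (\<integral>\<omega>. (\<integral>t. h (?k t) \<partial>esd (A \<omega>)) \<partial>\<Omega>)"
      if h: "h \<in> borel_measurable borel" "\<And>w. \<bar>h w\<bar> \<le> cmod w" for h :: "complex \<Rightarrow> real"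
      unfolding expected_esd_def
    proof (rule integral_bind[where K = borel and B = "1 / Im z" and B' = 1, OF _ _ sub])
      show "(\<lambda>t. h (?k t)) \<in> borel_measurable borel" using h(1) by measurable
      show "\<bar>h (?k t)\<bar> \<le> 1 / Im z" for t
        using h(2)[of "?k t"] norm_inverse_diff_le[OF z order_refl, of t] by linarith
      show "finite_measure \<Omega>" by unfold_locales
      show "AE \<omega> in \<Omega>. emeasure (esd (A \<omega>)) (space (esd (A \<omega>))) \<le> ennreal 1"
      proof (rule AE_I2)
        fix \<omega>
        have "prob_space (esd (A \<omega>))" using real_distribution_esd by (rule real_distribution.axioms)
        then show "emeasure (esd (A \<omega>)) (space (esd (A \<omega>))) \<le> ennreal 1" by (simp add: prob_space.emeasure_space_1)
      qed
    qed
    have ik: "integrable (esd (A \<omega>)) ?k" for \<omega>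
      by (rule real_distribution.integrable_cauchy_kernel[OF real_distribution_esd z])
    have "Re (cauchy_transform (expected_esd \<Omega> A) z) = (\<integral>\<omega>. Re (cauchy_transform (esd (A \<omega>)) z) \<partial>\<Omega>)"
      unfolding cauchy_transform_def
      using bind[of Re] E.integrable_cauchy_kernel[OF z] ik abs_Re_le_cmod by (simp add: integral_Re)
    moreover have "(\<integral>\<omega>. Re (cauchy_transform (esd (A \<omega>)) z) \<partial>\<Omega>) = (\<integral>\<omega>. Re (norm_trace n (?a \<omega>) z) \<partial>\<Omega>)"
      using ct[OF _ z] by (intro Bochner_Integration.integral_cong refl) simp
    moreover have "Im (cauchy_transform (expected_esd \<Omega> A) z) = (\<integral>\<omega>. Im (cauchy_transform (esd (A \<omega>)) z) \<partial>\<Omega>)"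
      unfolding cauchy_transform_def
      using bind[of Im] E.integrable_cauchy_kernel[OF z] ik abs_Im_le_cmod by (simp add: integral_Im)
    moreover have "(\<integral>\<omega>. Im (cauchy_transform (esd (A \<omega>)) z) \<partial>\<Omega>) = (\<integral>\<omega>. Im (norm_trace n (?a \<omega>) z) \<partial>\<Omega>)"
      using ct[OF _ z] by (intro Bochner_Integration.integral_cong refl) simp
    ultimately show ?thesis
      using int by (intro complex_eqI) (simp_all add: integral_Re integral_Im)
  qed
qed

text \<open>The real part of 1 - i y G(i y) is the integral of t^2 / (t^2 + y^2), and this function
  is at least 1 / 2 where |t| \<ge> y.\<close>

lemma (in real_distribution) tail_le_cauchy_transform:
  assumes y: "0 < y"
  shows "prob {t. y \<le> \<bar>t\<bar>} \<le> 2 * cmod (1 - \<i> * of_real y * cauchy_transform M (\<i> * of_real y))"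
proof -
  let ?G = "cauchy_transform M (\<i> * of_real y)"
  let ?f = "\<lambda>t. y / ((0 - t)\<^sup>2 + y\<^sup>2)"
  have pos: "0 < (0 - t)\<^sup>2 + y\<^sup>2" for t using y by (intro add_nonneg_pos) auto
  have "integrable M (\<lambda>t. - Im (1 / (\<i> * of_real y - complex_of_real t)))"
    using y by (intro integrable_minus integrable_Im integrable_cauchy_kernel) simp
  then have intf: "integrable M ?f" unfolding neg_Im_cauchy_kernel by simp
  have Im_G: "- Im ?G = (\<integral>t. ?f t \<partial>M)" using Im_cauchy_transform[of "\<i> * of_real y"] y by simp
  have "Re (1 - \<i> * of_real y * ?G) = 1 - y * (- Im ?G)" by simp
  moreover have "(\<integral>t. 1 - y * ?f t \<partial>M) = (\<integral>t. 1 \<partial>M) - (\<integral>t. y * ?f t \<partial>M)"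
    by (intro Bochner_Integration.integral_diff integrable_mult_right intf) simp
  moreover have "(\<integral>t. y * ?f t \<partial>M) = y * (\<integral>t. ?f t \<partial>M)" by (rule integral_mult_right_zero)
  moreover have "(\<integral>t. 1 \<partial>M) = (1 :: real)" using prob_space by simp
  ultimately have "Re (1 - \<i> * of_real y * ?G) = (\<integral>t. 1 - y * ?f t \<partial>M)" unfolding Im_G by (simp only:)
  also have "\<dots> \<ge> (\<integral>t. 1 / 2 * indicator {t. y \<le> \<bar>t\<bar>} t \<partial>M)"
  proof (rule integral_mono)
    show "integrable M (\<lambda>t. 1 - y * ?f t)"
      by (intro Bochner_Integration.integrable_diff integrable_mult_right intf) simp
    have "{t. y \<le> \<bar>t\<bar>} \<in> sets borel" by measurable
    then show "integrable M (\<lambda>t. 1 / 2 * indicator {t. y \<le> \<bar>t\<bar>} t :: real)"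
      by (intro integrable_mult_right integrable_real_indicator) (auto simp: emeasure_eq_measure)
    fix t
    define r where "r = y * ?f t"
    have "r \<le> 1" unfolding r_def using pos[of t] by (simp add: field_simps power2_eq_square)
    moreover have "r \<le> 1 / 2" if "y \<le> \<bar>t\<bar>"
    proof -
      have "y\<^sup>2 \<le> \<bar>t\<bar>\<^sup>2" using that y by (intro power_mono) auto
      then show ?thesis unfolding r_def using pos[of t] by (simp add: field_simps power2_eq_square)
    qed
    ultimately show "1 / 2 * indicator {t. y \<le> \<bar>t\<bar>} t \<le> 1 - y * ?f t" unfolding r_def[symmetric] by (auto simp: indicator_def)
  qed
  also have "(\<integral>t. 1 / 2 * indicator {t. y \<le> \<bar>t\<bar>} t \<partial>M) = 1 / 2 * prob {t. y \<le> \<bar>t\<bar>}" by simp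
  finally have "prob {t. y \<le> \<bar>t\<bar>} \<le> 2 * Re (1 - \<i> * of_real y * ?G)" by simp
  also have "\<dots> \<le> 2 * cmod (1 - \<i> * of_real y * ?G)" by (intro mult_left_mono complex_Re_le_cmod) simp
  finally show ?thesis .
qed

section \<open>From Wigner matrices to the product space\<close>

lemma model_of_wigner_matrix:
  fixes p q :: real
  assumes X: "X \<in> carrier_mat n n" "transpose_mat X = X"
  defines "W \<equiv> (1 / sqrt (real n)) \<cdot>\<^sub>m X"
  defines "A \<equiv> p \<cdot>\<^sub>m W + q \<cdot>\<^sub>m row_sum_mat W"
  shows "A \<in> carrier_mat n n" "transpose_mat A = A"
    and "i < n \<Longrightarrow> k < n \<Longrightarrow> A $$ (i, k) = model p q n (\<lambda>e. X $$ e) i k"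
proof -
  have sym: "X $$ (i, k) = X $$ (k, i)" if "i < n" "k < n" for i k
  proof -
    have "transpose_mat X $$ (i, k) = X $$ (k, i)" using X(1) that by simp
    then show ?thesis using X(2) by simp
  qed
  have W: "W \<in> carrier_mat n n" using X unfolding W_def by simp
  show A: "A \<in> carrier_mat n n" using W unfolding A_def row_sum_mat_def mat_diag_def by simp
  have e: "entry (\<lambda>e. X $$ e) i k = X $$ (i, k)" if "i < n" "k < n" for i k
    using sym[OF that] by (auto simp: entry_def min_def max_def)
  have Aik: "A $$ (i, k) = model p q n (\<lambda>e. X $$ e) i k" if ik: "i < n" "k < n" for i k
  proof -
    have "A $$ (i, k) = p * (X $$ (i, k) / sqrt (real n)) + (if i = k then q * (\<Sum>l<n. X $$ (i, l) / sqrt (real n)) else 0)"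
      using X W ik unfolding A_def row_sum_mat_def mat_diag_def by (auto simp: W_def)
    also have "\<dots> = model p q n (\<lambda>e. X $$ e) i k"
      using ik by (simp add: model_def e add_divide_distrib sum_divide_distrib[symmetric])
    finally show ?thesis .
  qed
  then show "i < n \<Longrightarrow> k < n \<Longrightarrow> A $$ (i, k) = model p q n (\<lambda>e. X $$ e) i k" .
  show "transpose_mat A = A"
  proof (rule eq_matI)
    fix i k assume "i < dim_row A" "k < dim_col A"
    then have ik: "i < n" "k < n" using A by auto
    then show "transpose_mat A $$ (i, k) = A $$ (i, k)"
      using A sym_array_model[of n p q "\<lambda>e. X $$ e"] unfolding sym_array_def by (simp add: Aik)
  qed (use A in auto)
qed

lemma real_wigner_moment_bound:
  assumes "real_wigner \<Omega> X"
  obtains K :: real where "1 \<le> K"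
    "\<And>n e l. e \<in> pair_index n \<Longrightarrow> l \<in> {1, 2, 3, 4} \<Longrightarrow> (\<integral>\<^sup>+\<omega>. ennreal (\<bar>X n \<omega> $$ e\<bar> ^ l) \<partial>\<Omega> n) \<le> ennreal K"
proof -
  let ?S = "\<lambda>l. \<Squnion>n. \<Squnion>(j, k)\<in>{(j, k). j \<le> k \<and> k < n}. \<integral>\<^sup>+\<omega>. ennreal (\<bar>X n \<omega> $$ (j, k)\<bar> ^ l) \<partial>\<Omega> n"
  have fin: "?S l < \<infinity>" for l using assms unfolding real_wigner_def by blast
  \<comment> \<open>The sum of the four suprema serves all orders in use at once, and the summand 1
    makes it at least 1.\<close>
  define K where "K = 1 + (\<Sum>l\<in>{1, 2, 3, 4}. enn2real (?S l))"
  have "1 \<le> K" unfolding K_def by (simp add: sum_nonneg)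
  moreover have "(\<integral>\<^sup>+\<omega>. ennreal (\<bar>X n \<omega> $$ e\<bar> ^ l) \<partial>\<Omega> n) \<le> ennreal K" if e: "e \<in> pair_index n" and l: "l \<in> {1, 2, 3, 4}" for n e l
  proof -
    obtain j k where jk: "e = (j, k)" "j \<le> k" "k < n" using e by (auto simp: pair_index_def)
    have "(\<integral>\<^sup>+\<omega>. ennreal (\<bar>X n \<omega> $$ e\<bar> ^ l) \<partial>\<Omega> n) \<le> (\<Squnion>(j, k)\<in>{(j, k). j \<le> k \<and> k < n}. \<integral>\<^sup>+\<omega>. ennreal (\<bar>X n \<omega> $$ (j, k)\<bar> ^ l) \<partial>\<Omega> n)"
      using jk by (intro SUP_upper2[of "(j, k)"]) auto
    also have "\<dots> \<le> ?S l" by (rule SUP_upper) simp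
    also have "\<dots> = ennreal (enn2real (?S l))" using fin[of l] by simp
    also have "\<dots> \<le> ennreal K"
    proof (rule ennreal_leI)
      have "enn2real (?S l) \<le> (\<Sum>l\<in>{1, 2, 3, 4}. enn2real (?S l))" using l by (intro member_le_sum) auto
      then show "enn2real (?S l) \<le> K" unfolding K_def by simp
    qed
    finally show ?thesis .
  qed
  ultimately show thesis by (rule that)
qed

text \<open>The point mass outside the index set makes this a family of probability measures on all
  pairs, as the product space asks for.\<close>

definition entry_law :: "(nat \<Rightarrow> 'a measure) \<Rightarrow> (nat \<Rightarrow> 'a \<Rightarrow> real mat) \<Rightarrow> nat \<Rightarrow> nat \<times> nat \<Rightarrow> real measure" where
  "entry_law \<Omega> X n e = (if e \<in> pair_index n then distr (\<Omega> n) borel (\<lambda>\<omega>. X n \<omega> $$ e) else return borel 0)"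

lemma real_wigner_measurable:
  assumes "real_wigner \<Omega> X" "e \<in> pair_index n"
  shows "(\<lambda>\<omega>. X n \<omega> $$ e) \<in> borel_measurable (\<Omega> n)"
proof -
  obtain j k where jk: "e = (j, k)" "j \<le> k" "k < n" using assms(2) by (auto simp: pair_index_def)
  have "prob_space (\<Omega> n)" using assms(1) unfolding real_wigner_def by blast
  moreover have "prob_space.indep_vars (\<Omega> n) (\<lambda>_. borel) (\<lambda>(j, k) \<omega>. X n \<omega> $$ (j, k)) {(j, k). j \<le> k \<and> k < n}"
    using assms(1) unfolding real_wigner_def by blast
  ultimately have "(case (j, k) of (j, k) \<Rightarrow> \<lambda>\<omega>. X n \<omega> $$ (j, k)) \<in> borel_measurable (\<Omega> n)"
    using jk unfolding prob_space.indep_vars_def2[OF \<open>prob_space (\<Omega> n)\<close>] by blast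
  then show ?thesis using jk by simp
qed

lemma wigner_product_entry_law:
  assumes rw: "real_wigner \<Omega> X" and n: "0 < n" and z: "1 \<le> Im z" and K: "1 \<le> K"
    and mom: "\<And>n e l. e \<in> pair_index n \<Longrightarrow> l \<in> {1, 2, 3, 4} \<Longrightarrow> (\<integral>\<^sup>+\<omega>. ennreal (\<bar>X n \<omega> $$ e\<bar> ^ l) \<partial>\<Omega> n) \<le> ennreal K"
  shows "wigner_product (entry_law \<Omega> X n) n K z"
proof (rule wigner_product.intro)
  have p: "prob_space (\<Omega> n)" using rw unfolding real_wigner_def by blast
  note meas = real_wigner_measurable[OF rw]
  show "0 < n" "1 \<le> Im z" "1 \<le> K" by fact+
  show "prob_space (entry_law \<Omega> X n e)" for e
    unfolding entry_law_def by (cases "e \<in> pair_index n") (simp_all add: prob_space.prob_space_distr[OF p meas] prob_space_return)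
  show "sets (entry_law \<Omega> X n e) = sets borel" for e by (simp add: entry_law_def)
  show "(\<integral>\<^sup>+t. ennreal (\<bar>t\<bar> ^ l) \<partial>entry_law \<Omega> X n e) \<le> ennreal K" if "e \<in> pair_index n" "l \<in> {1, 2, 3, 4}" for e l
    using mom[OF that] that(1) meas[OF that(1)] by (simp add: entry_law_def nn_integral_distr)
  fix i k assume ik: "i < k" "k < n"
  then have e: "(i, k) \<in> pair_index n" by (simp add: pair_index_def)
  have mv: "(\<integral>\<omega>. X n \<omega> $$ (i, k) \<partial>\<Omega> n) = 0" "(\<integral>\<omega>. (X n \<omega> $$ (i, k))\<^sup>2 \<partial>\<Omega> n) = 1"
    using rw ik unfolding real_wigner_def by blast+
  show "(\<integral>t. t \<partial>entry_law \<Omega> X n (i, k)) = 0"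
    using mv e meas[OF e] by (simp add: entry_law_def integral_distr)
  have "integrable (\<Omega> n) (\<lambda>\<omega>. (X n \<omega> $$ (i, k))\<^sup>2)"
    using mom[OF e, of 2] meas[OF e] by (intro integrableI_nonneg) (auto simp: le_less_trans)
  then have "(\<integral>\<^sup>+\<omega>. ennreal ((X n \<omega> $$ (i, k))\<^sup>2) \<partial>\<Omega> n) = 1"
    using mv by (subst nn_integral_eq_integral) auto
  then show "(\<integral>\<^sup>+t. ennreal (t\<^sup>2) \<partial>entry_law \<Omega> X n (i, k)) = 1"
    using e meas[OF e] by (simp add: entry_law_def nn_integral_distr)
qed

text \<open>Independence says that the joint law of the upper triangle is the product of the entry
  laws, so the expectation becomes an integral over the product space by a change of
  variables.\<close>

lemma expected_norm_trace_eq_mean_tr: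
  assumes rw: "real_wigner \<Omega> X" and n: "0 < n"
    and wp: "wigner_product (entry_law \<Omega> X n) n K z"
  shows "(\<integral>\<omega>. norm_trace n (model p q n (\<lambda>e. X n \<omega> $$ e)) z \<partial>\<Omega> n) = wigner_product.mean_tr (entry_law \<Omega> X n) n z p q"
proof -
  interpret wigner_product "entry_law \<Omega> X n" n K z p q by fact
  let ?I = "pair_index n"
  have p: "prob_space (\<Omega> n)" using rw unfolding real_wigner_def by blast
  interpret prob_space "\<Omega> n" by fact
  note meas = real_wigner_measurable[OF rw]
  have ne: "?I \<noteq> {}" using n by (auto simp: pair_index_def)
  have ind: "indep_vars (\<lambda>_. borel) (\<lambda>e \<omega>. X n \<omega> $$ e) ?I"
  proof -
    have eq: "(\<lambda>(j, k) \<omega>. X n \<omega> $$ (j, k)) = (\<lambda>e \<omega>. X n \<omega> $$ e)" by (auto simp: fun_eq_iff)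
    have "indep_vars (\<lambda>_. borel) (\<lambda>(j, k) \<omega>. X n \<omega> $$ (j, k)) {(j, k). j \<le> k \<and> k < n}"
      using rw unfolding real_wigner_def by blast
    then show ?thesis unfolding eq pair_index_def .
  qed
  have "distr (\<Omega> n) (\<Pi>\<^sub>M e\<in>?I. borel) (\<lambda>\<omega>. \<lambda>e\<in>?I. X n \<omega> $$ e) = (\<Pi>\<^sub>M e\<in>?I. distr (\<Omega> n) borel (\<lambda>\<omega>. X n \<omega> $$ e))"
    by (rule iffD1[OF indep_vars_iff_distr_eq_PiM'[OF ne] ind]) (rule meas)
  also have "\<dots> = Pi\<^sub>M ?I (entry_law \<Omega> X n)" by (rule PiM_cong) (auto simp: entry_law_def)
  finally have d: "distr (\<Omega> n) (\<Pi>\<^sub>M e\<in>?I. borel) (\<lambda>\<omega>. \<lambda>e\<in>?I. X n \<omega> $$ e) = Pi\<^sub>M ?I (entry_law \<Omega> X n)" .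
  have s: "sets (\<Pi>\<^sub>M e\<in>?I. borel) = sets (Pi\<^sub>M ?I (entry_law \<Omega> X n))"
    by (rule sets_PiM_cong) (simp_all add: entry_law_def)
  have t: "(\<lambda>x. norm_trace n (model p q n x) z) \<in> borel_measurable (\<Pi>\<^sub>M e\<in>?I. borel)"
    using measurable_tr measurable_cong_sets[OF s refl] by blast
  have Y: "(\<lambda>\<omega>. \<lambda>e\<in>?I. X n \<omega> $$ e) \<in> measurable (\<Omega> n) (\<Pi>\<^sub>M e\<in>?I. borel)"
    using meas by (intro measurable_restrict) auto
  have "mean_tr = (\<integral>\<omega>. norm_trace n (model p q n (\<lambda>e\<in>?I. X n \<omega> $$ e)) z \<partial>\<Omega> n)"
    unfolding mean_tr_def d[symmetric] by (rule integral_distr[OF Y t])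
  \<comment> \<open>The restriction to the index set is invisible, as the resolvent reads only
    entries with indices below \<open>n\<close>.\<close>
  also have "\<dots> = (\<integral>\<omega>. norm_trace n (model p q n (\<lambda>e. X n \<omega> $$ e)) z \<partial>\<Omega> n)"
  proof (rule Bochner_Integration.integral_cong[OF refl])
    fix \<omega>
    have "resolvent n (model p q n (\<lambda>e\<in>?I. X n \<omega> $$ e)) z = resolvent n (model p q n (\<lambda>e. X n \<omega> $$ e)) z"
      by (rule resolvent_cong) (simp add: model_def entry_def index_min_max)
    then show "norm_trace n (model p q n (\<lambda>e\<in>?I. X n \<omega> $$ e)) z = norm_trace n (model p q n (\<lambda>e. X n \<omega> $$ e)) z"
      unfolding norm_trace_def by simp
  qed
  finally show ?thesis by simp
qed

section \<open>Tightness and limits for the approximate equation\<close>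

text \<open>At \<zeta> = i y - v G the value F = F_N(\<zeta>) is within B = C + v of i y, so 1 - i y
  G_N(\<zeta>) = (F - i y) / F has modulus at most B / (y - B). Exchanging G_N(\<zeta>) for G costs
  y \<delta>, and the bound on the tail doubles the sum.\<close>

lemma approx_subordination_tail:
  assumes E: "real_distribution E" and near: "near_identity N C Y"
    and y: "Y \<le> y" "1 \<le> y" "C + v < y" and v: "0 \<le> v"
    and approx: "cmod (cauchy_transform E (\<i> * of_real y)
      - cauchy_transform N (\<i> * of_real y - of_real v * cauchy_transform E (\<i> * of_real y))) \<le> \<delta>"
  shows "measure E {t. y \<le> \<bar>t\<bar>} \<le> 2 * ((C + v) / (y - (C + v)) + y * \<delta>)"
proof -
  interpret real_distribution E by fact
  define G where "G = cauchy_transform E (\<i> * of_real y)"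
  define \<zeta> where "\<zeta> = \<i> * of_real y - of_real v * G"
  define F where "F = recip_cauchy N \<zeta>"
  define B where "B = C + v"
  have G1: "cmod G \<le> 1" unfolding G_def using norm_cauchy_transform_le[of 1 "\<i> * of_real y"] y by simp
  have ImG: "Im G \<le> 0" unfolding G_def using Im_cauchy_transform_neg[of "\<i> * of_real y"] y by simp
  then have "y \<le> Im \<zeta>" unfolding \<zeta>_def using v by (simp add: mult_nonneg_nonpos)
  then have F: "cmod (F - \<zeta>) \<le> C" using near y unfolding near_identity_def F_def by auto
  have "cmod (F - \<i> * of_real y) \<le> cmod (F - \<zeta>) + cmod (of_real v * G)"
    using norm_triangle_ineq[of "F - \<zeta>" "- (of_real v * G)"] unfolding \<zeta>_def by simp
  moreover have "cmod (of_real v * G) \<le> v" using v G1 by (simp add: norm_mult mult_left_le)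
  ultimately have FB: "cmod (F - \<i> * of_real y) \<le> B" using F unfolding B_def by linarith
  moreover have "cmod (\<i> * of_real y) \<le> cmod F + cmod (F - \<i> * of_real y)"
    using norm_triangle_ineq4[of F "F - \<i> * of_real y"] by simp
  moreover have "cmod (\<i> * of_real y) = y" using y by (simp add: norm_mult)
  ultimately have Fy: "y - B \<le> cmod F" by linarith
  have yB: "0 < y - B" using y unfolding B_def by simp
  then have F0: "F \<noteq> 0" using Fy by auto
  let ?N = "cauchy_transform N \<zeta>"
  have "?N = 1 / F" unfolding F_def recip_cauchy_def by simp
  then have "1 - \<i> * of_real y * ?N = (F - \<i> * of_real y) / F" using F0 by (simp add: field_simps)
  then have a: "cmod (1 - \<i> * of_real y * ?N) \<le> B / (y - B)"
    using frac_le[OF _ FB yB Fy] order_trans[OF norm_ge_zero FB] by (simp add: norm_divide)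
  have "cmod (\<i> * of_real y * (G - ?N)) \<le> y * \<delta>"
    using approx y unfolding G_def[symmetric] \<zeta>_def[symmetric] by (simp add: norm_mult)
  moreover have "1 - \<i> * of_real y * G = (1 - \<i> * of_real y * ?N) - \<i> * of_real y * (G - ?N)"
    by (simp add: algebra_simps)
  then have "cmod (1 - \<i> * of_real y * G) \<le> cmod (1 - \<i> * of_real y * ?N) + cmod (\<i> * of_real y * (G - ?N))"
    using norm_triangle_ineq4 by metis
  ultimately have "cmod (1 - \<i> * of_real y * G) \<le> B / (y - B) + y * \<delta>" using a by linarith
  then show ?thesis using tail_le_cauchy_transform[of y] y unfolding G_def[symmetric] B_def[symmetric] by simp
qed

lemma tight_of_approx_subordination:
  assumes E: "\<And>n. real_distribution (E n)" and near: "near_identity N C Y" and v: "0 \<le> v"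
    and lim: "\<And>z. 1 \<le> Im z \<Longrightarrow> (\<lambda>n. cauchy_transform (E n) z
      - cauchy_transform N (z - of_real v * cauchy_transform (E n) z)) \<longlonglongrightarrow> 0"
  shows "tight E"
  unfolding tight_def
proof (intro conjI allI impI)
  show "real_distribution (E n)" for n by (rule E)
  fix \<epsilon> :: real assume \<epsilon>: "0 < \<epsilon>"
  define B where "B = C + v"
  have B: "0 \<le> B" and Y: "0 < Y" using near v unfolding B_def near_identity_def by auto
  \<comment> \<open>Makes B / (y - B) \<le> \<epsilon> / 8; with an approximation error of at most
    \<epsilon> / (8 y) the tail is then at most \<epsilon> / 2. As the error is multiplied by y, the
    height is fixed before n is taken large.\<close>
  define y where "y = Y + 1 + B + 8 * B / \<epsilon>"
  have y: "Y \<le> y" "1 \<le> y" "C + v < y" "8 * B / \<epsilon> \<le> y - B" "B < y" 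
    using B Y divide_nonneg_pos[of "8 * B" \<epsilon>] \<epsilon> unfolding y_def B_def[symmetric] by linarith+
  have "0 < \<epsilon> / (8 * y)" using \<epsilon> y by simp
  from LIMSEQ_D[OF lim[of "\<i> * of_real y"] this] y
  obtain n0 where n0: "\<And>n. n0 \<le> n \<Longrightarrow> cmod (cauchy_transform (E n) (\<i> * of_real y)
      - cauchy_transform N (\<i> * of_real y - of_real v * cauchy_transform (E n) (\<i> * of_real y))) \<le> \<epsilon> / (8 * y)"
    by (auto intro: less_imp_le)
  have late: "measure (E n) {t. y \<le> \<bar>t\<bar>} < \<epsilon>" if "n0 \<le> n" for n
  proof -
    have "B / (y - B) \<le> \<epsilon> / 8" using y \<epsilon> by (simp add: field_simps)
    moreover have "y * (\<epsilon> / (8 * y)) \<le> \<epsilon> / 8" using y by simp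
    ultimately have "2 * (B / (y - B) + y * (\<epsilon> / (8 * y))) \<le> 2 * (\<epsilon> / 8 + \<epsilon> / 8)"
      by (intro mult_left_mono add_mono) auto
    moreover have "2 * (\<epsilon> / 8 + \<epsilon> / 8) < \<epsilon>" using \<epsilon> by simp
    ultimately show ?thesis
      using approx_subordination_tail[OF E near y(1-3) v n0[OF that]] unfolding B_def[symmetric] by (meson le_less_trans)
  qed
  \<comment> \<open>Needed for the finitely many laws before \<open>n0\<close>, each of which is
    tight by itself.\<close>
  have "\<forall>\<^sub>F k in sequentially. 1 - \<epsilon> < measure (E n) {- real k<..real k}" for n
  proof -
    interpret real_distribution "E n" by (rule E)
    have "(\<lambda>k. prob {- real k<..real k}) \<longlonglongrightarrow> prob (\<Union>k. {- real k<..real k})"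
      by (rule finite_Lim_measure_incseq) (auto simp: incseq_def)
    moreover have "(\<Union>k. {- real k<..real k}) = UNIV"
    proof (rule UNIV_eq_I[symmetric])
      fix x :: real
      obtain k where "\<bar>x\<bar> < real k" using reals_Archimedean2 by blast
      then show "x \<in> (\<Union>k. {- real k<..real k})" by (intro UN_I[of k]) auto
    qed
    ultimately have "(\<lambda>k. prob {- real k<..real k}) \<longlonglongrightarrow> 1" using prob_space by simp
    then show ?thesis by (rule order_tendstoD) (use \<epsilon> in simp)
  qed
  then have "\<forall>\<^sub>F k in sequentially. \<forall>n\<in>{..<n0}. 1 - \<epsilon> < measure (E n) {- real k<..real k}"
    by (intro eventually_ball_finite) auto
  moreover have "\<forall>\<^sub>F k in sequentially. y < real k"
    using filterlim_real_sequentially unfolding filterlim_at_top_dense by blast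
  ultimately have "\<forall>\<^sub>F k in sequentially. (\<forall>n\<in>{..<n0}. 1 - \<epsilon> < measure (E n) {- real k<..real k}) \<and> y < real k"
    by (rule eventually_conj)
  then obtain k where k: "\<forall>n\<in>{..<n0}. 1 - \<epsilon> < measure (E n) {- real k<..real k}" "y < real k"
    unfolding eventually_sequentially by blast
  have "1 - \<epsilon> < measure (E n) {- real k<..real k}" for n
  proof (cases "n < n0")
    case False
    interpret real_distribution "E n" by (rule E)
    have m: "{t. y \<le> \<bar>t\<bar>} \<in> sets borel" by measurable
    then have "prob (UNIV - {t. y \<le> \<bar>t\<bar>}) = 1 - prob {t. y \<le> \<bar>t\<bar>}" using prob_compl[of "{t. y \<le> \<bar>t\<bar>}"] by simp
    moreover have "prob (UNIV - {t. y \<le> \<bar>t\<bar>}) \<le> prob {- real k<..real k}"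
      using k(2) by (intro finite_measure_mono) auto
    ultimately show ?thesis using late[of n] False by simp
  qed (use k in auto)
  then show "\<exists>a b. a < b \<and> (\<forall>n. 1 - \<epsilon> < measure (E n) {a<..b})"
    using k(2) y(2) by (intro exI[of _ "- real k"] exI[of _ "real k"]) auto
qed

text \<open>The Cauchy kernel is bounded and continuous, so weak convergence carries over to the
  transforms at \<open>z\<close>. The arguments of G_N stay at height at least 1, where G_N has
  Lipschitz constant 1, and so the equation survives the limit.\<close>

lemma approx_subordination_limit:
  assumes E: "\<And>n. real_distribution (E n)" and N: "real_distribution N" and R: "real_distribution R"
    and v: "0 \<le> v" and z: "1 \<le> Im z" and conv: "weak_conv_m E R"
    and lim: "(\<lambda>n. cauchy_transform (E n) z - cauchy_transform N (z - of_real v * cauchy_transform (E n) z)) \<longlonglongrightarrow> 0"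
  shows "cauchy_transform R z = cauchy_transform N (z - of_real v * cauchy_transform R z)"
proof -
  let ?\<zeta> = "\<lambda>R. z - of_real v * cauchy_transform R z"
  have nz: "z - complex_of_real t \<noteq> 0" for t using z by (auto simp: complex_eq_iff)
  have cauchy: "(\<lambda>n. cauchy_transform (E n) z) \<longlonglongrightarrow> cauchy_transform R z"
    unfolding cauchy_transform_def
  proof (rule weak_conv_imp_integral_bdd_continuous_conv[OF E R conv, where B = 1])
    show "isCont (\<lambda>t. 1 / (z - complex_of_real t)) t" for t by (intro continuous_intros nz)
    show "cmod (1 / (z - complex_of_real t)) \<le> 1" for t using norm_inverse_diff_le[of 1 z t] z by simp
  qed
  then have \<zeta>: "(\<lambda>n. ?\<zeta> (E n)) \<longlonglongrightarrow> ?\<zeta> R" by (intro tendsto_intros)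
  have Im: "1 \<le> Im (?\<zeta> M)" if "real_distribution M" for M
    using real_distribution.Im_cauchy_transform_neg[OF that, of z] z v mult_nonneg_nonpos[of v "Im (cauchy_transform M z)"] by simp
  have le: "cmod (cauchy_transform N (?\<zeta> (E n)) - cauchy_transform N (?\<zeta> R)) \<le> cmod (?\<zeta> (E n) - ?\<zeta> R)" for n
    using real_distribution.cauchy_transform_lipschitz[OF N, of 1, OF _ Im[OF R] Im[OF E]] by simp
  have "(\<lambda>n. cmod (?\<zeta> (E n) - ?\<zeta> R)) \<longlonglongrightarrow> 0" by (rule tendsto_norm_zero[OF LIM_zero[OF \<zeta>]])
  from Lim_null_comparison[OF always_eventually[OF allI] this, OF le]
  have "(\<lambda>n. cauchy_transform N (?\<zeta> (E n))) \<longlonglongrightarrow> cauchy_transform N (?\<zeta> R)" by (rule LIM_zero_cancel)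
  from LIMSEQ_unique[OF tendsto_diff[OF cauchy this] lim] show ?thesis by simp
qed

text \<open>Every weak limit along a subsequence satisfies the exact equation and is therefore the
  free convolution. With tightness, equality of all these limits gives convergence of the whole
  sequence.\<close>

lemma weak_conv_semicircle_normal_free_conv:
  assumes E: "\<And>n. real_distribution (E n)"
    and lim: "\<And>z. 1 \<le> Im z \<Longrightarrow> (\<lambda>n. cauchy_transform (E n) z
      - cauchy_transform (normal_distr 0 (q\<^sup>2)) (z - of_real (p\<^sup>2) * cauchy_transform (E n) z)) \<longlonglongrightarrow> 0"
  shows "weak_conv_m E (semicircle 0 (p\<^sup>2) \<boxplus> normal_distr 0 (q\<^sup>2))"
proof -
  let ?N = "normal_distr 0 (q\<^sup>2)" and ?L = "semicircle 0 (p\<^sup>2) \<boxplus> normal_distr 0 (q\<^sup>2)"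
  obtain C Y where "near_identity ?N C Y" using normal_distr_near_identity by blast
  from tight_of_approx_subordination[OF E this _ lim] have tight: "tight E" by simp
  have limit: "?L = R" if s: "strict_mono s" and R: "real_distribution R" and "weak_conv_m (E \<circ> s) R" for s R
  proof (rule semicircle_normal_free_conv_eqI[OF R])
    fix z assume z: "1 \<le> Im z"
    have c: "weak_conv_m (\<lambda>n. E (s n)) R" using that(3) by (simp add: comp_def)
    show "cauchy_transform R z = cauchy_transform ?N (z - of_real (p\<^sup>2) * cauchy_transform R z)"
      using LIMSEQ_subseq_LIMSEQ[OF lim[OF z] s]
      by (intro approx_subordination_limit[OF E real_distribution_normal_distr R zero_le_power2 z c]) (simp add: comp_def)
  qed
  \<comment> \<open>One limit law is enough to show that the definite description in
    \<open>free_conv\<close> denotes a distribution.\<close>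
  obtain r R where "strict_mono r" "real_distribution R" "weak_conv_m (E \<circ> id \<circ> r) R"
    using tight_imp_convergent_subsubsequence[OF tight strict_mono_id] by blast
  then have "real_distribution ?L" using limit[of r R] by simp
  from E this tight show ?thesis
  proof (rule tight_subseq_weak_converge)
    fix s R assume *: "strict_mono s" "real_distribution R" "weak_conv_m (E \<circ> s) R"
    show "weak_conv_m (E \<circ> s) ?L" using *(3) unfolding limit[OF *] .
  qed
qed

theorem corollary3p2p3:
  fixes \<Omega> :: "nat \<Rightarrow> 'a measure" and X W D :: "nat \<Rightarrow> 'a \<Rightarrow> real mat" and p q :: real
  assumes "real_wigner \<Omega> X"
    and "\<And>n \<omega>. W n \<omega> = (1 / sqrt (real n)) \<cdot>\<^sub>m X n \<omega>"
    and "\<And>n \<omega>. D n \<omega> = row_sum_mat (W n \<omega>)"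
  shows "weak_conv_m (\<lambda>n. expected_esd (\<Omega> n) (\<lambda>\<omega>. p \<cdot>\<^sub>m W n \<omega> + q \<cdot>\<^sub>m D n \<omega>))
           (semicircle 0 (p\<^sup>2) \<boxplus> normal_distr 0 (q\<^sup>2))"
proof -
  note rw = assms(1)
  define A where "A n \<omega> = p \<cdot>\<^sub>m W n \<omega> + q \<cdot>\<^sub>m D n \<omega>" for n \<omega>
  \<comment> \<open>Sizes start at 1, because a matrix of size 0 has no eigenvalues to average over.
    The shift is undone at the end, as one index does not affect the limit.\<close>
  define E where "E n = expected_esd (\<Omega> (Suc n)) (A (Suc n))" for n
  obtain K :: real where K: "1 \<le> K"
    and mom: "\<And>n e l. e \<in> pair_index n \<Longrightarrow> l \<in> {1, 2, 3, 4} \<Longrightarrow> (\<integral>\<^sup>+\<omega>. ennreal (\<bar>X n \<omega> $$ e\<bar> ^ l) \<partial>\<Omega> n) \<le> ennreal K"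
    by (rule real_wigner_moment_bound[OF rw]) blast
  have prob: "prob_space (\<Omega> n)" for n using rw unfolding real_wigner_def by blast
  have A: "A n \<omega> \<in> carrier_mat n n" "transpose_mat (A n \<omega>) = A n \<omega>"
    "\<And>i k. i < n \<Longrightarrow> k < n \<Longrightarrow> A n \<omega> $$ (i, k) = model p q n (\<lambda>e. X n \<omega> $$ e) i k" if "\<omega> \<in> space (\<Omega> n)" for n \<omega>
  proof -
    have "\<forall>n. \<forall>\<omega>\<in>space (\<Omega> n). X n \<omega> \<in> carrier_mat n n \<and> transpose_mat (X n \<omega>) = X n \<omega>"
      using rw unfolding real_wigner_def by (elim conjE)
    from bspec[OF spec[OF this] that] have X: "X n \<omega> \<in> carrier_mat n n" "transpose_mat (X n \<omega>) = X n \<omega>"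
      by (rule conjunct1, rule conjunct2)
    note m = model_of_wigner_matrix[OF X]
    show "A n \<omega> \<in> carrier_mat n n" unfolding A_def assms(2,3) by (rule m(1))
    show "transpose_mat (A n \<omega>) = A n \<omega>" unfolding A_def assms(2,3) by (rule m(2))
    show "A n \<omega> $$ (i, k) = model p q n (\<lambda>e. X n \<omega> $$ e) i k" if "i < n" "k < n" for i k
      unfolding A_def assms(2,3) using that by (rule m(3))
  qed
  have meas: "(\<lambda>\<omega>. A n \<omega> $$ (i, k)) \<in> borel_measurable (\<Omega> n)" if ik: "i < n" "k < n" for n i k
  proof -
    have "(\<lambda>\<omega>. entry (\<lambda>e. X n \<omega> $$ e) i l) \<in> borel_measurable (\<Omega> n)" if "l < n" for l
      unfolding entry_def by (rule real_wigner_measurable[OF rw]) (use ik that in \<open>auto simp: pair_index_def\<close>)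
    then have "(\<lambda>\<omega>. model p q n (\<lambda>e. X n \<omega> $$ e) i k) \<in> borel_measurable (\<Omega> n)"
      unfolding model_def using ik by (cases "i = k") simp_all
    then show ?thesis by (subst measurable_cong[OF A(3)[OF _ ik]])
  qed
  have rd: "real_distribution (E n)" for n
    unfolding E_def by (rule expected_esd_properties(1)[OF prob zero_less_Suc _ meas]) (use A in blast)+
  let ?N = "normal_distr 0 (q\<^sup>2)"
  let ?c = "p\<^sup>2 * ((2 * K + 9) / 2 + 1 + 2 * (\<bar>p\<bar> + \<bar>q\<bar>) * K + (1 + 4 * (\<bar>p\<bar> + \<bar>q\<bar>)\<^sup>2 * K) / 2) + \<bar>p + q\<bar> * K
      + \<bar>p * q\<bar> * (3 * K + 1) / 4"
  let ?d = "2 * q\<^sup>2 + 6 * \<bar>q\<bar> ^ 3 + 24 * q ^ 4"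
  let ?err = "\<lambda>n. ?c * real (Suc n) powr (- (1 / 4)) + K * (1 / sqrt (real (Suc n))) * ?d"
  let ?L = "semicircle 0 (p\<^sup>2) \<boxplus> ?N"
  have E: "weak_conv_m E ?L"
  proof (rule weak_conv_semicircle_normal_free_conv[OF rd])
    fix z :: complex assume z: "1 \<le> Im z"
    let ?G = "\<lambda>n. cauchy_transform (E n) z"
    have le: "cmod (?G n - cauchy_transform ?N (z - of_real (p\<^sup>2) * ?G n)) \<le> ?err n" for n
    proof -
      let ?m = "Suc n"
      have wp: "wigner_product (entry_law \<Omega> X ?m) ?m K z"
        by (rule wigner_product_entry_law[OF rw zero_less_Suc z K mom])
      have "?G n = (\<integral>\<omega>. norm_trace ?m (\<lambda>i k. A ?m \<omega> $$ (i, k)) z \<partial>\<Omega> ?m)"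
        unfolding E_def by (rule expected_esd_properties(2)[OF prob zero_less_Suc _ meas]) (use A z in auto)
      also have "\<dots> = (\<integral>\<omega>. norm_trace ?m (model p q ?m (\<lambda>e. X ?m \<omega> $$ e)) z \<partial>\<Omega> ?m)"
      proof (rule Bochner_Integration.integral_cong[OF refl])
        fix \<omega> assume \<omega>: "\<omega> \<in> space (\<Omega> ?m)"
        have "resolvent ?m (\<lambda>i k. A ?m \<omega> $$ (i, k)) z = resolvent ?m (model p q ?m (\<lambda>e. X ?m \<omega> $$ e)) z"
          by (rule resolvent_cong) (rule A(3)[OF \<omega>])
        then show "norm_trace ?m (\<lambda>i k. A ?m \<omega> $$ (i, k)) z = norm_trace ?m (model p q ?m (\<lambda>e. X ?m \<omega> $$ e)) z"
          unfolding norm_trace_def by simp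
      qed
      also have "\<dots> = wigner_product.mean_tr (entry_law \<Omega> X ?m) ?m z p q"
        by (rule expected_norm_trace_eq_mean_tr[OF rw zero_less_Suc wp])
      finally show ?thesis using wigner_product.mean_tr_approx_equation[OF wp, of p q] by simp
    qed
    have "?err \<longlonglongrightarrow> 0"
    proof -
      have "(\<lambda>n. real (Suc n) powr (- (1 / 4))) \<longlonglongrightarrow> 0" "(\<lambda>n. 1 / sqrt (real (Suc n))) \<longlonglongrightarrow> 0"
        by real_asymp+
      then show ?thesis by (intro tendsto_add_zero tendsto_mult_right_zero tendsto_mult_left_zero)
    qed
    then show "(\<lambda>n. ?G n - cauchy_transform ?N (z - of_real (p\<^sup>2) * ?G n)) \<longlonglongrightarrow> 0"
      by (rule Lim_null_comparison[OF always_eventually[OF allI[OF le]]])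
  qed
  have "weak_conv_m (\<lambda>n. expected_esd (\<Omega> n) (A n)) ?L"
    unfolding weak_conv_m_def weak_conv_def
  proof (intro allI impI)
    fix x assume x: "isCont (cdf ?L) x"
    have "(\<lambda>n. cdf (E n) x) \<longlonglongrightarrow> cdf ?L x"
      using E x unfolding weak_conv_m_def weak_conv_def by simp
    then show "(\<lambda>n. cdf (expected_esd (\<Omega> n) (A n)) x) \<longlonglongrightarrow> cdf ?L x"
      unfolding E_def by (rule LIMSEQ_imp_Suc)
  qed
  then show ?thesis unfolding A_def[abs_def] .
qed

end
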